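(* Let $\overline{\Gamma}=(\Gamma,f)$ be a connected Coxeter graph, and let $\widehat{\Gamma}=(\Gamma,\widehat f)$ with $\widehat f(\alpha)=4\cos^2\frac{\pi}{f(\alpha)}$ (and $\widehat f(\alpha)=4$ if $f(\alpha)=\infty$). Then: (1) $\overline{\Gamma}$ belongs to list III if and only if $\widehat g_\rho(x)<4$ for every vertex $x$, where $\widehat g_\rho$ is the $\rho$-degree computed in $\widehat\Gamma$; (2) $\overline{\Gamma}$ belongs to list IV if and only if $\widehat g_\rho(x)\le4$ for every vertex $x$ and there is a vertex $y$ with $\widehat g_\rho(y)=4$.
   Context: $\mathbb N=\{1,2,\dots\}$. Put $\rho(n)=1+\frac{n-1}{n+1}=\frac{2n}{n+1}$ for $n\in\mathbb N$. A Coxeter graph is a finite graph $\Gamma$ (vertex set $\Gamma_v\neq\varnothing$, edge set $\Gamma_e$) without loops and parallel edges, with a function $f:\Gamma_e\to\{3,4,5,\dots\}\cup\{\infty\}$. $\varphi(\alpha)$ is the set of two endpoints of the edge $\alpha$, $\varphi^{-1}(x)=\{\alpha: x\in\varphi(\alpha)\}$, $g(x)=|\varphi^{-1}(x)|$. An edge $\alpha$ of a connected graph is cyclic if deleting it leaves the graph connected; otherwise, with $\varphi(\alpha)=\{x,y\}$, the deletion has two components $\Gamma'(x,\alpha)\ni x$ and $\Gamma'(y,\alpha)\ni y$. $\rho$-degree in $(\Gamma,\widehat f)$: a pair $(x,\alpha)$ with $x\in\varphi(\alpha)=\{x,y\}$ is $\widehat f$-simple if $\alpha$ is not cyclic, $g(y)\le2$,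 $\Gamma'(y,\alpha)$ is a path graph (with at least one vertex), and $\widehat f(\beta)=1$ for all edges $\beta$ of $\Gamma'(y,\alpha)$ (no condition on $\widehat f(\alpha)$). Put $\frac{\partial x}{\partial\alpha}=\rho(|\Gamma'(y,\alpha)_v|)$ if $(x,\alpha)$ is $\widehat f$-simple and $\frac{\partial x}{\partial\alpha}=2$ otherwise. Then $\widehat g_\rho(x)=\sum_{\alpha\in\varphi^{-1}(x)}\widehat f(\alpha)\frac{\partial x}{\partial\alpha}$. Lists (edges have $f=3$ unless stated; $T_{p,q,r}$ is the tree with a vertex whose removal leaves three paths with $p,q,r$ vertices, each joined to that vertex by an end; membership is up to isomorphism): List III: $A_l$ ($l\ge1$): path with $l$ vertices; $B_l$ ($l\ge2$): path with $l$ vertices, one end edge having $f=4$; $D_l=T_{1,1,l-3}$ ($l\ge4$); $E_6=T_{1,2,2}$; $E_7=T_{1,2,3}$; $E_8=T_{1,2,4}$; $F_4$: path with 4 vertices and $f$-values $3,4,3$; $G_2$: one edge with $f=6$; $H_3$: path with 3 vertices and $f$-values $5,3$; $H_4$: path with 4 vertices and $f$-values $5,3,3$; $I_2(p)$ ($p=5$ or $7\le p<\infty$): one edge with $f=p$. List IV: $\widetilde A_1$: one edge with $f=\infty$; $\widetilde A_l$ ($l\ge2$): cycle with $l+1$ vertices; $\widetilde B_2$: path with 3 vertices and $f$-values $4,4$; $\widetilde B_l$ ($l\ge3$): path $a_1,\dots,a_{l-1}$ with $f=4$ on the edge $a_{l-2}a_{l-1}$ and two additional leaves attached to $a_1$;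 $\widetilde C_l$ ($l\ge3$): path with $l+1$ vertices, both end edges having $f=4$; $\widetilde D_l$ ($l\ge4$): path with $l-3$ vertices, with two additional leaves attached to each of its two ends (four leaves attached to the single vertex if $l=4$); $\widetilde E_6=T_{2,2,2}$; $\widetilde E_7=T_{1,3,3}$; $\widetilde E_8=T_{1,2,5}$; $\widetilde F_4$: path with 5 vertices and $f$-values $3,3,4,3$; $\widetilde G_2$: path with 3 vertices and $f$-values $3,6$. *)

theory Defs
  imports Complex_Main "HOL-Library.Extended_Nat"
begin

text \<open>An edge is its set of two endpoints, so there are no loops and no parallel edges.
  Labels are kept outside the graph, since the same graph carries both the labels f
  and the real weights derived from them.\<close>

record 'a ugraph =
  verts :: "'a set"
  edges :: "'a set set"

type_synonym 'a labelled = "'a ugraph \<times> ('a set \<Rightarrow> enat)"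

definition coxeter_graph :: "'a ugraph \<Rightarrow> ('a set \<Rightarrow> enat) \<Rightarrow> bool" where
  "coxeter_graph G f \<longleftrightarrow>
     finite (verts G) \<and> verts G \<noteq> {} \<and>
     (\<forall>e\<in>edges G. e \<subseteq> verts G \<and> card e = 2) \<and>
     (\<forall>e\<in>edges G. 3 \<le> f e)"

definition incident :: "'a ugraph \<Rightarrow> 'a \<Rightarrow> 'a set set" where
  "incident G x = {e \<in> edges G. x \<in> e}"

definition degree :: "'a ugraph \<Rightarrow> 'a \<Rightarrow> nat" where
  "degree G x = card (incident G x)"

definition adjacency :: "'a ugraph \<Rightarrow> ('a \<times> 'a) set" where
  "adjacency G = {(u, v). {u, v} \<in> edges G}"

definition connected_graph :: "'a ugraph \<Rightarrow> bool" where
  "connected_graph G \<longleftrightarrow>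
     verts G \<noteq> {} \<and> (\<forall>x\<in>verts G. \<forall>y\<in>verts G. (x, y) \<in> (adjacency G)\<^sup>*)"

definition delete_edge :: "'a ugraph \<Rightarrow> 'a set \<Rightarrow> 'a ugraph" where
  "delete_edge G e = \<lparr>verts = verts G, edges = edges G - {e}\<rparr>"

definition cyclic_edge :: "'a ugraph \<Rightarrow> 'a set \<Rightarrow> bool" where
  "cyclic_edge G e \<longleftrightarrow> e \<in> edges G \<and> connected_graph (delete_edge G e)"

definition component :: "'a ugraph \<Rightarrow> 'a \<Rightarrow> 'a ugraph" where
  "component G y =
     (let C = {z \<in> verts G. (y, z) \<in> (adjacency G)\<^sup>*}
      in \<lparr>verts = C, edges = {e \<in> edges G. e \<subseteq> C}\<rparr>)"

definition graph_iso :: "('a \<Rightarrow> 'b) \<Rightarrow> 'a ugraph \<Rightarrow> 'b ugraph \<Rightarrow> bool" where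
  "graph_iso h G H \<longleftrightarrow>
     bij_betw h (verts G) (verts H) \<and> edges H = (\<lambda>e. h ` e) ` edges G"

definition path_graph :: "nat \<Rightarrow> nat ugraph" where
  "path_graph n = \<lparr>verts = {..<n}, edges = {{i, Suc i} |i. Suc i < n}\<rparr>"

definition is_path :: "'a ugraph \<Rightarrow> bool" where
  "is_path G \<longleftrightarrow> (\<exists>n\<ge>1. \<exists>h. graph_iso h (path_graph n) G)"

definition rho :: "nat \<Rightarrow> real" where
  "rho n = 1 + (real n - 1) / (real n + 1)"

text \<open>Only meaningful for an edge e with endpoint x.\<close>

definition other_end :: "'a \<Rightarrow> 'a set \<Rightarrow> 'a" where
  "other_end x e = the_elem (e - {x})"

text \<open>The component of y after deletion of the edge e, where y is the endpoint of e
  other than x.\<close>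

definition branch :: "'a ugraph \<Rightarrow> 'a \<Rightarrow> 'a set \<Rightarrow> 'a ugraph" where
  "branch G x e = component (delete_edge G e) (other_end x e)"

definition simple_pair :: "'a ugraph \<Rightarrow> ('a set \<Rightarrow> real) \<Rightarrow> 'a \<Rightarrow> 'a set \<Rightarrow> bool" where
  "simple_pair G w x e \<longleftrightarrow>
     e \<in> edges G \<and> x \<in> e \<and>
     \<not> cyclic_edge G e \<and>
     degree G (other_end x e) \<le> 2 \<and>
     is_path (branch G x e) \<and>
     (\<forall>e'\<in>edges (branch G x e). w e' = 1)"

definition partial_rho :: "'a ugraph \<Rightarrow> ('a set \<Rightarrow> real) \<Rightarrow> 'a \<Rightarrow> 'a set \<Rightarrow> real" where
  "partial_rho G w x e =
     (if simple_pair G w x e then rho (card (verts (branch G x e))) else 2)"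

definition rho_degree :: "'a ugraph \<Rightarrow> ('a set \<Rightarrow> real) \<Rightarrow> 'a \<Rightarrow> real" where
  "rho_degree G w x = (\<Sum>e\<in>incident G x. w e * partial_rho G w x e)"

definition f_hat :: "('a set \<Rightarrow> enat) \<Rightarrow> 'a set \<Rightarrow> real" where
  "f_hat f e = (case f e of enat n \<Rightarrow> 4 * (cos (pi / real n))\<^sup>2 | \<infinity> \<Rightarrow> 4)"

definition labelled_iso :: "'a labelled \<Rightarrow> 'b labelled \<Rightarrow> bool" where
  "labelled_iso X Y \<longleftrightarrow>
     (\<exists>h. graph_iso h (fst X) (fst Y) \<and> (\<forall>e\<in>edges (fst X). snd Y (h ` e) = snd X e))"

definition belongs_to :: "'a labelled \<Rightarrow> nat labelled set \<Rightarrow> bool" where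
  "belongs_to X L \<longleftrightarrow> (\<exists>Y\<in>L. labelled_iso X Y)"

text \<open>The path whose successive edges carry the labels in the list ms; it has one vertex
  more than ms has entries, and the edge {i, Suc i} gets the label ms ! i.\<close>

definition lpath :: "enat list \<Rightarrow> nat labelled" where
  "lpath ms = (path_graph (Suc (length ms)), \<lambda>e. ms ! Min e)"

definition cycle_graph :: "nat \<Rightarrow> nat ugraph" where
  "cycle_graph n =
     \<lparr>verts = {..<n}, edges = insert {0, n - 1} {{i, Suc i} |i. Suc i < n}\<rparr>"

text \<open>Branching vertex 0; the three arms are the intervals {1..p}, {p+1..p+q} and
  {p+q+1..p+q+r}.\<close>

definition T_graph :: "nat \<Rightarrow> nat \<Rightarrow> nat \<Rightarrow> nat ugraph" where
  "T_graph p q r =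
     \<lparr>verts = {..p + q + r},
      edges = {{0, 1}, {0, p + 1}, {0, p + q + 1}} \<union>
        {{i, Suc i} |i. i \<in> {1..<p} \<union> {p + 1..<p + q} \<union> {p + q + 1..<p + q + r}}\<rparr>"

text \<open>Path 1, ..., l - 1 with leaves l and l + 1 attached to 1.\<close>

definition B_affine_graph :: "nat \<Rightarrow> nat ugraph" where
  "B_affine_graph l =
     \<lparr>verts = {1..l + 1},
      edges = {{i, Suc i} |i. i \<in> {1..<l - 1}} \<union> {{1, l}, {1, l + 1}}\<rparr>"

text \<open>Path 3, ..., l - 1 with leaves 1 and 2 attached to 3, and leaves l and l + 1
  attached to l - 1.\<close>

definition D_affine_graph :: "nat \<Rightarrow> nat ugraph" where
  "D_affine_graph l =
     \<lparr>verts = {1..l + 1},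
      edges = {{i, Suc i} |i. i \<in> {3..<l - 1}} \<union>
        {{1, 3}, {2, 3}, {l - 1, l}, {l - 1, l + 1}}\<rparr>"

inductive_set list_III :: "nat labelled set" where
  A: "1 \<le> l \<Longrightarrow> lpath (replicate (l - 1) 3) \<in> list_III"
| B: "2 \<le> l \<Longrightarrow> lpath (4 # replicate (l - 2) 3) \<in> list_III"
| D: "4 \<le> l \<Longrightarrow> (T_graph 1 1 (l - 3), \<lambda>_. 3) \<in> list_III"
| E6: "(T_graph 1 2 2, \<lambda>_. 3) \<in> list_III"
| E7: "(T_graph 1 2 3, \<lambda>_. 3) \<in> list_III"
| E8: "(T_graph 1 2 4, \<lambda>_. 3) \<in> list_III"
| F4: "lpath [3, 4, 3] \<in> list_III"
| G2: "lpath [6] \<in> list_III"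
| H3: "lpath [5, 3] \<in> list_III"
| H4: "lpath [5, 3, 3] \<in> list_III"
| I2: "p = 5 \<or> 7 \<le> p \<Longrightarrow> lpath [enat p] \<in> list_III"

inductive_set list_IV :: "nat labelled set" where
  A1: "lpath [\<infinity>] \<in> list_IV"
| A: "2 \<le> l \<Longrightarrow> (cycle_graph (l + 1), \<lambda>_. 3) \<in> list_IV"
| B2: "lpath [4, 4] \<in> list_IV"
| B: "3 \<le> l \<Longrightarrow> (B_affine_graph l, (\<lambda>_. 3)({l - 2, l - 1} := 4)) \<in> list_IV"
| C: "3 \<le> l \<Longrightarrow> lpath (4 # replicate (l - 2) 3 @ [4]) \<in> list_IV"
| D: "4 \<le> l \<Longrightarrow> (D_affine_graph l, \<lambda>_. 3) \<in> list_IV"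
| E6: "(T_graph 2 2 2, \<lambda>_. 3) \<in> list_IV"
| E7: "(T_graph 1 3 3, \<lambda>_. 3) \<in> list_IV"
| E8: "(T_graph 1 2 5, \<lambda>_. 3) \<in> list_IV"
| F4: "lpath [3, 3, 4, 3] \<in> list_IV"
| G2: "lpath [3, 6] \<in> list_IV"

end

(* Up to labels, simple pairs are the same as arms: paths ys hanging off a vertex x, whose
   contribution to the rho-degree of x depends only on the list of their labels. On a path with
   a single label other than 3, of weight w and with a and b edges on its two sides, the bound 4
   becomes w (a + 1) (b + 1) <= (a + 2) (b + 2). For the classification, assume that all
   rho-degrees are at most 4. If all degrees are at most 2, the graph is a path or a cycle and
   only the labels matter. Otherwise let x have degree at least 3. If all its edges start short
   arms with labels 3, the graph is a T_{p,q,r} or a star. If one edge contributes at least 2, it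
   contributes exactly 2 and the other two edges at x are leaves; following that edge through
   vertices of degree 2, each of which sees a nonsimple edge behind it, forces all labels to be 3
   except possibly the last, so that the walk ends either in a leaf with last label 4 or in a
   second vertex of degree 3 with two leaves. *)

theory Submission imports Defs begin

section \<open>Weights of labels\<close>

text \<open>\<open>simple_pair\<close> is a global notion: components, cyclicity and an isomorphism
  to a path, all after deleting an edge. Arms make it local, and shapes, which describe G by
  explicit lists of its own vertices, replace isomorphisms to numbered graphs; afterwards only label
  lists and lengths have to be compared. Both equivalences need just one classification: each list
  satisfies its own degree condition and the two conditions exclude each other, so it suffices that
  degrees of at most 4 put the graph into one of the two lists. The sporadic members come from rho n
  = 2 - 2/(n+1): three arms of lengths p, q, r with all labels 3 give at most 4 exactly if 1/(p+1) +
  1/(q+1) + 1/(r+1) >= 1. Elsewhere the bound is rigid because every edge contributes at least 1,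
  and a nonsimple edge contributes twice its weight, hence at least 2.\<close>

declare upt_Suc [simp del]

definition weight :: "enat \<Rightarrow> real" where
  "weight m = (case m of enat n \<Rightarrow> 4 * (cos (pi / real n))\<^sup>2 | \<infinity> \<Rightarrow> 4)"

lemma f_hat_eq_weight: "f_hat f e = weight (f e)"
  by (simp add: f_hat_def weight_def)

lemma weight_3 [simp]: "weight 3 = 1"
  by (simp add: weight_def numeral_eq_enat cos_60 power2_eq_square)

lemma weight_4 [simp]: "weight 4 = 2"
  by (simp add: weight_def numeral_eq_enat cos_45 power_divide)

lemma weight_6 [simp]: "weight 6 = 3"
  by (simp add: weight_def numeral_eq_enat cos_30 power_divide)

lemma weight_infinity [simp]: "weight \<infinity> = 4"
  by (simp add: weight_def)

lemma weight_strict_mono: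
  assumes "3 \<le> m" "m < n"
  shows "weight m < weight n"
proof -
  obtain k where k: "m = enat k" using assms(2) by (cases m) auto
  then have k3: "3 \<le> k" using assms(1) by (simp add: numeral_eq_enat)
  have pos: "0 < cos (pi / real k)"
    using k3 by (intro cos_gt_zero) (auto simp: field_simps)
  show ?thesis
  proof (cases n)
    case (enat l)
    then have "k < l" using assms(2) k by simp
    then have "cos (pi / real k) < cos (pi / real l)"
      using k3 by (intro cos_monotone_0_pi) (auto simp: field_simps)
    then show ?thesis using pos enat k by (simp add: weight_def power_strict_mono)
  next
    case infinity
    have "cos (pi / real k) < cos 0"
      using k3 by (intro cos_monotone_0_pi) (auto simp: field_simps)
    then have "(cos (pi / real k))\<^sup>2 < 1" using pos by (simp add: power_less_one_iff abs_square_less_1)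
    then show ?thesis using k infinity by (simp add: weight_def)
  qed
qed

text \<open>The weight is (3 + sqrt 5)/2, about 2.618. The bound 8/3 is what keeps all degrees of
  the labels 5,3,3 below 4; the bound 5/2 is what rules out 5,3,3,3.\<close>

lemma weight_5_bounds: "5/2 < weight 5" "weight 5 < 8/3"
proof -
  define t where "t = pi/5"
  define u where "u = cos t"
  define w where "w = weight 5"
  have w: "w = 4 * u\<^sup>2" by (simp add: w_def weight_def numeral_eq_enat u_def t_def)
  \<comment> \<open>For t = pi/5 the angles 3t and 2t add up to pi. The resulting cubic in u = cos t
    has the factor u + 1, and the remaining quadratic makes w = 4 u^2 a root of w^2 - 3w +
    1.\<close>
  have "cos (3 * t) = - cos (2 * t)"
  proof -
    have "3 * t = pi - 2 * t" by (simp add: t_def)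
    then show ?thesis by (metis cos_pi_minus)
  qed
  then have "4 * u ^ 3 - 3 * u = - (2 * u\<^sup>2 - 1)"
    by (simp add: cos_treble_cos cos_double_cos u_def)
  then have "(u + 1) * (4 * u\<^sup>2 - 2 * u - 1) = 0"
    by (simp add: algebra_simps power2_eq_square power3_eq_cube)
  moreover have "0 < u" unfolding u_def t_def by (intro cos_gt_zero) auto
  ultimately have "2 * u = w - 1" by (simp add: w)
  then have "(w - 1)\<^sup>2 = (2 * u)\<^sup>2" by simp
  then have "(w - 1)\<^sup>2 = w" by (simp add: w power2_eq_square)
  then have q: "w * w - 3 * w + 1 = 0" by (simp add: power2_eq_square algebra_simps)
  have "weight 4 < weight 5" by (rule weight_strict_mono) auto
  then have w2: "2 < w" by (simp add: w_def)
  show "5/2 < weight 5"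
  proof (rule ccontr)
    \<comment> \<open>Since 5/2 + 1/2 = 3, the product with w - 1/2 differs from w^2 - 3w + 1 only
      by a constant. The bound 8/3 is treated in the same way with 1/3.\<close>
    assume "\<not> ?thesis"
    then have "(w - 5/2) * (w - 1/2) \<le> 0" using w2 by (intro mult_nonpos_nonneg) (auto simp: w_def)
    moreover have "(w - 5/2) * (w - 1/2) = w * w - 3 * w + 5/4" by (simp add: field_simps)
    ultimately show False using q by linarith
  qed
  show "weight 5 < 8/3"
  proof (rule ccontr)
    assume "\<not> ?thesis"
    then have "0 \<le> (w - 8/3) * (w - 1/3)" using w2 by (intro mult_nonneg_nonneg) (auto simp: w_def)
    moreover have "(w - 8/3) * (w - 1/3) = w * w - 3 * w + 8/9" by (simp add: field_simps)
    ultimately show False using q by linarith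
  qed
qed

text \<open>Labels 3, 4, 6 and infinity have integral weights; for finite labels from 7 on only the
  position of the weight between 3 and 4 matters.\<close>

lemma weight_cases:
  assumes "3 \<le> m"
  obtains "m = 3" | "m = 4" | "m = 5" | "m = 6" | p where "7 \<le> p" "m = enat p" "3 < weight m" "weight m < 4" | "m = \<infinity>"
proof (cases m)
  case (enat p)
  then have "3 \<le> p" using assms by (simp add: numeral_eq_enat)
  then consider "p = 3" | "p = 4" | "p = 5" | "p = 6" | "7 \<le> p" by linarith
  then show ?thesis
  proof cases
    case 5
    have "weight 6 < weight m" using 5 enat by (intro weight_strict_mono) (auto simp: numeral_eq_enat)
    moreover have "weight m < weight \<infinity>" using assms enat by (intro weight_strict_mono) auto
    ultimately show ?thesis using that 5 enat by simp
  qed (use that enat in \<open>simp_all add: numeral_eq_enat\<close>)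
qed (use that in blast)

lemma weight_ge_1: "3 \<le> m \<Longrightarrow> 1 \<le> weight m"
  using weight_strict_mono[of 3 m] by (cases "m = 3") (auto simp: order.strict_iff_order)

lemma weight_ge_2:
  assumes "3 \<le> m" "m \<noteq> 3" shows "2 \<le> weight m"
  by (rule weight_cases[OF assms(1)]) (use assms(2) weight_5_bounds in auto)

lemma weight_le_2:
  assumes "3 \<le> m" "weight m \<le> 2" shows "m = 3 \<or> m = 4"
  by (rule weight_cases[OF assms(1)]) (use assms(2) weight_5_bounds in auto)

lemma weight_eq_1_iff: "3 \<le> m \<Longrightarrow> weight m = 1 \<longleftrightarrow> m = 3"
  using weight_ge_2 by fastforce

text \<open>In this form rho visibly increases towards 2, and bounds on sums of rho become bounds on
  sums of reciprocals. The value \<open>rho 0 = 0\<close> fits the missing arm at the end of a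
  path.\<close>

lemma rho_eq: "rho n = 2 - 2 / (real n + 1)"
  by (simp add: rho_def field_simps)

lemma rho_0 [simp]: "rho 0 = 0" and rho_1 [simp]: "rho (Suc 0) = 1"
  by (simp_all add: rho_def)

lemma rho_less_2: "rho n < 2"
  by (simp add: rho_eq)

lemma rho_ge_1: "1 \<le> n \<Longrightarrow> 1 \<le> rho n"
  by (simp add: rho_eq field_simps)

lemma rho_le_1_iff: "rho n \<le> 1 \<longleftrightarrow> n \<le> 1"
  by (simp add: rho_eq field_simps)

text \<open>The contribution to the rho-degree of x of an arm at x, where ms lists the labels of
  its edges from x outwards.\<close>

fun side :: "enat list \<Rightarrow> real" where
  "side [] = 0"
| "side (m # ms) = weight m * (if set ms \<subseteq> {3} then rho (Suc (length ms)) else 2)"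

lemma side_replicate [simp]: "side (replicate n 3) = rho n"
  by (cases n) auto

text \<open>The length does not matter: for n = 0 the value is \<open>weight 4\<close> times
  \<open>rho 1\<close>, and for n > 0 the first edge has weight 1 but is not simple. This
  coincidence makes the types B and C infinite families.\<close>

lemma side_replicate_4 [simp]: "side (replicate n 3 @ [4]) = 2"
  by (cases n) auto

section \<open>Arms\<close>

text \<open>A list instead of a set, so that \<open>map f (elist xs)\<close> is the sequence of
  labels along the path; splitting or reversing the vertices then splits or reverses the
  labels.\<close>

fun elist :: "'a list \<Rightarrow> 'a set list" where
  "elist [] = []"
| "elist [x] = []"
| "elist (x # y # zs) = {x, y} # elist (y # zs)"

lemma length_elist [simp]: "length (elist xs) = length xs - 1"
  by (induction xs rule: elist.induct) auto

lemma elist_map: "elist (map h xs) = map ((`) h) (elist xs)"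
  by (induction xs rule: elist.induct) auto

lemma elist_append: "elist (xs @ v # ys) = elist (xs @ [v]) @ elist (v # ys)"
  by (induction xs rule: elist.induct) auto

lemma elist_Cons: "ys \<noteq> [] \<Longrightarrow> elist (x # ys) = {x, hd ys} # elist ys"
  by (cases ys) auto

lemma elist_snoc: "xs \<noteq> [] \<Longrightarrow> elist (xs @ [y]) = elist xs @ [{last xs, y}]"
  by (induction xs rule: elist.induct) auto

lemma elist_rev: "elist (rev xs) = rev (elist xs)"
proof (induction xs rule: elist.induct)
  case (3 x y zs)
  then show ?case
    using elist_append[of "rev zs" y "[x]"] by (simp add: insert_commute)
qed auto

lemma elist_subset: "e \<in> set (elist xs) \<Longrightarrow> e \<subseteq> set xs"
  by (induction xs rule: elist.induct) auto

lemma elist_nth: "Suc i < length xs \<Longrightarrow> elist xs ! i = {xs ! i, xs ! Suc i}"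
proof (induction xs arbitrary: i rule: elist.induct)
  case (3 x y zs) then show ?case by (cases i) auto
qed auto

lemma set_elist: "set (elist xs) = {{xs ! i, xs ! Suc i} | i. Suc i < length xs}"
proof -
  have "set (elist xs) = (!) (elist xs) ` {..<length xs - 1}"
    using nth_image[of "length xs - 1" "elist xs"] by (simp add: atLeast0LessThan)
  also have "\<dots> = (\<lambda>i. {xs ! i, xs ! Suc i}) ` {..<length xs - 1}"
    by (rule image_cong) (simp_all add: elist_nth less_diff_conv)
  also have "\<dots> = {{xs ! i, xs ! Suc i} | i. Suc i < length xs}"
    by (auto simp: less_diff_conv)
  finally show ?thesis .
qed

lemma elist_split:
  assumes "e \<in> set (elist xs)"
  obtains as p q bs where "xs = as @ p # q # bs" "e = {p, q}"
proof -
  have "\<exists>as p q bs. xs = as @ p # q # bs \<and> e = {p, q}"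
    using assms
  proof (induction xs rule: elist.induct)
    case (3 x y zs)
    show ?case
    proof (cases "e = {x, y}")
      case True
      then show ?thesis by (intro exI[of _ "[]"]) auto
    next
      case False
      with 3 obtain as p q bs where "y # zs = as @ p # q # bs" "e = {p, q}" by auto
      then show ?thesis by (intro exI[of _ "x # as"]) auto
    qed
  qed auto
  then show ?thesis using that by blast
qed

lemma set_elist_upt: "set (elist [a..<b]) = {{i, Suc i} | i. a \<le> i \<and> Suc i < b}"
proof (intro set_eqI iffI)
  fix e assume "e \<in> {{i, Suc i} | i. a \<le> i \<and> Suc i < b}"
  then obtain i where i: "e = {i, Suc i}" "a \<le> i" "Suc i < b" by blast
  then have "e = {[a..<b] ! (i - a), [a..<b] ! Suc (i - a)}" "Suc (i - a) < length [a..<b]"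
    by (simp_all add: nth_upt)
  then show "e \<in> set (elist [a..<b])" unfolding set_elist by blast
next
  fix e assume "e \<in> set (elist [a..<b])"
  then obtain i where i: "e = {[a..<b] ! i, [a..<b] ! Suc i}" "Suc i < b - a"
    unfolding set_elist by auto
  then have "e = {a + i, Suc (a + i)}" "a \<le> a + i" "Suc (a + i) < b"
    by (simp_all add: nth_upt)
  then show "e \<in> {{i, Suc i} | i. a \<le> i \<and> Suc i < b}" by blast
qed

lemma elist_incident:
  assumes "distinct (as @ v # bs)"
  shows "e \<in> set (elist (as @ v # bs)) \<and> v \<in> e \<longleftrightarrow>
    as \<noteq> [] \<and> e = {last as, v} \<or> bs \<noteq> [] \<and> e = {v, hd bs}"
proof -
  have "e \<in> set (elist (as @ [v])) \<and> v \<in> e \<longleftrightarrow> as \<noteq> [] \<and> e = {last as, v}"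
    using assms by (cases "as = []") (auto simp: elist_snoc dest: elist_subset)
  moreover have "e \<in> set (elist (v # bs)) \<and> v \<in> e \<longleftrightarrow> bs \<noteq> [] \<and> e = {v, hd bs}"
    using assms by (cases "bs = []") (auto simp: elist_Cons dest: elist_subset)
  ultimately show ?thesis by (subst elist_append) auto
qed

section \<open>Reachability, and arms as the combinatorial form of simple pairs\<close>

lemma adjacency_rtrancl_closed:
  assumes "(y, z) \<in> (adjacency H)\<^sup>*" "y \<in> S"
    and "\<And>e. e \<in> edges H \<Longrightarrow> e \<inter> S \<noteq> {} \<Longrightarrow> e \<subseteq> S"
  shows "z \<in> S"
  using assms(1,2)
proof (induction rule: rtrancl_induct)
  case (step u v)
  then show ?case using assms(3)[of "{u, v}"] by (auto simp: adjacency_def)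
qed auto

lemma sym_adjacency_rtrancl: "(y, z) \<in> (adjacency H)\<^sup>* \<Longrightarrow> (z, y) \<in> (adjacency H)\<^sup>*"
proof -
  have "sym (adjacency H)" by (auto simp: sym_def adjacency_def insert_commute)
  then show "(y, z) \<in> (adjacency H)\<^sup>* \<Longrightarrow> (z, y) \<in> (adjacency H)\<^sup>*"
    by (meson sym_rtrancl symD)
qed

lemma elist_reachable:
  assumes "set (elist ys) \<subseteq> edges H" "z \<in> set ys"
  shows "(hd ys, z) \<in> (adjacency H)\<^sup>*"
  using assms
proof (induction ys rule: elist.induct)
  case (3 x y zs)
  have "(x, y) \<in> adjacency H" using 3 by (auto simp: adjacency_def)
  then show ?case using 3 by (auto intro: converse_rtrancl_into_rtrancl)
qed auto

text \<open>The path ys is attached to the rest of the graph only by the edge from x to its first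
  vertex. Labels are not constrained here; the pair of x and that edge is simple iff all labels
  inside ys are 3.\<close>

definition arm :: "'a ugraph \<Rightarrow> 'a \<Rightarrow> 'a list \<Rightarrow> bool" where
  "arm G x ys \<longleftrightarrow> ys \<noteq> [] \<and> distinct (x # ys) \<and> set (elist (x # ys)) \<subseteq> edges G \<and>
     (\<forall>e\<in>edges G. e \<inter> set ys \<noteq> {} \<longrightarrow> e \<in> set (elist (x # ys)))"

locale coxeter =
  fixes G :: "'a ugraph" and f :: "'a set \<Rightarrow> enat"
  assumes coxeter: "coxeter_graph G f" and connected: "connected_graph G"
begin

lemma finite_verts: "finite (verts G)" and verts_nonempty: "verts G \<noteq> {}"
  using coxeter by (auto simp: coxeter_graph_def)

lemma edge_subset: "e \<in> edges G \<Longrightarrow> e \<subseteq> verts G"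
  and edge_card: "e \<in> edges G \<Longrightarrow> card e = 2"
  and label_ge_3: "e \<in> edges G \<Longrightarrow> 3 \<le> f e"
  using coxeter by (auto simp: coxeter_graph_def)

lemma finite_edges: "finite (edges G)"
  using finite_verts edge_subset by (intro finite_subset[of "edges G" "Pow (verts G)"]) auto

lemma finite_incident: "finite (incident G x)"
  using finite_edges by (simp add: incident_def)

lemma edge_at:
  assumes "e \<in> edges G" "x \<in> e"
  obtains y where "e = {x, y}" "x \<noteq> y" "y \<in> verts G" "other_end x e = y"
proof -
  obtain a b where "e = {a, b}" "a \<noteq> b" using edge_card[OF assms(1)] by (meson card_2_iff)
  then obtain y where "e = {x, y}" "x \<noteq> y" using assms(2) by blast
  moreover then have "e - {x} = {y}" by auto
  ultimately show ?thesis using that edge_subset[OF assms(1)] by (auto simp: other_end_def)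
qed

lemma verts_subset_closed:
  assumes "y \<in> S" "y \<in> verts G"
    and "\<And>e. e \<in> edges G \<Longrightarrow> e \<inter> S \<noteq> {} \<Longrightarrow> e \<subseteq> S"
  shows "verts G \<subseteq> S"
  using connected assms adjacency_rtrancl_closed[of y _ G S] by (auto simp: connected_graph_def)

lemma arm_verts: "arm G x ys \<Longrightarrow> set (x # ys) \<subseteq> verts G"
proof
  fix u assume a: "arm G x ys" "u \<in> set (x # ys)"
  have "\<exists>e\<in>set (elist (x # ys)). u \<in> e"
  proof (cases "u = x")
    case True then show ?thesis using a by (auto simp: arm_def elist_Cons)
  next
    case False
    then obtain as bs where "ys = as @ u # bs" using a by (auto dest: split_list)
    then have "{last (x # as), u} \<in> set (elist ((x # as) @ u # bs))"
      using a elist_incident[of "x # as" u bs "{last (x # as), u}"] by (auto simp: arm_def)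
    then show ?thesis using \<open>ys = _\<close> by auto
  qed
  then show "u \<in> verts G" using a edge_subset by (auto simp: arm_def)
qed

lemma arm_incident:
  assumes "arm G x (as @ u # bs)"
  shows "incident G u = insert {last (x # as), u} (if bs = [] then {} else {{u, hd bs}})"
proof -
  have "incident G u = {e \<in> set (elist ((x # as) @ u # bs)). u \<in> e}"
    using assms by (auto simp: arm_def incident_def)
  then show ?thesis
    using assms elist_incident[of "x # as" u bs] by (auto simp: arm_def)
qed

lemma arm_degree:
  assumes "arm G x (as @ u # bs)"
  shows "degree G u = (if bs = [] then 1 else 2)"
proof -
  have "last (x # as) \<noteq> hd bs" if "bs \<noteq> []"
  proof -
    have "last (x # as) \<in> set (x # as)" "hd bs \<in> set bs" using that by simp_all
    then show ?thesis using assms by (auto simp: arm_def)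
  qed
  then have "bs \<noteq> [] \<Longrightarrow> {last (x # as), u} \<noteq> {u, hd bs}"
    by (metis doubleton_eq_iff)
  then show ?thesis
    by (simp add: degree_def arm_incident[OF assms] card_insert_if)
qed

lemma arm_degree_le_2:
  assumes "arm G x ys" "u \<in> set ys"
  shows "degree G u \<le> 2"
proof -
  obtain as bs where "ys = as @ u # bs" using split_list[OF assms(2)] by blast
  then show ?thesis using arm_degree[of x as u bs] assms by auto
qed

lemma arm_degree_last:
  assumes "arm G x ys"
  shows "degree G (last ys) = 1"
proof -
  have "ys = butlast ys @ last ys # []" using assms by (simp add: arm_def)
  then show ?thesis using arm_degree[of x "butlast ys" "last ys" "[]"] assms by simp
qed

lemma arm_suffix:
  assumes "arm G x (as @ u # bs)" "bs \<noteq> []"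
  shows "arm G u bs"
proof -
  have el: "elist (x # as @ u # bs) = elist ((x # as) @ [u]) @ elist (u # bs)"
    using elist_append[of "x # as" u bs] by simp
  have "e \<in> set (elist (u # bs))" if "e \<in> edges G" "e \<inter> set bs \<noteq> {}" for e
  proof -
    have "e \<in> set (elist ((x # as) @ [u])) \<or> e \<in> set (elist (u # bs))"
      using that assms(1) unfolding arm_def el by auto
    then show ?thesis using elist_subset[of e "(x # as) @ [u]"] that assms(1)
      by (auto simp: arm_def)
  qed
  then show ?thesis using assms unfolding arm_def el by auto
qed

lemma arm_hd_edge:
  assumes "arm G x ys" shows "{x, hd ys} \<in> edges G"
  using assms by (auto simp: arm_def elist_Cons)

lemma arm_other_end:
  assumes "arm G x ys" shows "other_end x {x, hd ys} = hd ys"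
proof -
  have "hd ys \<in> set ys" using assms by (simp add: arm_def)
  then have "{x, hd ys} - {x} = {hd ys}" using assms by (auto simp: arm_def)
  then show ?thesis by (simp add: other_end_def)
qed

lemma arm_closed:
  assumes "arm G x ys" "e \<in> edges (delete_edge G {x, hd ys})" "e \<inter> set ys \<noteq> {}"
  shows "e \<in> set (elist ys)"
  using assms by (auto simp: arm_def delete_edge_def elist_Cons)

text \<open>The edge from x is the only one leaving \<open>set ys\<close>. Once it is deleted,
  \<open>set ys\<close> is closed under edges, while the path itself connects its first vertex to
  all the others.\<close>

lemma arm_branch:
  assumes "arm G x ys"
  shows "branch G x {x, hd ys} = \<lparr>verts = set ys, edges = set (elist ys)\<rparr>"
proof -
  let ?H = "delete_edge G {x, hd ys}"
  have el: "set (elist ys) \<subseteq> edges ?H"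
    using assms by (auto simp: arm_def delete_edge_def elist_Cons dest: elist_subset)
  have "z \<in> set ys" if "(hd ys, z) \<in> (adjacency ?H)\<^sup>*" for z
    using that
  proof (rule adjacency_rtrancl_closed)
    show "hd ys \<in> set ys" using assms by (simp add: arm_def)
  qed (use arm_closed[OF assms] elist_subset in blast)
  moreover have "(hd ys, z) \<in> (adjacency ?H)\<^sup>*" if "z \<in> set ys" for z
    using elist_reachable[OF el that] .
  ultimately have C: "{z \<in> verts ?H. (hd ys, z) \<in> (adjacency ?H)\<^sup>*} = set ys"
    using arm_verts[OF assms] by (auto simp: delete_edge_def)
  have "{e \<in> edges ?H. e \<subseteq> set ys} = set (elist ys)"
  proof -
    have "e \<inter> set ys \<noteq> {}" if "e \<in> edges ?H" "e \<subseteq> set ys" for e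
      using that edge_card[of e] by (auto simp: delete_edge_def Int_absorb2)
    then show ?thesis using arm_closed[OF assms] el elist_subset[of _ ys] by blast
  qed
  then show ?thesis by (simp add: branch_def arm_other_end[OF assms] component_def C)
qed

lemma is_path_elist:
  assumes "distinct ys" "ys \<noteq> []"
  shows "is_path \<lparr>verts = set ys, edges = set (elist ys)\<rparr>"
proof -
  have "bij_betw ((!) ys) {..<length ys} (set ys)"
    using assms(1) by (simp add: bij_betw_nth)
  moreover have "set (elist ys) = (`) ((!) ys) ` edges (path_graph (length ys))"
    by (simp add: set_elist path_graph_def setcompr_eq_image image_image)
  ultimately have "graph_iso ((!) ys) (path_graph (length ys)) \<lparr>verts = set ys, edges = set (elist ys)\<rparr>"
    by (simp add: graph_iso_def path_graph_def)
  then show ?thesis using assms(2) unfolding is_path_def by (metis One_nat_def Suc_leI length_greater_0_conv)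
qed

lemma arm_not_cyclic:
  assumes "arm G x ys" shows "\<not> cyclic_edge G {x, hd ys}"
proof
  let ?H = "delete_edge G {x, hd ys}"
  assume "cyclic_edge G {x, hd ys}"
  then have "(hd ys, x) \<in> (adjacency ?H)\<^sup>*"
    using arm_verts[OF assms] assms
    by (simp add: cyclic_edge_def connected_graph_def delete_edge_def arm_def subset_iff)
  then have "x \<in> set ys"
  proof (rule adjacency_rtrancl_closed)
    show "hd ys \<in> set ys" using assms by (simp add: arm_def)
  qed (use arm_closed[OF assms] elist_subset in blast)
  then show False using assms by (simp add: arm_def)
qed

text \<open>Every other condition of \<open>simple_pair\<close> is automatic for an arm: its edge to
  x separates it from x, its vertices have degree at most 2, and its branch is a path.\<close>

lemma arm_simple_iff:
  assumes "arm G x ys"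
  shows "simple_pair G (f_hat f) x {x, hd ys} \<longleftrightarrow> f ` set (elist ys) \<subseteq> {3}"
proof -
  have "f_hat f e = 1 \<longleftrightarrow> f e = 3" if "e \<in> set (elist ys)" for e
  proof -
    have "e \<in> edges G" using assms that by (auto simp: arm_def elist_Cons)
    then show ?thesis by (simp add: f_hat_eq_weight weight_eq_1_iff label_ge_3)
  qed
  moreover have "is_path (branch G x {x, hd ys})"
    using assms by (simp add: arm_branch[OF assms] is_path_elist arm_def)
  moreover have "degree G (hd ys) \<le> 2"
    using arm_degree_le_2[OF assms] assms by (simp add: arm_def)
  ultimately show ?thesis
    using arm_hd_edge[OF assms] arm_not_cyclic[OF assms] arm_other_end[OF assms] arm_branch[OF assms]
    by (auto simp: simple_pair_def)
qed

definition contrib :: "'a \<Rightarrow> 'a set \<Rightarrow> real" where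
  "contrib x e = f_hat f e * partial_rho G (f_hat f) x e"

lemma rho_degree_eq: "rho_degree G (f_hat f) x = (\<Sum>e\<in>incident G x. contrib x e)"
  by (simp add: rho_degree_def contrib_def)

lemma arm_contrib:
  assumes "arm G x ys"
  shows "contrib x {x, hd ys} = side (map f (elist (x # ys)))"
proof -
  have "card (set ys) = Suc (length (elist ys))"
    using assms by (simp add: arm_def distinct_card)
  moreover have "elist (x # ys) = {x, hd ys} # elist ys" using assms by (simp add: arm_def elist_Cons)
  ultimately show ?thesis
    by (simp add: contrib_def partial_rho_def arm_simple_iff[OF assms] arm_branch[OF assms]
        f_hat_eq_weight)
qed

text \<open>The branch is a path containing the far endpoint y of the edge. The degree bound makes y
  an end of this path, so the path or its reversal is an arm starting at y.\<close>

lemma simple_pair_imp_arm: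
  assumes "simple_pair G w x e"
  obtains ys where "arm G x ys" "e = {x, hd ys}" "w ` set (elist ys) \<subseteq> {1}"
proof -
  have e: "e \<in> edges G" "x \<in> e" using assms by (auto simp: simple_pair_def)
  obtain y where y: "e = {x, y}" "x \<noteq> y" "y \<in> verts G" "other_end x e = y"
    using edge_at[OF e] .
  let ?H = "delete_edge G e"
  let ?B = "branch G x e"
  have x: "x \<in> verts G" using e edge_subset by blast
  have Bv: "verts ?B = {z \<in> verts G. (y, z) \<in> (adjacency ?H)\<^sup>*}"
    and Be: "edges ?B = {d \<in> edges G. d \<noteq> e \<and> d \<subseteq> verts ?B}"
    by (auto simp: branch_def y(4) component_def delete_edge_def Let_def)
  have yB: "y \<in> verts ?B" using y(3) Bv by simp
  have closed: "d \<in> edges ?B" if d: "d \<in> edges G" "d \<noteq> e" "d \<inter> verts ?B \<noteq> {}" for d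
  proof -
    obtain u where u: "u \<in> d" "u \<in> verts ?B" using d by blast
    obtain v where v: "d = {u, v}" "v \<in> verts G" using edge_at[OF d(1) u(1)] by metis
    have "(u, v) \<in> adjacency ?H" using v(1) d by (simp add: adjacency_def delete_edge_def)
    then have "v \<in> verts ?B" using u(2) v(2) Bv by (auto intro: rtrancl_into_rtrancl)
    then show ?thesis using d u v Be by auto
  qed
  \<comment> \<open>If the branch contained x, it would be closed under all edges including e, hence
    contain every vertex; deleting e would then leave the graph connected, and e would be
    cyclic.\<close>
  have xB: "x \<notin> verts ?B"
  proof
    assume "x \<in> verts ?B"
    have "verts G \<subseteq> verts ?B"
    proof (rule verts_subset_closed[OF yB y(3)])
      fix d assume "d \<in> edges G" "d \<inter> verts ?B \<noteq> {}"
      then show "d \<subseteq> verts ?B" using closed[of d] Be \<open>x \<in> verts ?B\<close> yB y(1) by (cases "d = e") auto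
    qed
    then have "(y, z) \<in> (adjacency ?H)\<^sup>*" if "z \<in> verts G" for z using that Bv by blast
    then have "connected_graph ?H"
      using x by (auto simp: connected_graph_def delete_edge_def
          intro: rtrancl_trans[OF sym_adjacency_rtrancl])
    then show False using assms e by (simp add: simple_pair_def cyclic_edge_def)
  qed
  obtain n h where n: "n \<ge> 1" and h: "graph_iso h (path_graph n) ?B"
    using assms by (auto simp: simple_pair_def is_path_def)
  define zs where "zs = map h [0..<n]"
  have zs: "distinct zs" "zs \<noteq> []" "verts ?B = set zs" "edges ?B = set (elist zs)"
  proof -
    show "distinct zs" using h by (auto simp: zs_def distinct_map graph_iso_def path_graph_def bij_betw_def atLeast0LessThan)
    show "zs \<noteq> []" using n by (simp add: zs_def)
    show "verts ?B = set zs" using h by (auto simp: zs_def graph_iso_def path_graph_def bij_betw_def atLeast0LessThan)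
    show "edges ?B = set (elist zs)"
      using h by (auto simp: zs_def graph_iso_def path_graph_def elist_map set_elist_upt)
  qed
  obtain as bs where ab: "zs = as @ y # bs" using yB zs split_list[of y zs] by auto
  \<comment> \<open>An inner position of y would give it two neighbours on the path in addition to
    x, hence degree at least 3.\<close>
  have "as = [] \<or> bs = []"
  proof (rule ccontr)
    assume ne: "\<not> ?thesis"
    let ?p = "{last as, y}" and ?q = "{y, hd bs}"
    have "?p \<in> set (elist zs)" "?q \<in> set (elist zs)"
      using elist_incident[of as y bs] zs ab ne by blast+
    then have pq: "{?p, ?q, e} \<subseteq> incident G y" using zs(4) Be e y(1) by (auto simp: incident_def)
    have "last as \<in> set as" "hd bs \<in> set bs" using ne by auto
    then have "last as \<noteq> hd bs" "last as \<noteq> x" "hd bs \<noteq> x"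
      using zs ab xB by auto
    then have "card {?p, ?q, e} = 3" using y by (auto simp: card_insert_if doubleton_eq_iff)
    then have "3 \<le> degree G y"
      unfolding degree_def using card_mono[OF finite_incident pq] by simp
    then show False using assms y(4) by (simp add: simple_pair_def)
  qed
  then obtain ys where ys: "distinct ys" "ys \<noteq> []" "hd ys = y" "set ys = verts ?B" "set (elist ys) = edges ?B"
  proof
    assume "as = []" then show ?thesis using that[of zs] zs ab by simp
  next
    assume "bs = []"
    then have "hd (rev zs) = y" using ab by simp
    then show ?thesis using that[of "rev zs"] zs by (simp add: elist_rev)
  qed
  have "arm G x ys"
    unfolding arm_def using ys xB closed Be y(1) e by (auto simp: elist_Cons)
  moreover have "w ` set (elist ys) \<subseteq> {1}" using assms ys(5) by (auto simp: simple_pair_def)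
  ultimately show ?thesis using that y(1) ys(3) by blast
qed

end

section \<open>Graphs of the lists as vertex lists\<close>

lemma map_nth_segment: "map ((!) (us @ vs @ ws)) [length us..<length us + length vs] = vs"
  by (rule nth_equalityI) (auto simp: nth_append)

text \<open>The version for the affine graphs of types B and D, whose vertices are numbered from
  1.\<close>

lemma map_nth_pred_segment:
  "map (\<lambda>i. (us @ vs @ ws) ! (i - 1)) [Suc (length us)..<Suc (length us + length vs)] = vs"
  by (rule nth_equalityI) (auto simp: nth_append)

lemma image_elist: "(`) h ` set (elist xs) = set (elist (map h xs))"
  by (simp add: elist_map)

lemma set_elist_upt': "set (elist [a..<b]) = {{i, Suc i} | i. i \<in> {a..<b - 1}}"
  unfolding set_elist_upt setcompr_eq_image by (rule image_cong) (auto simp: less_diff_conv)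

lemma edges_path_graph: "edges (path_graph n) = set (elist [0..<n])"
  by (simp add: path_graph_def set_elist_upt)

lemma edges_cycle_graph: "edges (cycle_graph n) = insert {0, n - 1} (set (elist [0..<n]))"
  by (simp add: cycle_graph_def set_elist_upt)

lemma edges_T_graph:
  assumes "1 \<le> p" "1 \<le> q" "1 \<le> r"
  shows "edges (T_graph p q r) = set (elist (0 # [1..<1 + p])) \<union>
    set (elist (0 # [1 + p..<1 + p + q])) \<union> set (elist (0 # [1 + p + q..<1 + p + q + r]))"
proof -
  have e: "elist (0 # [a..<a + n]) = {0, a} # elist [a..<a + n]" if "1 \<le> n" for a n :: nat
    using that by (simp add: elist_Cons)
  have "{{i, Suc i} | i. i \<in> {1..<p} \<union> {p + 1..<p + q} \<union> {p + q + 1..<p + q + r}} =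
    set (elist [1..<1 + p]) \<union> set (elist [1 + p..<1 + p + q]) \<union>
    set (elist [1 + p + q..<1 + p + q + r])"
    unfolding set_elist_upt' setcompr_eq_image Collect_mem_eq image_Un by (simp add: add.commute)
  then show ?thesis
    unfolding T_graph_def e[OF assms(1)] e[OF assms(2)] e[OF assms(3)]
    by (simp add: Un_ac insert_commute)
qed

lemma edges_B_affine_graph:
  "edges (B_affine_graph l) = set (elist [1..<l]) \<union> {{1, l}, {1, l + 1}}"
  by (simp add: B_affine_graph_def set_elist_upt')

lemma edges_D_affine_graph:
  "edges (D_affine_graph l) = set (elist [3..<l]) \<union> {{1, 3}, {2, 3}, {l - 1, l}, {l - 1, l + 1}}"
  by (simp add: D_affine_graph_def set_elist_upt')

context coxeter
begin

text \<open>Directed opposite to \<open>labelled_iso\<close>: a map from numbers into G turns an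
  interval of vertex numbers directly into a list of vertices of G.\<close>

definition copy_of :: "nat ugraph \<Rightarrow> (nat set \<Rightarrow> enat) \<Rightarrow> (nat \<Rightarrow> 'a) \<Rightarrow> bool" where
  "copy_of Y g k \<longleftrightarrow> inj_on k (verts Y) \<and> verts G = k ` verts Y \<and>
     edges G = (`) k ` edges Y \<and> (\<forall>e\<in>edges Y. f (k ` e) = g e)"

lemma labelled_iso_imp_copy:
  assumes "labelled_iso (G, f) (Y, g)"
  obtains k where "copy_of Y g k"
proof -
  obtain h where h: "bij_betw h (verts G) (verts Y)" "edges Y = (`) h ` edges G"
    "\<forall>e\<in>edges G. g (h ` e) = f e"
    using assms by (auto simp: labelled_iso_def graph_iso_def)
  define k where "k = inv_into (verts G) h"
  have kh: "k ` h ` e = e" if "e \<in> edges G" for e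
    using h(1) edge_subset[OF that] by (simp add: k_def bij_betw_def inv_into_image_cancel)
  have "bij_betw k (verts Y) (verts G)" using h(1) by (simp add: k_def bij_betw_inv_into)
  then have "copy_of Y g k"
    using h kh by (auto simp: copy_of_def bij_betw_def image_iff)
  then show ?thesis using that by blast
qed

text \<open>The second assumption is there because a standard graph is not known to be a Coxeter
  graph, and the inverse of k cancels only on sets of vertices.\<close>

lemma copy_imp_labelled_iso:
  assumes "copy_of Y g k" "edges Y \<subseteq> Pow (verts Y)"
  shows "labelled_iso (G, f) (Y, g)"
proof -
  define h where "h = inv_into (verts Y) k"
  have k: "bij_betw k (verts Y) (verts G)" using assms(1) by (simp add: copy_of_def bij_betw_def)
  have hk: "h ` k ` e = e" if "e \<in> edges Y" for e
    unfolding h_def using assms that by (intro inv_into_image_cancel) (auto simp: copy_of_def)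
  have "edges Y = (`) h ` edges G"
    using assms(1) hk by (auto simp: copy_of_def image_iff)
  moreover have "bij_betw h (verts G) (verts Y)" using k by (simp add: h_def bij_betw_inv_into)
  ultimately have "graph_iso h G Y" by (simp add: graph_iso_def)
  moreover have "\<forall>e\<in>edges G. g (h ` e) = f e" using assms(1) hk by (auto simp: copy_of_def)
  ultimately show ?thesis by (auto simp: labelled_iso_def)
qed

section \<open>Shapes, and their equivalence with isomorphism to the standard graphs\<close>

definition path_shape :: "'a list \<Rightarrow> bool" where
  "path_shape vs \<longleftrightarrow> distinct vs \<and> vs \<noteq> [] \<and> verts G = set vs \<and> edges G = set (elist vs)"

definition cycle_shape :: "'a list \<Rightarrow> bool" where
  "cycle_shape vs \<longleftrightarrow> distinct vs \<and> 3 \<le> length vs \<and> verts G = set vs \<and>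
     edges G = insert {hd vs, last vs} (set (elist vs))"

text \<open>Labels are unconstrained, so that this shape also covers the graphs of
  type B in list IV.\<close>

definition T_shape :: "'a \<Rightarrow> 'a list \<Rightarrow> 'a list \<Rightarrow> 'a list \<Rightarrow> bool" where
  "T_shape x as bs cs \<longleftrightarrow> distinct (x # as @ bs @ cs) \<and> as \<noteq> [] \<and> bs \<noteq> [] \<and> cs \<noteq> [] \<and>
     verts G = set (x # as @ bs @ cs) \<and>
     edges G = set (elist (x # as)) \<union> set (elist (x # bs)) \<union> set (elist (x # cs))"

text \<open>If \<open>ys\<close> is a single vertex, its first and last vertex coincide and all four
  leaves hang on it; this is the star with four leaves.\<close>

definition D_shape :: "'a \<Rightarrow> 'a \<Rightarrow> 'a list \<Rightarrow> 'a \<Rightarrow> 'a \<Rightarrow> bool" where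
  "D_shape a b ys c d \<longleftrightarrow> distinct ([a, b] @ ys @ [c, d]) \<and> ys \<noteq> [] \<and>
     verts G = set ([a, b] @ ys @ [c, d]) \<and>
     edges G = set (elist ys) \<union> {{a, hd ys}, {b, hd ys}, {last ys, c}, {last ys, d}}"

lemma labelled_iso_lpath:
  "labelled_iso (G, f) (lpath ms) \<longleftrightarrow> (\<exists>vs. path_shape vs \<and> map f (elist vs) = ms)"
proof
  let ?n = "Suc (length ms)"
  assume "labelled_iso (G, f) (lpath ms)"
  then obtain k where k: "copy_of (path_graph ?n) (\<lambda>e. ms ! Min e) k"
    unfolding lpath_def by (rule labelled_iso_imp_copy)
  define vs where "vs = map k [0..<?n]"
  have "path_shape vs"
    using k by (simp add: copy_of_def path_shape_def vs_def edges_path_graph distinct_map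
        image_elist) (simp add: path_graph_def atLeast0LessThan)
  moreover have "map f (elist vs) = ms"
  proof (rule nth_equalityI)
    show "length (map f (elist vs)) = length ms" by (simp add: vs_def)
    fix i assume "i < length (map f (elist vs))"
    then have i: "i < length ms" by (simp add: vs_def)
    then have "{i, Suc i} \<in> edges (path_graph ?n)" by (auto simp: path_graph_def)
    then have "f (k ` {i, Suc i}) = ms ! Min {i, Suc i}" using k by (auto simp: copy_of_def)
    moreover have "elist vs ! i = k ` {i, Suc i}"
      using i by (simp add: elist_nth vs_def)
    ultimately show "map f (elist vs) ! i = ms ! i" using i by (simp add: vs_def)
  qed
  ultimately show "\<exists>vs. path_shape vs \<and> map f (elist vs) = ms" by blast
next
  assume "\<exists>vs. path_shape vs \<and> map f (elist vs) = ms"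
  then obtain vs where vs: "path_shape vs" and ms: "map f (elist vs) = ms" by blast
  let ?n = "Suc (length ms)"
  have len: "length vs = ?n" using vs ms by (auto simp: path_shape_def)
  have m: "map ((!) vs) [0..<?n] = vs" using map_nth[of vs] len by simp
  have "copy_of (path_graph ?n) (\<lambda>e. ms ! Min e) ((!) vs)"
    unfolding copy_of_def edges_path_graph image_elist m
  proof (intro conjI ballI)
    show "inj_on ((!) vs) (verts (path_graph ?n))"
      using vs len by (auto simp: path_shape_def path_graph_def inj_on_nth)
    show "verts G = (!) vs ` verts (path_graph ?n)"
      using vs len by (auto simp: path_shape_def path_graph_def set_conv_nth)
    show "edges G = set (elist vs)" using vs by (simp add: path_shape_def)
    fix e assume "e \<in> set (elist [0..<?n])"
    then obtain i where i: "e = {i, Suc i}" "i < length ms" by (auto simp: set_elist_upt)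
    have "ms ! i = f (elist vs ! i)" using i len by (subst ms[symmetric]) simp
    then show "f ((!) vs ` e) = ms ! Min e" using i len by (simp add: elist_nth)
  qed
  then show "labelled_iso (G, f) (lpath ms)"
    unfolding lpath_def by (rule copy_imp_labelled_iso) (auto simp: path_graph_def)
qed

lemma labelled_iso_cycle:
  assumes "3 \<le> n"
  shows "labelled_iso (G, f) (cycle_graph n, \<lambda>_. 3) \<longleftrightarrow>
    (\<exists>vs. cycle_shape vs \<and> length vs = n \<and> f ` edges G \<subseteq> {3})"
proof
  assume "labelled_iso (G, f) (cycle_graph n, \<lambda>_. 3)"
  then obtain k where k: "copy_of (cycle_graph n) (\<lambda>_. 3) k" by (rule labelled_iso_imp_copy)
  define vs where "vs = map k [0..<n]"
  have "hd vs = k 0" "last vs = k (n - 1)" using assms by (auto simp: vs_def hd_map last_map)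
  then have "cycle_shape vs"
    using k assms by (simp add: copy_of_def cycle_shape_def edges_cycle_graph vs_def distinct_map
        image_elist) (simp add: cycle_graph_def atLeast0LessThan)
  moreover have "f ` edges G \<subseteq> {3}" using k by (auto simp: copy_of_def)
  ultimately show "\<exists>vs. cycle_shape vs \<and> length vs = n \<and> f ` edges G \<subseteq> {3}"
    by (auto simp: vs_def)
next
  assume "\<exists>vs. cycle_shape vs \<and> length vs = n \<and> f ` edges G \<subseteq> {3}"
  then obtain vs where vs: "cycle_shape vs" "length vs = n" "f ` edges G \<subseteq> {3}" by blast
  have m: "map ((!) vs) [0..<n] = vs" using map_nth[of vs] vs by simp
  have "vs \<noteq> []" using vs assms by auto
  then have hl: "hd vs = vs ! 0" "last vs = vs ! (n - 1)"
    using vs by (simp_all add: hd_conv_nth last_conv_nth)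
  have eG: "edges G = (`) ((!) vs) ` edges (cycle_graph n)"
    using vs by (simp add: cycle_shape_def edges_cycle_graph image_elist m hl)
  have "copy_of (cycle_graph n) (\<lambda>_. 3) ((!) vs)"
    unfolding copy_of_def
  proof (intro conjI ballI)
    show "inj_on ((!) vs) (verts (cycle_graph n))"
      using vs by (auto simp: cycle_shape_def cycle_graph_def inj_on_nth)
    show "verts G = (!) vs ` verts (cycle_graph n)"
      using vs by (auto simp: cycle_shape_def cycle_graph_def set_conv_nth)
    show "edges G = (`) ((!) vs) ` edges (cycle_graph n)" by (rule eG)
    show "f ((!) vs ` e) = 3" if "e \<in> edges (cycle_graph n)" for e
    proof -
      have "(!) vs ` e \<in> edges G" unfolding eG using that by (rule imageI)
      then show ?thesis using vs(3) by auto
    qed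
  qed
  then show "labelled_iso (G, f) (cycle_graph n, \<lambda>_. 3)"
    by (rule copy_imp_labelled_iso) (use assms in \<open>auto simp: cycle_graph_def\<close>)
qed

lemma labelled_iso_T:
  assumes pqr: "1 \<le> p" "1 \<le> q" "1 \<le> r"
  shows "labelled_iso (G, f) (T_graph p q r, \<lambda>_. 3) \<longleftrightarrow>
    (\<exists>x as bs cs. T_shape x as bs cs \<and> length as = p \<and> length bs = q \<and> length cs = r \<and>
       f ` edges G \<subseteq> {3})"
proof
  assume "labelled_iso (G, f) (T_graph p q r, \<lambda>_. 3)"
  then obtain k where k: "copy_of (T_graph p q r) (\<lambda>_. 3) k" by (rule labelled_iso_imp_copy)
  let ?as = "map k [1..<1 + p]" and ?bs = "map k [1 + p..<1 + p + q]"
    and ?cs = "map k [1 + p + q..<1 + p + q + r]"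
  \<comment> \<open>The three arms are numbered consecutively, so one injective map on an initial
    interval yields the distinctness of all three vertex lists at once.\<close>
  have l: "0 # [1..<1 + p] @ [1 + p..<1 + p + q] @ [1 + p + q..<1 + p + q + r] = [0..<1 + p + q + r]"
    using upt_add_eq_append[of 0 "1 + p + q" r] upt_add_eq_append[of 0 "1 + p" q]
      upt_conv_Cons[of 0 "1 + p"] by simp
  have s: "k 0 # ?as @ ?bs @ ?cs = map k [0..<1 + p + q + r]"
    by (subst l[symmetric]) simp
  have "verts (T_graph p q r) = set [0..<1 + p + q + r]" by (auto simp: T_graph_def)
  then have "T_shape (k 0) ?as ?bs ?cs"
    using k pqr unfolding T_shape_def s
    by (simp add: copy_of_def edges_T_graph image_Un image_elist distinct_map)
  moreover have "f ` edges G \<subseteq> {3}" using k by (auto simp: copy_of_def)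
  moreover have "length ?as = p" "length ?bs = q" "length ?cs = r" by simp_all
  ultimately show "\<exists>x as bs cs. T_shape x as bs cs \<and> length as = p \<and> length bs = q \<and>
    length cs = r \<and> f ` edges G \<subseteq> {3}" by blast
next
  assume "\<exists>x as bs cs. T_shape x as bs cs \<and> length as = p \<and> length bs = q \<and>
    length cs = r \<and> f ` edges G \<subseteq> {3}"
  then obtain x as bs cs where T: "T_shape x as bs cs" and len: "length as = p" "length bs = q"
    "length cs = r" and f: "f ` edges G \<subseteq> {3}" by blast
  let ?vs = "x # as @ bs @ cs"
  have m: "map ((!) ?vs) [1..<1 + p] = as" "map ((!) ?vs) [1 + p..<1 + p + q] = bs"
    "map ((!) ?vs) [1 + p + q..<1 + p + q + r] = cs"
    using map_nth_segment[of "[x]" as "bs @ cs"] map_nth_segment[of "x # as" bs cs]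
      map_nth_segment[of "x # as @ bs" cs "[]"] len by (simp_all add: add.assoc)
  have eG: "edges G = (`) ((!) ?vs) ` edges (T_graph p q r)"
    using T m by (simp add: T_shape_def edges_T_graph[OF pqr] image_Un image_elist)
  have V: "verts (T_graph p q r) = {..<length ?vs}" using len by (auto simp: T_graph_def)
  have "copy_of (T_graph p q r) (\<lambda>_. 3) ((!) ?vs)"
    unfolding copy_of_def V
  proof (intro conjI ballI)
    show "inj_on ((!) ?vs) {..<length ?vs}" using T by (intro inj_on_nth) (auto simp: T_shape_def)
    show "verts G = (!) ?vs ` {..<length ?vs}"
      using T nth_image[of "length ?vs" ?vs] by (simp add: T_shape_def atLeast0LessThan)
    show "edges G = (`) ((!) ?vs) ` edges (T_graph p q r)" by (rule eG)
    show "f ((!) ?vs ` e) = 3" if "e \<in> edges (T_graph p q r)" for e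
    proof -
      have "(!) ?vs ` e \<in> edges G" unfolding eG using that by (rule imageI)
      then show ?thesis using f by auto
    qed
  qed
  then show "labelled_iso (G, f) (T_graph p q r, \<lambda>_. 3)"
    by (rule copy_imp_labelled_iso) (use pqr in \<open>auto simp: T_graph_def\<close>)
qed

lemma labelled_iso_B_affine:
  assumes l: "3 \<le> l"
  shows "labelled_iso (G, f) (B_affine_graph l, (\<lambda>_. 3)({l - 2, l - 1} := 4)) \<longleftrightarrow>
    (\<exists>x a b cs. T_shape x [a] [b] cs \<and> f {x, a} = 3 \<and> f {x, b} = 3 \<and>
       map f (elist (x # cs)) = replicate (l - 3) 3 @ [4])"
proof
  let ?g = "(\<lambda>_. 3)({l - 2, l - 1} := 4) :: nat set \<Rightarrow> enat"
  assume "labelled_iso (G, f) (B_affine_graph l, ?g)"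
  then obtain k where k: "copy_of (B_affine_graph l) ?g k" by (rule labelled_iso_imp_copy)
  define cs where "cs = map k [2..<l]"
  have ys: "k 1 # cs = map k [1..<l]"
    using l upt_conv_Cons[of "Suc 0" l] by (simp add: cs_def numeral_2_eq_2)
  have V: "verts (B_affine_graph l) = set ([1..<l] @ [l, l + 1])" using l by (auto simp: B_affine_graph_def)
  have s: "set (k 1 # [k l] @ [k (l + 1)] @ cs) = k ` set ([1..<l] @ [l, l + 1])"
    unfolding list.set set_append using arg_cong[OF ys, of set] by auto
  have "distinct (map k ([1..<l] @ [l, l + 1]))"
    using k unfolding copy_of_def V by (subst distinct_map) auto
  then have "distinct (map k [1..<l] @ [k l, k (l + 1)])" by simp
  then have "distinct ((k 1 # cs) @ [k l, k (l + 1)])" unfolding ys .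
  then have d: "distinct (k 1 # [k l] @ [k (l + 1)] @ cs)" by auto
  have "edges G = set (elist (k 1 # cs)) \<union> {{k 1, k l}, {k 1, k (l + 1)}}"
    unfolding ys using k by (simp add: copy_of_def edges_B_affine_graph image_elist image_Un)
  moreover have "cs \<noteq> []" using l by (simp add: cs_def)
  ultimately have "T_shape (k 1) [k l] [k (l + 1)] cs"
    using k d s unfolding T_shape_def copy_of_def V by (simp add: insert_commute)
  moreover have fk: "f (k ` e) = ?g e" if "e \<in> edges (B_affine_graph l)" for e
    using k that by (auto simp: copy_of_def)
  have "f {k 1, k l} = 3" "f {k 1, k (l + 1)} = 3"
    using fk[of "{1, l}"] fk[of "{1, l + 1}"] l
    by (auto simp: edges_B_affine_graph doubleton_eq_iff)
  moreover have "map f (elist (k 1 # cs)) = replicate (l - 3) 3 @ [4]"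
    unfolding ys
  proof (rule nth_equalityI)
    show "length (map f (elist (map k [1..<l]))) = length (replicate (l - 3) (3::enat) @ [4])"
      using l by simp
    fix i assume "i < length (map f (elist (map k [1..<l])))"
    then have i: "i < l - 2" by simp
    then have "{Suc i, Suc (Suc i)} \<in> edges (B_affine_graph l)"
      by (auto simp: edges_B_affine_graph set_elist_upt)
    from fk[OF this] have "f {k (Suc i), k (Suc (Suc i))} = (if i = l - 3 then 4 else 3)"
      using i l by (auto simp: doubleton_eq_iff)
    then show "map f (elist (map k [1..<l])) ! i = (replicate (l - 3) 3 @ [4]) ! i"
      using i l by (auto simp: elist_nth nth_append)
  qed
  ultimately show "\<exists>x a b cs. T_shape x [a] [b] cs \<and> f {x, a} = 3 \<and> f {x, b} = 3 \<and>
       map f (elist (x # cs)) = replicate (l - 3) 3 @ [4]" by blast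
next
  let ?g = "(\<lambda>_. 3)({l - 2, l - 1} := 4) :: nat set \<Rightarrow> enat"
  assume "\<exists>x a b cs. T_shape x [a] [b] cs \<and> f {x, a} = 3 \<and> f {x, b} = 3 \<and>
       map f (elist (x # cs)) = replicate (l - 3) 3 @ [4]"
  then obtain x a b cs where T: "T_shape x [a] [b] cs" and fab: "f {x, a} = 3" "f {x, b} = 3"
    and fc: "map f (elist (x # cs)) = replicate (l - 3) 3 @ [4]" by blast
  have "length (elist (x # cs)) = l - 2" using l arg_cong[OF fc, of length] by simp
  then have len: "length cs = l - 2" by simp
  \<comment> \<open>The order follows the numbering of the standard graph: first the path 1, ..., l
    - 1 starting at x, then the leaves l and l + 1. Numbers start at 1, so vertex i is found at
    position i - 1.\<close>
  let ?vs = "(x # cs) @ [a, b]"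
  let ?k = "\<lambda>i. ?vs ! (i - 1)"
  have m: "map ?k [1..<l] = x # cs"
  proof -
    have "Suc (Suc (l - 2)) = l" using l by simp
    then show ?thesis using map_nth_pred_segment[of "[]" "x # cs" "[a, b]"] len by simp
  qed
  have kab: "?k 1 = x" "?k l = a" "?k (l + 1) = b" 
  proof -
    have "l = Suc (Suc (length cs))" using len l by simp
    then show "?k 1 = x" "?k l = a" "?k (l + 1) = b" by (simp_all add: nth_append)
  qed
  have kV: "?k ` {1..l + 1} = set ?vs"
  proof -
    have "{1..l + 1} = Suc ` {..<l + 1}" by (simp add: image_Suc_lessThan)
    then have "?k ` {1..l + 1} = (!) ?vs ` {..<l + 1}" by (simp only: image_image diff_Suc_1)
    then show ?thesis using nth_image[of "l + 1" ?vs] len l by (simp add: atLeast0LessThan)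
  qed
  have "edges G = set (elist (x # cs)) \<union> {{x, a}, {x, b}}" using T by (auto simp: T_shape_def)
  then have eG: "edges G = (`) ?k ` edges (B_affine_graph l)"
    unfolding edges_B_affine_graph image_Un image_elist m using kab by simp
  have "copy_of (B_affine_graph l) ?g ?k"
    unfolding copy_of_def
  proof (intro conjI ballI)
    have "distinct ?vs" using T by (auto simp: T_shape_def)
    then show "inj_on ?k (verts (B_affine_graph l))"
      using len l by (auto simp: B_affine_graph_def inj_on_def nth_eq_iff_index_eq)
    show "verts G = ?k ` verts (B_affine_graph l)" using T kV by (auto simp: B_affine_graph_def T_shape_def)
    show "edges G = (`) ?k ` edges (B_affine_graph l)" by (rule eG)
    fix e assume "e \<in> edges (B_affine_graph l)"
    then consider i where "e = {Suc i, Suc (Suc i)}" "i < l - 2" | "e = {1, l}" | "e = {1, l + 1}"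
    proof -
      consider j where "e = {j, Suc j}" "1 \<le> j" "Suc j < l" | "e = {1, l}" | "e = {1, l + 1}"
        using \<open>e \<in> _\<close> by (auto simp: edges_B_affine_graph set_elist_upt)
      then show thesis
      proof cases
        case (1 j)
        then show ?thesis using that(1)[of "j - 1"] by (cases j) auto
      qed (use that in blast)+
    qed
    then show "f (?k ` e) = ?g e"
    proof cases
      case 1
      have "?k ` e = elist (x # cs) ! i"
        using 1 len nth_append_left[of i "x # cs" "[a, b]"] nth_append_left[of "Suc i" "x # cs" "[a, b]"]
        by (simp add: elist_nth)
      then have "f (?k ` e) = map f (elist (x # cs)) ! i" using 1 len by simp
      then show ?thesis unfolding fc using 1 l by (auto simp: nth_append doubleton_eq_iff)
    next
      case 2
      then have k: "?k ` e = {x, a}" using kab by simp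
      have "?g e = 3" using 2 l by (auto simp: doubleton_eq_iff)
      then show ?thesis unfolding k using fab by simp
    next
      case 3
      then have k: "?k ` e = {x, b}" using kab by simp
      have "?g e = 3" using 3 l by (auto simp: doubleton_eq_iff)
      then show ?thesis unfolding k using fab by simp
    qed
  qed
  then show "labelled_iso (G, f) (B_affine_graph l, ?g)"
    by (rule copy_imp_labelled_iso) (use l in \<open>auto simp: B_affine_graph_def\<close>)
qed

lemma labelled_iso_D_affine:
  assumes l: "4 \<le> l"
  shows "labelled_iso (G, f) (D_affine_graph l, \<lambda>_. 3) \<longleftrightarrow>
    (\<exists>a b ys c d. D_shape a b ys c d \<and> length ys = l - 3 \<and> f ` edges G \<subseteq> {3})"
proof
  assume "labelled_iso (G, f) (D_affine_graph l, \<lambda>_. 3)"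
  then obtain k where k: "copy_of (D_affine_graph l) (\<lambda>_. 3) k" by (rule labelled_iso_imp_copy)
  define ys where "ys = map k [3..<l]"
  have V: "verts (D_affine_graph l) = set ([1, 2] @ [3..<l] @ [l, l + 1])" using l
    by (auto simp: D_affine_graph_def)
  have s: "[k 1, k 2] @ ys @ [k l, k (l + 1)] = map k ([1, 2] @ [3..<l] @ [l, l + 1])" by (simp add: ys_def)
  have h: "hd ys = k 3" "last ys = k (l - 1)" using l by (auto simp: ys_def hd_map last_map)
  have "distinct (map k ([1, 2] @ [3..<l] @ [l, l + 1]))"
    using k l unfolding copy_of_def V by (subst distinct_map) auto
  moreover have "edges G = set (elist ys) \<union> {{k 1, hd ys}, {k 2, hd ys}, {last ys, k l}, {last ys, k (l + 1)}}"
    unfolding h using k by (simp add: copy_of_def edges_D_affine_graph image_elist ys_def image_Un Un_commute)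
  moreover have "ys \<noteq> []" using l by (simp add: ys_def)
  ultimately have "D_shape (k 1) (k 2) ys (k l) (k (l + 1))"
    using k unfolding D_shape_def copy_of_def V s by simp
  moreover have "f ` edges G \<subseteq> {3}" using k by (auto simp: copy_of_def)
  moreover have "length ys = l - 3" by (simp add: ys_def)
  ultimately show "\<exists>a b ys c d. D_shape a b ys c d \<and> length ys = l - 3 \<and> f ` edges G \<subseteq> {3}" by blast
next
  assume "\<exists>a b ys c d. D_shape a b ys c d \<and> length ys = l - 3 \<and> f ` edges G \<subseteq> {3}"
  then obtain a b ys c d where D: "D_shape a b ys c d" and len: "length ys = l - 3"
    and f: "f ` edges G \<subseteq> {3}" by blast
  let ?vs = "[a, b] @ ys @ [c, d]"
  let ?k = "\<lambda>i. ?vs ! (i - 1)"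
  have m: "map ?k [3..<l] = ys"
  proof -
    have "Suc (length [a, b]) = 3" "Suc (length [a, b] + length ys) = l" using len l by simp_all
    then show ?thesis using map_nth_pred_segment[of "[a, b]" ys "[c, d]"]
      by (simp add: numeral_3_eq_3)
  qed
  \<comment> \<open>Writing l as j + 4 removes truncated subtraction, so that the list positions
    below can be evaluated by simplification.\<close>
  have "l = Suc (Suc (Suc (Suc (l - 4))))" using l by simp
  then obtain j where j: "l = Suc (Suc (Suc (Suc j)))" by blast
  have ne: "ys \<noteq> []" using D by (simp add: D_shape_def)
  have kv: "?k 1 = a" "?k 2 = b" "?k l = c" "?k (l + 1) = d"
    using len by (simp_all add: j nth_append)
  have kh: "?k 3 = hd ys" "?k (l - 1) = last ys"
    using len ne by (simp_all add: j nth_append hd_conv_nth last_conv_nth numeral_3_eq_3)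
  have kV: "?k ` {1..l + 1} = set ?vs"
  proof -
    have "{1..l + 1} = Suc ` {..<l + 1}" by (simp add: image_Suc_lessThan)
    then have "?k ` {1..l + 1} = (!) ?vs ` {..<l + 1}" by (simp only: image_image diff_Suc_1)
    then show ?thesis using nth_image[of "l + 1" ?vs] len l by (simp add: atLeast0LessThan)
  qed
  have eG: "edges G = (`) ?k ` edges (D_affine_graph l)"
    using D unfolding edges_D_affine_graph image_Un image_elist m D_shape_def image_insert image_empty kv kh
    by simp
  have "copy_of (D_affine_graph l) (\<lambda>_. 3) ?k"
    unfolding copy_of_def
  proof (intro conjI ballI)
    have "distinct ?vs" using D by (auto simp: D_shape_def)
    then show "inj_on ?k (verts (D_affine_graph l))"
      using len l by (auto simp: D_affine_graph_def inj_on_def nth_eq_iff_index_eq)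
    show "verts G = ?k ` verts (D_affine_graph l)" using D kV by (auto simp: D_affine_graph_def D_shape_def)
    show "edges G = (`) ?k ` edges (D_affine_graph l)" by (rule eG)
    show "f (?k ` e) = 3" if "e \<in> edges (D_affine_graph l)" for e
    proof -
      have "?k ` e \<in> edges G" unfolding eG using that by (rule imageI)
      then show ?thesis using f by auto
    qed
  qed
  then show "labelled_iso (G, f) (D_affine_graph l, \<lambda>_. 3)"
    by (rule copy_imp_labelled_iso) (use l in \<open>auto simp: D_affine_graph_def\<close>)
qed

end

section \<open>Rho-degrees of the listed graphs\<close>

context coxeter
begin

text \<open>A simple branch has at least one vertex and \<open>rho 1 = 1\<close>. This lower bound
  is what limits degrees and labels in the classification.\<close>

lemma contrib_ge_weight:
  assumes "e \<in> incident G x"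
  shows "weight (f e) \<le> contrib x e"
proof -
  have "1 \<le> partial_rho G (f_hat f) x e"
  proof (cases "simple_pair G (f_hat f) x e")
    case True
    then obtain ys where ys: "arm G x ys" "e = {x, hd ys}" by (rule simple_pair_imp_arm)
    then have "1 \<le> card (set ys)" by (auto simp: arm_def Suc_le_eq card_gt_0_iff)
    then show ?thesis using True ys rho_ge_1 by (simp add: partial_rho_def arm_branch)
  qed (simp add: partial_rho_def)
  moreover have "1 \<le> weight (f e)" using assms label_ge_3 weight_ge_1 by (simp add: incident_def)
  ultimately show ?thesis by (simp add: contrib_def f_hat_eq_weight mult_le_cancel_left1)
qed

lemma contrib_ge_1:
  assumes "e \<in> incident G x" shows "1 \<le> contrib x e"
  using order_trans[OF weight_ge_1 contrib_ge_weight[OF assms]] assms label_ge_3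
  by (simp add: incident_def)

lemma contrib_le:
  assumes "e \<in> edges G" shows "contrib x e \<le> 2 * weight (f e)"
proof -
  have "partial_rho G (f_hat f) x e \<le> 2" by (simp add: partial_rho_def less_imp_le[OF rho_less_2])
  then have "weight (f e) * partial_rho G (f_hat f) x e \<le> weight (f e) * 2"
    using weight_ge_1[OF label_ge_3[OF assms]] by (intro mult_left_mono) auto
  then show ?thesis by (simp add: contrib_def f_hat_eq_weight)
qed

lemma contrib_no_arm:
  assumes "\<And>ys. arm G x ys \<Longrightarrow> hd ys \<noteq> y"
  shows "contrib x {x, y} = 2 * weight (f {x, y})"
proof -
  have "\<not> simple_pair G (f_hat f) x {x, y}"
  proof
    assume "simple_pair G (f_hat f) x {x, y}"
    then obtain ys where ys: "arm G x ys" "{x, y} = {x, hd ys}" by (rule simple_pair_imp_arm)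
    then have "y = hd ys" by (auto simp: doubleton_eq_iff)
    then show False using assms ys(1) by blast
  qed
  then show ?thesis by (simp add: contrib_def partial_rho_def f_hat_eq_weight)
qed

lemma armI:
  assumes "ys \<noteq> []" "distinct (x # ys)" "edges G = set (elist (x # ys)) \<union> F"
    and "\<And>e. e \<in> F \<Longrightarrow> e \<inter> set ys = {}"
  shows "arm G x ys"
  using assms by (auto simp: arm_def)

text \<open>An arm can be left only through x. Together with the degree bound on arms, this shows
  that no arm starts in a direction in which a path leads to a vertex of degree at least 3.\<close>

lemma arm_propagate:
  assumes "arm G x as" "hd zs \<in> set as" "set (elist zs) \<subseteq> edges G" "x \<notin> set zs"
  shows "set zs \<subseteq> set as"
  using assms(2-4)
proof (induction zs rule: elist.induct)
  case (3 u v zs)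
  then have "{u, v} \<in> edges G" "{u, v} \<inter> set as \<noteq> {}" by auto
  then have "{u, v} \<in> set (elist (x # as))" using assms(1) by (auto simp: arm_def)
  then have "{u, v} \<subseteq> set (x # as)" by (rule elist_subset)
  then show ?case using 3 by auto
qed auto

text \<open>The edge towards x is only estimated, by twice its weight. The edges further out form an
  arm at u with labels \<open>post\<close>, which is empty for the last vertex.\<close>

lemma arm_rho_degree:
  assumes "arm G x ys" "u \<in> set ys"
  obtains pre m post where "map f (elist (x # ys)) = pre @ m # post" "3 \<le> m"
    "rho_degree G (f_hat f) u \<le> 2 * weight m + side post"
proof -
  obtain as bs where ys: "ys = as @ u # bs" using assms(2) split_list by fast
  let ?e = "{last (x # as), u}"
  have el: "elist (x # ys) = elist (x # as) @ ?e # elist (u # bs)"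
    using elist_append[of "x # as" u bs] elist_snoc[of "x # as" u] by (simp add: ys)
  have arm: "arm G x (as @ u # bs)" using assms ys by simp
  have e: "?e \<in> edges G" using assms(1) el by (auto simp: arm_def)
  have "rho_degree G (f_hat f) u \<le> contrib u ?e + side (map f (elist (u # bs)))"
  proof (cases "bs = []")
    case True
    then show ?thesis by (simp add: rho_degree_eq arm_incident[OF arm])
  next
    case False
    then have u: "arm G u bs" using arm_suffix[OF arm] by simp
    have "degree G u = 2" using arm_degree[OF arm] False by simp
    then have "?e \<noteq> {u, hd bs}" using False by (auto simp: degree_def arm_incident[OF arm])
    then show ?thesis using False
      by (simp add: rho_degree_eq arm_incident[OF arm] arm_contrib[OF u])
  qed
  then have "rho_degree G (f_hat f) u \<le> 2 * weight (f ?e) + side (map f (elist (u # bs)))"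
    using contrib_le[OF e, of u] by simp
  then show ?thesis using that el label_ge_3[OF e] by simp
qed

lemma arm_rho_degree_label_3:
  assumes "arm G x ys" "u \<in> set ys" "f ` set (elist (x # ys)) \<subseteq> {3}"
  shows "rho_degree G (f_hat f) u < 4"
proof -
  obtain pre m post where m: "map f (elist (x # ys)) = pre @ m # post"
    "rho_degree G (f_hat f) u \<le> 2 * weight m + side post"
    using arm_rho_degree[OF assms(1,2)] by blast
  have "set (map f (elist (x # ys))) \<subseteq> {3}" using assms(3) by simp
  then have "m = 3" "\<forall>l\<in>set post. l = 3" unfolding m(1) by auto
  then have "post = replicate (length post) 3" by (simp add: replicate_length_same)
  then have "side post < 2" using rho_less_2 by (metis side_replicate)
  then show ?thesis using m \<open>m = 3\<close> by simp
qed

section \<open>Paths\<close>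

lemma path_rho_degree:
  assumes "path_shape (as @ v # bs)"
  shows "rho_degree G (f_hat f) v =
    side (rev (map f (elist (as @ [v])))) + side (map f (elist (v # bs)))"
proof -
  have d: "distinct (as @ v # bs)" and eG: "edges G = set (elist (as @ [v])) \<union> set (elist (v # bs))"
    using assms elist_append[of as v bs] by (simp_all add: path_shape_def)
  have inc: "incident G v = (if as = [] then {} else {{v, last as}}) \<union> (if bs = [] then {} else {{v, hd bs}})"
    using elist_incident[OF d] assms by (auto simp: incident_def path_shape_def insert_commute)
  \<comment> \<open>The part before v is an arm at v when read outwards from v, hence backwards;
    this is where the reversal of labels comes from.\<close>
  have r: "elist (v # rev as) = rev (elist (as @ [v]))" using elist_rev[of "as @ [v]"] by simp
  have A: "contrib v {v, last as} = side (rev (map f (elist (as @ [v]))))" if "as \<noteq> []"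
  proof -
    have "arm G v (rev as)"
    proof (rule armI)
      show "edges G = set (elist (v # rev as)) \<union> set (elist (v # bs))" by (simp add: r eG)
      show "e \<inter> set (rev as) = {}" if "e \<in> set (elist (v # bs))" for e
        using elist_subset[OF that] d by auto
    qed (use that d in auto)
    then show ?thesis using arm_contrib[of v "rev as"] that by (simp add: hd_rev r rev_map)
  qed
  have B: "contrib v {v, hd bs} = side (map f (elist (v # bs)))" if "bs \<noteq> []"
  proof -
    have "arm G v bs"
    proof (rule armI)
      show "edges G = set (elist (v # bs)) \<union> set (elist (as @ [v]))" by (simp add: eG Un_commute)
      show "e \<inter> set bs = {}" if "e \<in> set (elist (as @ [v]))" for e
        using elist_subset[OF that] d by auto
    qed (use that d in auto)
    then show ?thesis by (rule arm_contrib)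
  qed
  have "{v, last as} \<noteq> {v, hd bs}" if "as \<noteq> []" "bs \<noteq> []"
  proof -
    have "last as \<in> set as" "hd bs \<notin> set as" using that d by auto
    then show ?thesis by (metis doubleton_eq_iff)
  qed
  then show ?thesis unfolding rho_degree_eq inc using A B by auto
qed

text \<open>Vertices of a path correspond to splittings of its label list. This lemma and
  \<open>path_rho_degree_split\<close> are the two directions; they reduce paths to statements about
  lists of labels.\<close>

lemma path_ex_rho_degree:
  assumes vs: "path_shape vs" and ms: "map f (elist vs) = ms1 @ ms2"
  shows "\<exists>v\<in>verts G. rho_degree G (f_hat f) v = side (rev ms1) + side ms2"
proof -
  let ?n = "length ms1"
  have "length vs = Suc (length (ms1 @ ms2))"
    using arg_cong[OF ms, of length] vs by (cases vs) (auto simp: path_shape_def)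
  then have n: "?n < length vs" by simp
  define as v bs where "as = take ?n vs" and "v = vs ! ?n" and "bs = drop (Suc ?n) vs"
  have v: "vs = as @ v # bs" using id_take_nth_drop[OF n] by (simp add: as_def v_def bs_def)
  have "ms1 @ ms2 = map f (elist (as @ [v])) @ map f (elist (v # bs))"
    using ms elist_append[of as v bs] by (simp add: v)
  moreover have "length (map f (elist (as @ [v]))) = length ms1" using n by (simp add: as_def)
  ultimately have "map f (elist (as @ [v])) = ms1" "map f (elist (v # bs)) = ms2" by auto
  moreover have "v \<in> verts G" using vs v by (auto simp: path_shape_def)
  ultimately show ?thesis using path_rho_degree vs v by blast
qed

lemma path_rho_degree_split:
  assumes vs: "path_shape vs" and v: "v \<in> verts G"
  obtains ms1 ms2 where "map f (elist vs) = ms1 @ ms2"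
    "rho_degree G (f_hat f) v = side (rev ms1) + side ms2"
proof -
  obtain as bs where s: "vs = as @ v # bs" using vs v split_list[of v vs] by (auto simp: path_shape_def)
  show ?thesis
    using that[of "map f (elist (as @ [v]))" "map f (elist (v # bs))"] path_rho_degree[of as v bs] vs
      elist_append[of as v bs] by (simp add: s)
qed

section \<open>Trees consisting of three arms at one vertex\<close>

lemma T_shape_arms:
  assumes "T_shape x as bs cs"
  shows "arm G x as" "arm G x bs" "arm G x cs"
    and "incident G x = {{x, hd as}, {x, hd bs}, {x, hd cs}}" "distinct [hd as, hd bs, hd cs]"
proof -
  have T: "distinct (x # as @ bs @ cs)" "as \<noteq> []" "bs \<noteq> []" "cs \<noteq> []"
    "edges G = set (elist (x # as)) \<union> set (elist (x # bs)) \<union> set (elist (x # cs))"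
    using assms by (auto simp: T_shape_def)
  have sub: "e \<subseteq> set (x # ys)" if "e \<in> set (elist (x # ys))" for e ys using elist_subset[OF that] .
  show "arm G x as"
  proof (rule armI)
    show "e \<inter> set as = {}" if "e \<in> set (elist (x # bs)) \<union> set (elist (x # cs))" for e
      using that sub[of e bs] sub[of e cs] T(1) by auto
  qed (use T in auto)
  show "arm G x bs"
  proof (rule armI)
    show "e \<inter> set bs = {}" if "e \<in> set (elist (x # as)) \<union> set (elist (x # cs))" for e
      using that sub[of e as] sub[of e cs] T(1) by auto
  qed (use T in auto)
  show "arm G x cs"
  proof (rule armI)
    show "e \<inter> set cs = {}" if "e \<in> set (elist (x # as)) \<union> set (elist (x # bs))" for e
      using that sub[of e as] sub[of e bs] T(1) by auto
  qed (use T in auto)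
  have I: "{e \<in> set (elist (x # ys)). x \<in> e} = {{x, hd ys}}" if "distinct (x # ys)" "ys \<noteq> []" for ys
    using elist_incident[of "[]" x ys] that by auto
  have "incident G x = {e \<in> set (elist (x # as)). x \<in> e} \<union> {e \<in> set (elist (x # bs)). x \<in> e} \<union>
      {e \<in> set (elist (x # cs)). x \<in> e}"
    unfolding incident_def T(5) by blast
  then show "incident G x = {{x, hd as}, {x, hd bs}, {x, hd cs}}"
    using I[of as] I[of bs] I[of cs] T by auto
  have "hd as \<in> set as" "hd bs \<in> set bs" "hd cs \<in> set cs" "hd bs \<notin> set as" "hd cs \<notin> set as" "hd cs \<notin> set bs"
    using T by auto
  then show "distinct [hd as, hd bs, hd cs]" by (metis distinct_length_2_or_more distinct_singleton)
qed

lemma T_shape_center: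
  assumes "T_shape x as bs cs"
  shows "rho_degree G (f_hat f) x = side (map f (elist (x # as))) + side (map f (elist (x # bs)))
    + side (map f (elist (x # cs)))"
proof -
  note T = T_shape_arms[OF assms]
  have "card {{x, hd as}, {x, hd bs}, {x, hd cs}} = 3"
    using T(5) by (auto simp: card_insert_if doubleton_eq_iff)
  then have "rho_degree G (f_hat f) x = contrib x {x, hd as} + contrib x {x, hd bs} + contrib x {x, hd cs}"
    unfolding rho_degree_eq T(4) using T(5) by (auto simp: doubleton_eq_iff)
  then show ?thesis by (simp add: arm_contrib T(1-3))
qed

text \<open>Only the centre can reach 4: a vertex on an arm gets at most 2 from its inner edge and
  less than 2 from its outer one.\<close>

lemma T_shape_label_3:
  assumes T: "T_shape x as bs cs" and f: "f ` edges G \<subseteq> {3}"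
  shows "rho_degree G (f_hat f) x = rho (length as) + rho (length bs) + rho (length cs)"
    and "y \<in> verts G \<Longrightarrow> y \<noteq> x \<Longrightarrow> rho_degree G (f_hat f) y < 4"
proof -
  have s: "side (map f (elist (x # ys))) = rho (length ys)" if "set (elist (x # ys)) \<subseteq> edges G" for ys
  proof -
    have "\<forall>m\<in>set (map f (elist (x # ys))). m = 3" using that f by auto
    then have "map f (elist (x # ys)) = replicate (length ys) 3"
      using replicate_length_same[of "map f (elist (x # ys))" 3] by simp
    then show ?thesis by simp
  qed
  show "rho_degree G (f_hat f) x = rho (length as) + rho (length bs) + rho (length cs)"
  proof -
    have "set (elist (x # as)) \<subseteq> edges G" "set (elist (x # bs)) \<subseteq> edges G" "set (elist (x # cs)) \<subseteq> edges G"
      using T by (auto simp: T_shape_def)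
    then show ?thesis by (simp add: T_shape_center[OF T] s)
  qed
  assume "y \<in> verts G" "y \<noteq> x"
  then consider "y \<in> set as" | "y \<in> set bs" | "y \<in> set cs" using T by (auto simp: T_shape_def)
  then show "rho_degree G (f_hat f) y < 4"
  proof cases
    case 1 show ?thesis
      by (rule arm_rho_degree_label_3[OF T_shape_arms(1)[OF T] 1]) (use T f in \<open>auto simp: T_shape_def\<close>)
  next
    case 2 show ?thesis
      by (rule arm_rho_degree_label_3[OF T_shape_arms(2)[OF T] 2]) (use T f in \<open>auto simp: T_shape_def\<close>)
  next
    case 3 show ?thesis
      by (rule arm_rho_degree_label_3[OF T_shape_arms(3)[OF T] 3]) (use T f in \<open>auto simp: T_shape_def\<close>)
  qed
qed

lemma B_affine_rho_degree:
  assumes T: "T_shape x [a] [b] cs" and f: "f {x, a} = 3" "f {x, b} = 3"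
    and fc: "map f (elist (x # cs)) = replicate n 3 @ [4]"
  shows "rho_degree G (f_hat f) x = 4" and "y \<in> verts G \<Longrightarrow> rho_degree G (f_hat f) y \<le> 4"
proof -
  show x: "rho_degree G (f_hat f) x = 4" by (simp add: T_shape_center[OF T] f fc)
  assume "y \<in> verts G"
  then consider "y = x" | "y \<in> set [a]" | "y \<in> set [b]" | "y \<in> set cs" using T by (auto simp: T_shape_def)
  then show "rho_degree G (f_hat f) y \<le> 4"
  proof cases
    case 1 then show ?thesis using x by simp
  next
    case 2 then show ?thesis using arm_rho_degree_label_3[OF T_shape_arms(1)[OF T] 2] f by simp
  next
    case 3 then show ?thesis using arm_rho_degree_label_3[OF T_shape_arms(2)[OF T] 3] f by simp
  next
    case 4
    obtain pre m post where m: "map f (elist (x # cs)) = pre @ m # post"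
      "rho_degree G (f_hat f) y \<le> 2 * weight m + side post"
      using arm_rho_degree[OF T_shape_arms(3)[OF T] 4] by blast
    have e: "replicate n 3 @ [4] = pre @ m # post" using m(1) fc by simp
    \<comment> \<open>The last vertex only sees its edge of label 4, estimated by 2 times 2. Any
      earlier vertex gets at most 2 from the inner edge of label 3 and exactly 2 from the arm
      outside, which ends with the label 4.\<close>
    show ?thesis
    proof (cases post rule: rev_cases)
      case Nil
      then have "m = 4" using e by simp
      then show ?thesis using m Nil by simp
    next
      case (snoc post' l)
      then have l: "l = 4" "replicate n 3 = pre @ m # post'"
        using e append_eq_append_conv2 by (simp_all flip: append_assoc append_Cons)
      then have "set (pre @ m # post') \<subseteq> {3}" by (metis set_replicate_conv_if empty_subsetI order_refl)
      then have "m = 3" "\<forall>l\<in>set post'. l = 3" by auto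
      then have "post' = replicate (length post') 3" by (simp add: replicate_length_same)
      then have "side post = 2" using snoc l(1) side_replicate_4 by metis
      then show ?thesis using m \<open>m = 3\<close> by simp
    qed
  qed
qed

section \<open>Cycles\<close>

lemma degree_2_contrib:
  assumes "\<And>v. v \<in> verts G \<Longrightarrow> degree G v = 2" "e \<in> incident G x"
  shows "contrib x e = 2 * weight (f e)"
proof -
  obtain y where y: "e = {x, y}" using edge_at[of e x] assms(2) by (auto simp: incident_def)
  \<comment> \<open>An arm ends in a vertex of degree 1, so a graph in which all degrees are 2 has
    no arms and hence no simple pairs.\<close>
  have "hd ys \<noteq> y" if "arm G x ys" for ys
  proof -
    have "last ys \<in> verts G" using arm_verts[OF that] that by (auto simp: arm_def)
    then show ?thesis using arm_degree_last[OF that] assms(1) by auto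
  qed
  then show ?thesis unfolding y by (rule contrib_no_arm)
qed

lemma cycle_degree:
  assumes vs: "cycle_shape vs" and v: "v \<in> verts G"
  shows "degree G v = 2"
proof -
  obtain as bs where s: "vs = as @ v # bs" using vs v split_list[of v vs] by (auto simp: cycle_shape_def)
  have d: "distinct (as @ v # bs)" and l: "3 \<le> length (as @ v # bs)"
    and eG: "edges G = insert {hd vs, last vs} (set (elist (as @ v # bs)))"
    using vs s by (auto simp: cycle_shape_def)
  have inc: "e \<in> incident G v \<longleftrightarrow> (as \<noteq> [] \<and> e = {last as, v}) \<or> (bs \<noteq> [] \<and> e = {v, hd bs}) \<or>
      (e = {hd vs, last vs} \<and> v \<in> {hd vs, last vs})" for e
    using elist_incident[OF d, of e] by (auto simp: incident_def eG)
  have two: "card {{v, p}, {v, q}} = 2" if "p \<noteq> q" for p q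
    using that by (auto simp: card_insert_if doubleton_eq_iff)
  \<comment> \<open>At an end of the list one neighbour comes from the closing edge; having at least
    three vertices keeps the two neighbours distinct.\<close>
  consider "as = []" | "bs = []" | "as \<noteq> []" "bs \<noteq> []" by blast
  then show ?thesis
  proof cases
    case 1
    then have bs: "bs \<noteq> []" "tl bs \<noteq> []" using l by (cases bs; cases "tl bs"; auto)+
    then have "hd bs \<noteq> last bs" using d by (cases bs) auto
    moreover have "incident G v = {{v, hd bs}, {v, last bs}}" using 1 bs s by (auto simp: inc)
    ultimately show ?thesis by (simp add: degree_def two)
  next
    case 2
    then have as: "as \<noteq> []" "tl as \<noteq> []" using l by (cases as; cases "tl as"; auto)+
    then have "hd as \<noteq> last as" using d by (cases as) auto
    moreover have "incident G v = {{v, hd as}, {v, last as}}"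
      using 2 as s by (auto simp: inc insert_commute)
    ultimately show ?thesis by (simp add: degree_def two)
  next
    case 3
    then have "hd vs \<in> set as" "last vs \<in> set bs" by (simp_all add: s)
    then have "v \<notin> {hd vs, last vs}" using d by auto
    then have "incident G v = {{v, last as}, {v, hd bs}}" using 3 by (auto simp: inc insert_commute)
    moreover have "last as \<noteq> hd bs"
    proof -
      have "last as \<in> set as" "hd bs \<notin> set as" using 3 d by auto
      then show ?thesis by metis
    qed
    ultimately show ?thesis by (simp add: degree_def two)
  qed
qed

lemma degree_2_rho_degree:
  assumes "\<And>e. e \<in> incident G x \<Longrightarrow> f e = 3" "degree G x = 2"
  shows "rho_degree G (f_hat f) x \<le> 4"
proof -
  have "rho_degree G (f_hat f) x \<le> (\<Sum>e\<in>incident G x. 2)"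
    unfolding rho_degree_eq
  proof (rule sum_mono)
    fix e assume "e \<in> incident G x"
    then show "contrib x e \<le> 2" using contrib_le[of e x] assms(1)[of e] by (simp add: incident_def)
  qed
  then show ?thesis using assms(2) by (simp add: degree_def)
qed

lemma cycle_rho_degree:
  assumes vs: "cycle_shape vs" and f: "f ` edges G \<subseteq> {3}" and v: "v \<in> verts G"
  shows "rho_degree G (f_hat f) v = 4"
proof -
  have "rho_degree G (f_hat f) v = (\<Sum>e\<in>incident G v. 2)"
    unfolding rho_degree_eq
  proof (rule sum.cong)
    fix e assume e: "e \<in> incident G v"
    then have "f e = 3" using f by (auto simp: incident_def)
    then show "contrib v e = 2" using degree_2_contrib[OF cycle_degree[OF vs] e] by simp
  qed simp
  then show ?thesis using cycle_degree[OF vs v] by (simp add: degree_def)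
qed

section \<open>Affine type D\<close>

lemma D_shape_rev:
  assumes "D_shape a b ys c d" shows "D_shape c d (rev ys) a b"
proof -
  have D: "distinct ([a, b] @ ys @ [c, d])" "ys \<noteq> []" "verts G = set ([a, b] @ ys @ [c, d])"
    "edges G = set (elist ys) \<union> {{a, hd ys}, {b, hd ys}, {last ys, c}, {last ys, d}}"
    using assms by (simp_all add: D_shape_def)
  have "distinct ([c, d] @ rev ys @ [a, b])" using D(1) by auto
  moreover have "verts G = set ([c, d] @ rev ys @ [a, b])" unfolding D(3) by auto
  moreover have "edges G = set (elist (rev ys)) \<union>
      {{c, hd (rev ys)}, {d, hd (rev ys)}, {last (rev ys), a}, {last (rev ys), b}}"
    by (simp add: D(4) elist_rev hd_rev last_rev insert_commute)
  ultimately show ?thesis using D(2) by (simp add: D_shape_def)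
qed

lemma D_shape_leaf:
  assumes D: "D_shape a b ys c d"
  shows "arm G (hd ys) [a]" "arm G (hd ys) [b]" "arm G (last ys) [c]" "arm G (last ys) [d]"
proof -
  have "hd ys \<in> set ys" "last ys \<in> set ys" using D by (auto simp: D_shape_def)
  then show "arm G (hd ys) [a]" "arm G (hd ys) [b]" "arm G (last ys) [c]" "arm G (last ys) [d]"
    using D by (auto simp: D_shape_def arm_def insert_commute dest!: elist_subset)
qed

text \<open>Each leaf contributes 1. If the spine is longer than one vertex, its first edge
  contributes 2: an arm along it would contain the other end of the spine, whose degree is at least
  3. By \<open>D_shape_rev\<close> this also settles the last spine vertex.\<close>

lemma D_shape_hd:
  assumes D: "D_shape a b ys c d" and f: "f ` edges G \<subseteq> {3}"
  shows "rho_degree G (f_hat f) (hd ys) = 4"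
proof -
  obtain y zs where ys: "ys = y # zs" using D by (cases ys) (auto simp: D_shape_def)
  have leaf: "contrib y {y, u} = 1" if "arm G y [u]" for u
    using arm_contrib[OF that] arm_hd_edge[OF that] f by auto
  note arms = D_shape_leaf[OF D, unfolded ys]
  have d: "distinct ([a, b] @ (y # zs) @ [c, d])"
    and eG: "edges G = set (elist (y # zs)) \<union> {{y, a}, {y, b}, {last (y # zs), c}, {last (y # zs), d}}"
    using D by (auto simp: D_shape_def ys insert_commute)
  show ?thesis
  proof (cases "zs = []")
    case True
    have "incident G y = {{y, a}, {y, b}, {y, c}, {y, d}}"
      using True by (auto simp: incident_def eG)
    moreover have "contrib y {y, a} = 1" "contrib y {y, b} = 1" "contrib y {y, c} = 1" "contrib y {y, d} = 1"
      using arms leaf True by auto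
    moreover have "distinct [{y, a}, {y, b}, {y, c}, {y, d}]" using d by (auto simp: doubleton_eq_iff)
    ultimately show ?thesis by (simp add: rho_degree_eq ys)
  next
    case False
    obtain ws z where wz: "y # zs = ws @ [z]" by (metis list.distinct(1) rev_exhaust)
    then have ws: "ws \<noteq> []" and z: "z \<in> set zs" and lz: "last (y # zs) = z"
      using False by (auto simp: Cons_eq_append_conv)
    let ?p = "last ws"
    have "{?p, z} \<in> set (elist (y # zs))" using ws by (simp add: wz elist_snoc)
    then have incz: "{{?p, z}, {z, c}, {z, d}} \<subseteq> incident G z" unfolding incident_def eG lz by blast
    have "?p \<in> set ws" "c \<notin> set ws" "d \<notin> set ws" "c \<noteq> d"
      using ws d unfolding wz by auto
    then have "{?p, z} \<noteq> {z, c}" "{?p, z} \<noteq> {z, d}" "{z, c} \<noteq> {z, d}"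
      by (metis doubleton_eq_iff)+
    then have "card {{?p, z}, {z, c}, {z, d}} = 3" by simp
    then have deg: "3 \<le> degree G z"
      using card_mono[OF finite_incident incz] by (simp add: degree_def)
    have "contrib y {y, hd zs} = 2 * weight (f {y, hd zs})"
    proof (rule contrib_no_arm)
      fix as assume as: "arm G y as"
      show "hd as \<noteq> hd zs"
      proof
        assume "hd as = hd zs"
        then have "hd zs \<in> set as" using as hd_in_set[of as] by (simp add: arm_def)
        then have "set zs \<subseteq> set as"
          using arm_propagate[OF as] eG d False by (auto simp: elist_Cons)
        then show False using arm_degree_le_2[OF as, of z] deg z by auto
      qed
    qed
    moreover have "f {y, hd zs} = 3" using f eG False by (auto simp: elist_Cons)
    ultimately have "contrib y {y, hd zs} = 2" by simp
    moreover have "contrib y {y, a} = 1" "contrib y {y, b} = 1" using arms leaf by auto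
    moreover have "distinct [{y, a}, {y, b}, {y, hd zs}]"
    proof -
      have "a \<noteq> b" "a \<noteq> hd zs" "b \<noteq> hd zs" using d hd_in_set[OF False] by auto
      then show ?thesis by (simp add: doubleton_eq_iff)
    qed
    moreover have "incident G y = {{y, a}, {y, b}, {y, hd zs}}"
    proof -
      have "{e \<in> set (elist (y # zs)). y \<in> e} = {{y, hd zs}}"
        using d elist_incident[of "[]" y zs] False by auto
      moreover have "y \<notin> {z, c}" "y \<notin> {z, d}" using d z by auto
      ultimately show ?thesis unfolding incident_def eG lz by blast
    qed
    ultimately show ?thesis by (simp add: rho_degree_eq ys)
  qed
qed

lemma D_shape_rho_degree:
  assumes D: "D_shape a b ys c d" and f: "f ` edges G \<subseteq> {3}" and v: "v \<in> verts G"
  shows "rho_degree G (f_hat f) v \<le> 4"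
proof -
  note arms = D_shape_leaf[OF D]
  have leaf: "rho_degree G (f_hat f) u \<le> 4" if "arm G x [u]" for x u
    using arm_rho_degree_label_3[OF that] arm_hd_edge[OF that] f by fastforce
  consider "v \<in> {a, b, c, d}" | "v = hd ys" | "v = last ys" | "v \<in> set ys" "v \<noteq> hd ys" "v \<noteq> last ys"
    using v D by (auto simp: D_shape_def)
  then show ?thesis
  proof cases
    case 1 then show ?thesis using leaf arms by auto
  next
    case 2 then show ?thesis using D_shape_hd[OF D f] by simp
  next
    case 3 then show ?thesis using D_shape_hd[OF D_shape_rev[OF D] f] D by (simp add: hd_rev D_shape_def)
  next
    case 4
    then obtain as bs where s: "ys = as @ v # bs" using split_list by fast
    then have ne: "as \<noteq> []" "bs \<noteq> []" using 4 by auto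
    have d: "distinct (as @ v # bs)" using D s by (auto simp: D_shape_def)
    have "incident G v = {{last as, v}, {v, hd bs}}"
    proof -
      have "v \<notin> {a, b, c, d}" using 4(1) D by (auto simp: D_shape_def)
      then have "incident G v = {e \<in> set (elist (as @ v # bs)). v \<in> e}"
        using 4 D by (auto simp: incident_def D_shape_def s)
      then show ?thesis using elist_incident[OF d] ne by auto
    qed
    moreover have "last as \<noteq> hd bs"
    proof -
      have "last as \<in> set as" "hd bs \<notin> set as" using ne d by auto
      then show ?thesis by metis
    qed
    ultimately have "degree G v = 2" by (auto simp: degree_def card_insert_if doubleton_eq_iff)
    moreover have "f e = 3" if "e \<in> incident G v" for e using that f by (auto simp: incident_def)
    ultimately show ?thesis by (simp add: degree_2_rho_degree)
  qed
qed

end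

section \<open>Splittings of the label lists of types A, B and C\<close>

lemma replicate_eq_append:
  assumes "replicate n x = as @ bs"
  shows "as = replicate (length as) x" "bs = replicate (length bs) x"
proof -
  have "set (as @ bs) \<subseteq> {x}" unfolding assms[symmetric] by auto
  then have "\<forall>y\<in>set as. y = x" "\<forall>y\<in>set bs. y = x" by auto
  then show "as = replicate (length as) x" "bs = replicate (length bs) x"
    by (simp_all add: replicate_length_same)
qed

lemma side_snoc_4:
  assumes "replicate n 3 = as @ bs"
  shows "side (rev as @ [4]) = 2" "side (bs @ [4]) = 2"
proof -
  have "side (rev as @ [4]) = side (replicate (length as) 3 @ [4])"
    using replicate_eq_append(1)[OF assms] by (metis rev_replicate)
  moreover have "side (bs @ [4]) = side (replicate (length bs) 3 @ [4])"
    using replicate_eq_append(2)[OF assms] by metis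
  ultimately show "side (rev as @ [4]) = 2" "side (bs @ [4]) = 2" by simp_all
qed

lemma side_A:
  assumes "replicate n 3 = ms1 @ ms2"
  shows "side (rev ms1) + side ms2 < 4"
proof -
  have "side (rev ms1) = rho (length ms1)" "side ms2 = rho (length ms2)"
    using replicate_eq_append[OF assms] by (metis rev_replicate side_replicate)+
  then show ?thesis using rho_less_2[of "length ms1"] rho_less_2[of "length ms2"] by simp
qed

text \<open>At the end carrying the label 4 the sum is twice a value of rho. At every other vertex
  the direction towards the 4 gives exactly 2, and the other direction gives less than 2.\<close>

lemma side_B:
  assumes "4 # replicate n 3 = ms1 @ ms2"
  shows "side (rev ms1) + side ms2 < 4"
proof (cases ms1)
  case Nil
  then have "ms2 = 4 # replicate n 3" using assms by simp
  then have "side ms2 = 2 * rho (Suc n)" by (simp add: set_replicate_conv_if)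
  then show ?thesis using Nil rho_less_2[of "Suc n"] by simp
next
  case (Cons m ms)
  then have m: "m = 4" "replicate n 3 = ms @ ms2" using assms by simp_all
  have "side ms2 = rho (length ms2)"
    using replicate_eq_append(2)[OF m(2)] by (metis side_replicate)
  then show ?thesis using Cons m(1) side_snoc_4(1)[OF m(2)] rho_less_2[of "length ms2"] by simp
qed

text \<open>Every vertex reaches the value 4: an inner one as 2 + 2, and an end as 2 times 2,
  because its only edge has weight 2 and is not simple.\<close>

lemma side_C:
  assumes "4 # replicate n 3 @ [4] = ms1 @ ms2"
  shows "side (rev ms1) + side ms2 \<le> 4"
proof (cases ms1)
  case Nil
  then have "ms2 = 4 # replicate n 3 @ [4]" using assms by simp
  then show ?thesis using Nil by simp
next
  case (Cons m ms)
  then have m: "m = 4" "replicate n 3 @ [4] = ms @ ms2" using assms by simp_all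
  show ?thesis
  proof (cases ms2 rule: rev_cases)
    case Nil
    then have "ms = replicate n 3 @ [4]" using m(2) by simp
    then have "rev ms1 = 4 # replicate n 3 @ [4]" using m(1) Cons by simp
    then show ?thesis using Nil by simp
  next
    case (snoc ms' l)
    then have l: "l = 4" "replicate n 3 = ms @ ms'" using m(2) by (simp_all flip: append_assoc)
    show ?thesis using side_snoc_4[OF l(2)] Cons m(1) snoc l(1) by simp
  qed
qed

lemma rho_numeral: "rho (numeral k) = 2 - 2 / (numeral k + 1)"
  by (simp add: rho_eq)

section \<open>The listed graphs satisfy the degree conditions\<close>

context coxeter
begin

lemma path_rho_degree_less:
  assumes "path_shape vs" "map f (elist vs) = ms"
    and "\<And>ms1 ms2. ms = ms1 @ ms2 \<Longrightarrow> side (rev ms1) + side ms2 < 4"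
  shows "\<forall>v\<in>verts G. rho_degree G (f_hat f) v < 4"
proof
  fix v assume "v \<in> verts G"
  then obtain ms1 ms2 where "map f (elist vs) = ms1 @ ms2"
    "rho_degree G (f_hat f) v = side (rev ms1) + side ms2"
    by (rule path_rho_degree_split[OF assms(1)])
  then show "rho_degree G (f_hat f) v < 4" using assms(2,3) by simp
qed

lemma path_rho_degree_le:
  assumes "path_shape vs" "map f (elist vs) = ms"
    and "\<And>ms1 ms2. ms = ms1 @ ms2 \<Longrightarrow> side (rev ms1) + side ms2 \<le> 4"
    and "ms = ms1 @ ms2" "side (rev ms1) + side ms2 = 4"
  shows "(\<forall>v\<in>verts G. rho_degree G (f_hat f) v \<le> 4) \<and> (\<exists>v\<in>verts G. rho_degree G (f_hat f) v = 4)"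
proof
  show "\<forall>v\<in>verts G. rho_degree G (f_hat f) v \<le> 4"
  proof
    fix v assume "v \<in> verts G"
    then obtain ks1 ks2 where "map f (elist vs) = ks1 @ ks2"
      "rho_degree G (f_hat f) v = side (rev ks1) + side ks2"
      by (rule path_rho_degree_split[OF assms(1)])
    then show "rho_degree G (f_hat f) v \<le> 4" using assms(2,3) by simp
  qed
  show "\<exists>v\<in>verts G. rho_degree G (f_hat f) v = 4"
    using path_ex_rho_degree[OF assms(1), of ms1 ms2] assms(2,4,5) by simp
qed

lemma list_III_rho_degree:
  assumes "belongs_to (G, f) list_III"
  shows "\<forall>v\<in>verts G. rho_degree G (f_hat f) v < 4"
proof -
  obtain Y where Y: "Y \<in> list_III" "labelled_iso (G, f) Y" using assms by (auto simp: belongs_to_def)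
  have path: ?thesis if p: "Y = lpath ms"
    and s: "\<And>ms1 ms2. ms = ms1 @ ms2 \<Longrightarrow> side (rev ms1) + side ms2 < 4" for ms
  proof -
    obtain vs where "path_shape vs" "map f (elist vs) = ms" using Y(2) p labelled_iso_lpath by auto
    then show ?thesis using s by (rule path_rho_degree_less)
  qed
  have T: ?thesis if p: "Y = (T_graph p q r, \<lambda>_. 3)" "1 \<le> p" "1 \<le> q" "1 \<le> r"
    and s: "rho p + rho q + rho r < 4" for p q r
  proof -
    obtain x as bs cs where T: "T_shape x as bs cs" "f ` edges G \<subseteq> {3}"
      and len: "length as = p" "length bs = q" "length cs = r"
      using Y(2) labelled_iso_T[OF p(2-4)] by (auto simp: p(1))
    have "rho_degree G (f_hat f) x < 4" using s by (simp add: T_shape_label_3(1)[OF T] len)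
    then show ?thesis using T_shape_label_3(2)[OF T] by blast
  qed
  from Y(1) show ?thesis
  proof cases
    case (A l) then show ?thesis using side_A by (intro path)
  next
    case (B l) then show ?thesis using side_B by (intro path)
  next
    \<comment> \<open>Two arms of length 1 contribute 2 in total, which leaves room for a third arm
      of any length.\<close>
    case (D l) then show ?thesis using rho_less_2[of "l - 3"] by (intro T) auto
  next
    case F4 then show ?thesis
      by (rule path) (auto simp: Cons_eq_append_conv rho_def)
  next
    case G2 then show ?thesis by (rule path) (auto simp: Cons_eq_append_conv)
  next
    case H3 then show ?thesis
      by (rule path) (use weight_5_bounds in \<open>auto simp: Cons_eq_append_conv rho_def\<close>)
  next
    case H4 then show ?thesis
      by (rule path) (use weight_5_bounds in \<open>auto simp: Cons_eq_append_conv rho_def\<close>)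
  next
    case (I2 p)
    then have "3 \<le> p" by auto
    then have "weight (enat p) < weight \<infinity>" by (intro weight_strict_mono) (auto simp: numeral_eq_enat)
    then show ?thesis using I2 by (intro path) (auto simp: Cons_eq_append_conv)
  next
    case E6 then show ?thesis by (rule T) (simp_all add: rho_numeral)
  next
    case E7 then show ?thesis by (rule T) (simp_all add: rho_numeral)
  next
    case E8 then show ?thesis by (rule T) (simp_all add: rho_numeral)
  qed
qed

lemma list_IV_rho_degree:
  assumes "belongs_to (G, f) list_IV"
  shows "(\<forall>v\<in>verts G. rho_degree G (f_hat f) v \<le> 4) \<and> (\<exists>v\<in>verts G. rho_degree G (f_hat f) v = 4)"
proof -
  obtain Y where Y: "Y \<in> list_IV" "labelled_iso (G, f) Y" using assms by (auto simp: belongs_to_def)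
  have path: ?thesis if p: "Y = lpath ms"
    and s: "\<And>ms1 ms2. ms = ms1 @ ms2 \<Longrightarrow> side (rev ms1) + side ms2 \<le> 4"
    and e: "ms = ks @ ls" "side (rev ks) + side ls = 4" for ms ks ls
  proof -
    obtain vs where "path_shape vs" "map f (elist vs) = ms" using Y(2) p labelled_iso_lpath by auto
    then show ?thesis using s e by (rule path_rho_degree_le)
  qed
  have T: ?thesis if p: "Y = (T_graph p q r, \<lambda>_. 3)" "1 \<le> p" "1 \<le> q" "1 \<le> r"
    and s: "rho p + rho q + rho r = 4" for p q r
  proof -
    obtain x as bs cs where T: "T_shape x as bs cs" "f ` edges G \<subseteq> {3}"
      and len: "length as = p" "length bs = q" "length cs = r"
      using Y(2) labelled_iso_T[OF p(2-4)] by (auto simp: p(1))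
    have "rho_degree G (f_hat f) x = 4" using s by (simp add: T_shape_label_3(1)[OF T] len)
    moreover have "x \<in> verts G" using T by (simp add: T_shape_def)
    moreover have "rho_degree G (f_hat f) v \<le> 4" if "v \<in> verts G" "v \<noteq> x" for v
      using T_shape_label_3(2)[OF T that] by simp
    ultimately show ?thesis by (metis order_refl)
  qed
  from Y(1) show ?thesis
  proof cases
    case A1 then show ?thesis by (rule path[where ks = "[]" and ls = "[\<infinity>]"]) (auto simp: Cons_eq_append_conv)
  next
    case (A l)
    then have l3: "3 \<le> l + 1" by simp
    then obtain vs where vs: "cycle_shape vs" "f ` edges G \<subseteq> {3}"
      using Y(2) unfolding A(1) labelled_iso_cycle[OF l3] by blast
    show ?thesis using cycle_rho_degree[OF vs] verts_nonempty by auto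
  next
    case B2 then show ?thesis by (rule path[where ks = "[]" and ls = "[4, 4]"]) (auto simp: Cons_eq_append_conv)
  next
    case (B l)
    obtain x a b cs where T: "T_shape x [a] [b] cs" "f {x, a} = 3" "f {x, b} = 3"
      "map f (elist (x # cs)) = replicate (l - 3) 3 @ [4]"
      using labelled_iso_B_affine[OF B(2)] B(1) Y(2) by auto
    have "x \<in> verts G" using T by (simp add: T_shape_def)
    then show ?thesis using B_affine_rho_degree[OF T] by blast
  next
    case (C l) show ?thesis
      by (rule path[OF C(1), where ks = "[]" and ls = "4 # replicate (l - 2) 3 @ [4]"])
        (use side_C in auto)
  next
    case (D l)
    obtain a b ys c d where D: "D_shape a b ys c d" "f ` edges G \<subseteq> {3}"
      using labelled_iso_D_affine[OF D(2)] D(1) Y(2) by auto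
    have "hd ys \<in> verts G" using D by (simp add: D_shape_def)
    then show ?thesis using D_shape_hd[OF D] D_shape_rho_degree[OF D] by blast
  next
    \<comment> \<open>The value 4 is attained at the end of the 4-edge facing the two labels 3, as
      4/3 + 2 times 4/3. For affine G_2 it is 1 + 3 at the middle vertex.\<close>
    case F4 then show ?thesis
      by (rule path[where ks = "[3, 3]" and ls = "[4, 3]"]) (auto simp: Cons_eq_append_conv rho_def)
  next
    case G2 then show ?thesis
      by (rule path[where ks = "[3]" and ls = "[6]"]) (auto simp: Cons_eq_append_conv rho_def)
  next
    \<comment> \<open>The three cases of reciprocals with sum 1: 1/3 + 1/3 + 1/3, 1/2 + 1/4 + 1/4
      and 1/2 + 1/3 + 1/6.\<close>
    case E6 then show ?thesis by (rule T) (simp_all add: rho_numeral)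
  next
    case E7 then show ?thesis by (rule T) (simp_all add: rho_numeral)
  next
    case E8 then show ?thesis by (rule T) (simp_all add: rho_numeral)
  qed
qed

end

section \<open>Label lists of paths whose rho-degrees are at most 4\<close>

lemma side_ge:
  assumes "\<forall>m\<in>set ms. 3 \<le> m" "ms \<noteq> []"
  shows "1 \<le> side ms" and "\<not> set ms \<subseteq> {3} \<Longrightarrow> 2 \<le> side ms"
proof -
  obtain m ns where ms: "ms = m # ns" using assms(2) by (cases ms) auto
  have m: "1 \<le> weight m" using assms(1) ms weight_ge_1 by simp
  have r: "1 \<le> rho (Suc (length ns))" by (simp add: rho_ge_1)
  have p: "weight m * 1 \<le> weight m * rho (Suc (length ns))" using m r by (intro mult_left_mono) auto
  have "1 \<le> weight m * rho (Suc (length ns))" using m p by linarith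
  then show "1 \<le> side ms" using m by (auto simp: ms)
  assume "\<not> set ms \<subseteq> {3}"
  then consider "m \<noteq> 3" | "\<not> set ns \<subseteq> {3}" using ms by auto
  then show "2 \<le> side ms"
  proof cases
    case 1
    then have "2 \<le> weight m" using assms(1) ms weight_ge_2 by simp
    moreover from this have "2 \<le> weight m * rho (Suc (length ns))" using p by linarith
    ultimately show ?thesis by (auto simp: ms)
  next
    case 2 then show ?thesis using m by (auto simp: ms)
  qed
qed

text \<open>The weight is already at least 2 and the other factor at least 1, so both are minimal:
  weight 2 means label 4, and factor 1 means a branch with one vertex.\<close>

lemma side_le_2:
  assumes "3 \<le> m" "m \<noteq> 3" "side (m # ms) \<le> 2"
  shows "m = 4 \<and> ms = []"
proof -
  have w: "2 \<le> weight m" using assms weight_ge_2 by simp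
  let ?r = "if set ms \<subseteq> {3} then rho (Suc (length ms)) else 2"
  have r: "1 \<le> ?r" by (simp add: rho_ge_1)
  have s: "weight m * ?r \<le> 2" using assms(3) by simp
  have "weight m * 1 \<le> weight m * ?r" using w r by (intro mult_left_mono) auto
  then have "weight m = 2" using s w by linarith
  then have "?r \<le> 1" using s by simp
  then have "ms = []" using rho_le_1_iff[of "Suc (length ms)"] by (auto split: if_splits)
  moreover have "m = 4" using weight_le_2[OF assms(1)] assms(2) \<open>weight m = 2\<close> by simp
  ultimately show ?thesis by simp
qed

definition listed :: "nat labelled \<Rightarrow> bool" where
  "listed Y \<longleftrightarrow> Y \<in> list_III \<union> list_IV"

text \<open>The hypothesis is the condition at one endpoint of the edge of weight w; the conclusion
  results from multiplying by (a+1)(b+2). As the conclusion is symmetric in a and b, the other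
  endpoint would give the same inequality.\<close>

lemma weight_ineq:
  assumes "rho a + w * rho (Suc b) \<le> 4"
  shows "w * (real a + 1) * (real b + 1) \<le> (real a + 2) * (real b + 2)"
proof -
  have "rho a = 2 * real a / (real a + 1)" "rho (Suc b) = 2 * (real b + 1) / (real b + 2)"
    by (simp_all add: rho_eq field_simps)
  with assms have "2 * real a / (real a + 1) + w * (2 * (real b + 1) / (real b + 2)) \<le> 4" by simp
  then have "(2 * real a / (real a + 1) + w * (2 * (real b + 1) / (real b + 2))) * ((real a + 1) * (real b + 2))
      \<le> 4 * ((real a + 1) * (real b + 2))"
    by (intro mult_right_mono) auto
  moreover have "(2 * real a / (real a + 1) + w * (2 * (real b + 1) / (real b + 2))) * ((real a + 1) * (real b + 2))
     = 2 * real a * (real b + 2) + 2 * w * (real b + 1) * (real a + 1)"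
  proof -
    have "real a + 1 \<noteq> 0" "real b + 2 \<noteq> 0" by linarith+
    then show ?thesis by (simp add: divide_simps)
  qed
  ultimately show ?thesis by (simp add: algebra_simps)
qed

lemma path_labels_single:
  assumes ab: "a \<le> b" and m: "3 \<le> m" "m \<noteq> 3"
    and ineq: "weight m * (real a + 1) * (real b + 1) \<le> (real a + 2) * (real b + 2)"
  shows "listed (lpath (replicate a 3 @ m # replicate b 3)) \<or>
    listed (lpath (replicate b 3 @ m # replicate a 3))"
proof -
  have bound: "c * (real a + 1) * (real b + 1) \<le> (real a + 2) * (real b + 2)" if "c \<le> weight m" for c
  proof -
    have "c * (real a + 1) * (real b + 1) \<le> weight m * (real a + 1) * (real b + 1)"
      using that by (intro mult_right_mono) auto
    then show ?thesis using ineq by linarith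
  qed
  \<comment> \<open>For weight 2 the inequality reads a b <= 2, which is impossible if both numbers
    are at least 2. The substitutions for a and b turn this into a sum of nonnegative terms.\<close>
  have a1: "a \<le> 1"
  proof (rule ccontr)
    assume "\<not> ?thesis"
    then obtain i where i: "a = i + 2" by (metis Suc_1 Suc_leI add.commute le_Suc_ex not_less)
    then obtain j where j: "b = i + j + 2" using ab le_Suc_ex by (metis add.commute add.left_commute)
    have "2 + (real i * real i + (real i * real j + (real j * 2 + real i * 4))) \<le> 0"
      using bound[OF weight_ge_2[OF m]] by (simp add: i j algebra_simps)
    moreover have "0 \<le> real i * real i + (real i * real j + (real j * 2 + real i * 4))" by simp
    ultimately show False by linarith
  qed
  \<comment> \<open>With a = 1 and weight at least 5/2 the inequality would give 5(b+1) <= 3(b+2),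
    contradicting b >= 1.\<close>
  have a0: "a = 0" if "5/2 \<le> weight m"
  proof (rule ccontr)
    assume "a \<noteq> 0"
    then have "a = 1" using a1 by simp
    then show False using bound[OF that] ab by simp
  qed
  have III: "listed Y" if "Y \<in> list_III" for Y using that by (simp add: listed_def)
  have IV: "listed Y" if "Y \<in> list_IV" for Y using that by (simp add: listed_def)
  show ?thesis
  proof (rule weight_cases[OF m(1)])
    assume "m = 3" then show ?thesis using m(2) by simp
  next
    assume m4: "m = 4"
    show ?thesis
    proof (cases "a = 0")
      case True
      then show ?thesis using III[OF list_III.B[of "b + 2"]] m4 by simp
    next
      case False
      then have a: "a = 1" using a1 by simp
      then have "real b \<le> 2" using bound[of 2] m4 by simp
      then have "b = 1 \<or> b = 2" using ab a by auto
      then show ?thesis using III[OF list_III.F4] IV[OF list_IV.F4] m4 a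
        by (auto simp: numeral_2_eq_2)
    qed
  next
    assume m5: "m = 5"
    have a: "a = 0" using a0 weight_5_bounds m5 by simp
    \<comment> \<open>For a = 0 the condition is w(b+1) <= 2(b+2). At b = 3 it would require w <=
      5/2, and larger b only lower the admissible weight.\<close>
    have "b < 3"
    proof (rule ccontr)
      assume "\<not> ?thesis"
      then obtain j where j: "b = j + 3" by (metis add.commute le_Suc_ex not_less)
      have "5/2 * (real b + 1) < weight m * (real b + 1)"
        using weight_5_bounds m5 by (intro mult_strict_right_mono) auto
      then show False using ineq a by (simp add: j)
    qed
    then have "b = 0 \<or> b = 1 \<or> b = 2" by auto
    then show ?thesis using III[OF list_III.I2[of 5]] III[OF list_III.H3] III[OF list_III.H4] m5 a
      by (auto simp: numeral_2_eq_2 numeral_eq_enat)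
  next
    assume m6: "m = 6"
    have a: "a = 0" using a0 m6 by simp
    then have "real b \<le> 1" using bound[of 3] m6 by simp
    then have "b = 0 \<or> b = 1" by auto
    then show ?thesis using III[OF list_III.G2] IV[OF list_IV.G2] m6 a by auto
  next
    fix p assume p: "7 \<le> p" "m = enat p" "3 < weight m"
    have a: "a = 0" using a0 p by simp
    have "b = 0"
    proof (rule ccontr)
      assume "b \<noteq> 0"
      have "3 * (real b + 1) < weight m * (real b + 1)" using p(3) by (intro mult_strict_right_mono) auto
      then show False using ineq a \<open>b \<noteq> 0\<close> by simp
    qed
    then show ?thesis using III[OF list_III.I2[of p]] p a by simp
  next
    assume mi: "m = \<infinity>"
    have a: "a = 0" using a0 mi by simp
    then have "b = 0" using bound[of 4] mi by simp
    then show ?thesis using IV[OF list_IV.A1] mi a by simp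
  qed
qed

text \<open>The lists fix an orientation of each path, so the labels may have to be read backwards.
  The case split is on the number of labels other than 3: none, one, or at least two, where two of
  them force each other to the ends.\<close>

lemma path_labels_listed:
  assumes m3: "\<forall>m\<in>set ms. 3 \<le> m"
    and le: "\<And>ms1 ms2. ms = ms1 @ ms2 \<Longrightarrow> side (rev ms1) + side ms2 \<le> 4"
  shows "listed (lpath ms) \<or> listed (lpath (rev ms))"
proof (cases "set ms \<subseteq> {3}")
  case True
  then have "\<forall>m\<in>set ms. m = 3" by auto
  then have "ms = replicate (length ms) 3" by (simp add: replicate_length_same)
  then have "lpath ms \<in> list_III" using list_III.A[of "Suc (length ms)"] by simp
  then show ?thesis by (simp add: listed_def)
next
  case False
  then have "\<exists>m\<in>set ms. m \<noteq> 3" by auto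
  then obtain as m rest where ms: "ms = as @ m # rest" and m: "m \<noteq> 3" and as: "\<forall>l\<in>set as. l = 3"
    using split_list_first_prop[of ms "\<lambda>m. m \<noteq> 3"] by auto
  have as': "as = replicate (length as) 3" using replicate_length_same[OF as] by simp
  have mge: "3 \<le> m" using m3 ms by simp
  show ?thesis
  proof (cases "set rest \<subseteq> {3}")
    case True
    then have "\<forall>m\<in>set rest. m = 3" by auto
    then have rest: "rest = replicate (length rest) 3" by (simp add: replicate_length_same)
    define a b where "a = length as" and "b = length rest"
    have e: "ms = replicate a 3 @ m # replicate b 3" using ms as' rest by (simp add: a_def b_def)
    have "rho a + weight m * rho (Suc b) \<le> 4"
      using le[OF e] by (cases "b = 0") (simp_all add: set_replicate_conv_if)
    then have i: "weight m * (real a + 1) * (real b + 1) \<le> (real a + 2) * (real b + 2)"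
      by (rule weight_ineq)
    have r: "rev ms = replicate b 3 @ m # replicate a 3" by (simp add: e)
    show ?thesis
    proof (cases "a \<le> b")
      case True
      then show ?thesis using path_labels_single[OF _ mge m i] unfolding r unfolding e by blast
    next
      case False
      moreover have "weight m * (real b + 1) * (real a + 1) \<le> (real b + 2) * (real a + 2)"
        using i by (simp add: mult_ac)
      ultimately show ?thesis using path_labels_single[of b a m] mge m unfolding r unfolding e by auto
    qed
  next
    case False
    then have "\<exists>m\<in>set rest. m \<noteq> 3" by auto
    then obtain cs m' bs where rest: "rest = cs @ m' # bs" and m': "m' \<noteq> 3" and cs: "\<forall>l\<in>set cs. l = 3"
      using split_list_first_prop[of rest "\<lambda>m. m \<noteq> 3"] by auto
    \<comment> \<open>Split just after \<open>m\<close>: the other special label takes at least 2 of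
      the 4, so the direction towards \<open>m\<close> has at most 2 and \<open>m\<close> is a 4 on
      an end edge. The same argument from the other side then settles \<open>m'\<close>.\<close>
    have "2 \<le> side rest" using False m3 ms by (intro side_ge) auto
    then have "side (m # rev as) \<le> 2" using le[of "as @ [m]" rest] ms by simp
    then have m4: "m = 4" "as = []" using side_le_2[OF mge m, of "rev as"] by simp_all
    have "2 \<le> side (rev (m # cs))" using m m3 ms rest by (intro side_ge) auto
    then have "side (m' # bs) \<le> 2" using le[of "m # cs" "m' # bs"] ms rest m4 by simp
    moreover have "3 \<le> m'" using m3 ms rest by simp
    ultimately have m'4: "m' = 4" "bs = []" using side_le_2[of m' bs] m' by blast+
    have c: "cs = replicate (length cs) 3" using replicate_length_same[OF cs] by simp
    then have e: "ms = 4 # replicate (length cs) 3 @ [4]" using ms rest m4 m'4 by simp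
    show ?thesis
    proof (cases "cs = []")
      case True
      then show ?thesis using list_IV.B2 e by (simp add: listed_def)
    next
      case False
      then have "3 \<le> length cs + 2" by (cases cs) auto
      from list_IV.C[OF this] show ?thesis by (simp add: listed_def flip: e)
    qed
  qed
qed

section \<open>Classification\<close>

text \<open>The last assumption is the degree condition at an inner arm vertex whose inward edge is
  not simple. It forces the first label of a longer list to be 3; then total 2 requires a later
  label other than 3, and the rest again has value exactly 2, so induction applies.\<close>

lemma labels_B_affine:
  assumes "\<forall>m\<in>set ms. 3 \<le> m" "side ms = 2"
    and "\<And>pre m post. ms = pre @ m # post \<Longrightarrow> post \<noteq> [] \<Longrightarrow> 2 * weight m + side post \<le> 4"
  shows "\<exists>n. ms = replicate n 3 @ [4]"
  using assms
proof (induction ms)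
  case Nil then show ?case by simp
next
  case (Cons m ms)
  have m: "3 \<le> m" using Cons.prems(1) by simp
  show ?case
  proof (cases "ms = []")
    case True
    then have "weight m = 2" using Cons.prems(2) by simp
    then have "m = 4" using weight_le_2[OF m] by auto
    then show ?thesis using True by (intro exI[of _ 0]) simp
  next
    case False
    have le: "2 * weight m + side ms \<le> 4" using Cons.prems(3)[of "[]" m ms] False by simp
    have "1 \<le> side ms" using Cons.prems(1) False by (intro side_ge) auto
    then have m3: "m = 3" using le weight_ge_2[OF m] by force
    then have n3: "\<not> set ms \<subseteq> {3}"
      using Cons.prems(2) rho_less_2[of "Suc (length ms)"] by (auto split: if_splits)
    have "2 \<le> side ms" using Cons.prems(1) False n3 by (intro side_ge) auto
    then have "side ms = 2" using le m3 by simp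
    moreover have "2 * weight k + side post \<le> 4" if "ms = pre @ k # post" "post \<noteq> []" for pre k post
      using Cons.prems(3)[of "m # pre" k post] that by simp
    ultimately obtain n where "ms = replicate n 3 @ [4]" using Cons.IH Cons.prems(1) by auto
    then show ?thesis using m3 by (intro exI[of _ "Suc n"]) simp
  qed
qed

lemma elist_last_edge: "as \<noteq> [] \<Longrightarrow> {last as, v} \<in> set (elist (as @ v # bs))"
  by (subst elist_append) (simp add: elist_snoc)

lemma elist_hd_edge: "bs \<noteq> [] \<Longrightarrow> {v, hd bs} \<in> set (elist (as @ v # bs))"
  by (subst elist_append) (simp add: elist_Cons)

section \<open>Chains, and graphs with all degrees at most 2\<close>

context coxeter
begin

text \<open>By connectedness, a piece of the graph that already contains all edges at its vertices
  is everything. This is how local information is turned into a shape.\<close>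

lemma spanning:
  assumes "y \<in> S" "S \<subseteq> verts G" "E \<subseteq> edges G"
    and inc: "\<And>u. u \<in> S \<Longrightarrow> incident G u \<subseteq> E" and sub: "\<And>e. e \<in> E \<Longrightarrow> e \<subseteq> S"
  shows "verts G = S" "edges G = E"
proof -
  have "e \<subseteq> S" if "e \<in> edges G" "e \<inter> S \<noteq> {}" for e
    using that inc sub by (auto simp: incident_def)
  then have "verts G \<subseteq> S" using verts_subset_closed[of y S] assms(1,2) by blast
  then show v: "verts G = S" using assms(2) by blast
  have "e \<in> E" if e: "e \<in> edges G" for e
  proof -
    have "e \<noteq> {}" using edge_card[OF e] by auto
    then obtain u where "u \<in> e" "u \<in> S" using edge_subset[OF e] v by auto
    then show ?thesis using inc[of u] e by (auto simp: incident_def)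
  qed
  then show "edges G = E" using assms(3) by blast
qed

lemma incident_1:
  assumes "degree G u = 1" "e \<in> incident G u"
  shows "incident G u = {e}"
  using assms by (auto simp: degree_def card_1_singleton_iff)

lemma incident_2:
  assumes "degree G u = 2" "e \<in> incident G u" "e' \<in> incident G u" "e \<noteq> e'"
  shows "incident G u = {e, e'}"
  using assms by (auto simp: degree_def card_2_iff)

lemma arm_incident_subset:
  assumes "arm G x ys" "u \<in> set ys" shows "incident G u \<subseteq> set (elist (x # ys))"
  using assms by (auto simp: arm_def incident_def)

text \<open>Nothing is assumed about the degree of the last vertex.\<close>

definition chain :: "'a \<Rightarrow> 'a list \<Rightarrow> bool" where
  "chain x ys \<longleftrightarrow> ys \<noteq> [] \<and> distinct (x # ys) \<and> set (elist (x # ys)) \<subseteq> edges G \<and>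
     (\<forall>u\<in>set (butlast ys). degree G u = 2)"

lemma chain_edge:
  assumes "chain x (as @ u # bs)"
  shows "{last (x # as), u} \<in> incident G u" "bs \<noteq> [] \<Longrightarrow> {u, hd bs} \<in> incident G u"
proof -
  have "set (elist ((x # as) @ u # bs)) \<subseteq> edges G"
    using assms by (auto simp: chain_def)
  then show "{last (x # as), u} \<in> incident G u" "bs \<noteq> [] \<Longrightarrow> {u, hd bs} \<in> incident G u"
    using elist_last_edge[of "x # as" u bs] elist_hd_edge[of bs u "x # as"]
    by (auto simp: incident_def simp del: append_Cons)
qed

lemma chain_incident:
  assumes c: "chain x (as @ u # bs)" and bs: "bs \<noteq> []"
  shows "degree G u = 2" "incident G u = {{last (x # as), u}, {u, hd bs}}"
    "{last (x # as), u} \<noteq> {u, hd bs}"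
proof -
  show d: "degree G u = 2" using c bs by (auto simp: chain_def butlast_append)
  have "last (x # as) \<in> set (x # as)" "hd bs \<notin> set (x # as)"
    using c bs hd_in_set[of bs] by (auto simp: chain_def)
  then show "{last (x # as), u} \<noteq> {u, hd bs}" by (metis doubleton_eq_iff)
  then show "incident G u = {{last (x # as), u}, {u, hd bs}}"
    using incident_2[OF d] chain_edge[OF c] bs by blast
qed

lemma chain_inner:
  assumes "chain x ys" "u \<in> set ys" "u \<noteq> last ys"
  obtains as bs where "ys = as @ u # bs" "bs \<noteq> []"
proof -
  obtain as bs where ys: "ys = as @ u # bs" using assms(2) split_list by fast
  then have "bs \<noteq> []" using assms(3) by auto
  then show ?thesis using that ys by blast
qed

lemma chain_verts: "chain x ys \<Longrightarrow> set (x # ys) \<subseteq> verts G"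
proof
  fix v assume c: "chain x ys" and v: "v \<in> set (x # ys)"
  show "v \<in> verts G"
  proof (cases "v = x")
    case True
    then have "{v, hd ys} \<in> edges G" using c by (auto simp: chain_def elist_Cons)
    then show ?thesis using edge_subset by blast
  next
    case False
    then obtain as bs where "ys = as @ v # bs" using v split_list[of v ys] by auto
    then have "{last (x # as), v} \<in> incident G v" using c chain_edge(1) by blast
    then show ?thesis using edge_subset by (auto simp: incident_def)
  qed
qed

lemma chain_arm:
  assumes c: "chain x ys" and d: "degree G (last ys) = 1"
  shows "arm G x ys"
proof -
  have e: "e \<in> set (elist (x # ys))" if e: "e \<in> edges G" "u \<in> e" "u \<in> set ys" for e u
  proof (cases "u = last ys")
    case True
    define us where "us = butlast ys"
    have ys: "ys = us @ [u]" using c True by (simp add: chain_def us_def)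
    then have "{last (x # us), u} \<in> incident G u" using chain_edge(1)[of x us u "[]"] c by simp
    moreover have "degree G u = 1" using d True by simp
    ultimately have "incident G u = {{last (x # us), u}}" by (intro incident_1)
    moreover have "e \<in> incident G u" using e by (simp add: incident_def)
    ultimately have "e = {last (x # us), u}" by blast
    then show ?thesis using elist_snoc[of "x # us" u] ys by simp
  next
    case False
    then obtain as bs where ys: "ys = as @ u # bs" "bs \<noteq> []" using chain_inner[OF c e(3)] by blast
    have "incident G u = {{last (x # as), u}, {u, hd bs}}"
      using chain_incident(2)[of x as u bs] c ys by simp
    moreover have "e \<in> incident G u" using e by (simp add: incident_def)
    ultimately have "e = {last (x # as), u} \<or> e = {u, hd bs}" by blast
    moreover have "{last (x # as), u} \<in> set (elist (x # ys))"
      using elist_last_edge[of "x # as" u bs] by (simp add: ys(1))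
    moreover have "{u, hd bs} \<in> set (elist (x # ys))"
      using elist_hd_edge[of bs u "x # as"] ys(2) by (simp add: ys(1))
    ultimately show ?thesis by blast
  qed
  show ?thesis unfolding arm_def
  proof (intro conjI ballI impI)
    fix e assume "e \<in> edges G" "e \<inter> set ys \<noteq> {}"
    then show "e \<in> set (elist (x # ys))" using e by blast
  qed (use c in \<open>auto simp: chain_def\<close>)
qed

text \<open>The last vertex has a second edge, leading to some u. An inner vertex of the chain has
  no free edge for it, and a new vertex would prolong the chain, so u = x. As x is then not the
  predecessor of the last vertex, the chain has at least two vertices.\<close>

lemma chain_maximal:
  assumes c: "chain x ys" and max: "\<And>u. \<not> chain x (ys @ [u])" and d: "degree G (last ys) = 2"
  shows "{last ys, x} \<in> edges G" "2 \<le> length ys"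
proof -
  define us z where "us = butlast ys" and "z = last ys"
  have ys: "ys = us @ [z]" using c by (simp add: us_def z_def chain_def)
  let ?p = "last (x # us)"
  have cz: "chain x (us @ [z])" using c ys by simp
  have inner: "\<forall>v\<in>set us. degree G v = 2" using cz by (simp add: chain_def)
  have dz: "degree G z = 2" using d by (simp add: z_def)
  have pz: "{?p, z} \<in> incident G z" using chain_edge(1)[OF cz] .
  have "\<exists>e\<in>incident G z. e \<noteq> {?p, z}"
  proof (rule ccontr)
    assume "\<not> ?thesis"
    then have "incident G z = {{?p, z}}" using pz by blast
    then have "degree G z = card {{?p, z}}" by (simp only: degree_def)
    then show False using dz by simp
  qed
  then obtain e where e: "e \<in> incident G z" "e \<noteq> {?p, z}" by blast
  then have "e \<in> edges G" "z \<in> e" by (simp_all add: incident_def)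
  then obtain u where u: "e = {z, u}" "z \<noteq> u" using edge_at[of e z] by metis
  have up: "u \<noteq> ?p" using e(2) u(1) by (metis insert_commute)
  have zu: "{z, u} \<in> edges G" using \<open>e \<in> edges G\<close> u(1) by simp
  have "u \<notin> set us"
  proof
    assume "u \<in> set us"
    then obtain as bs where us: "us = as @ u # bs" using split_list by fast
    have cu: "chain x (as @ u # (bs @ [z]))" using cz by (simp add: us)
    have dist: "distinct (x # as @ u # bs @ [z])" using cu by (simp add: chain_def)
    have "{z, u} \<in> incident G u" using zu by (simp add: incident_def)
    moreover have "incident G u = {{last (x # as), u}, {u, hd (bs @ [z])}}"
      by (rule chain_incident(2)[OF cu]) simp
    ultimately have "{z, u} = {last (x # as), u} \<or> {z, u} = {u, hd (bs @ [z])}" by simp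
    then have "z = last (x # as) \<or> z = hd (bs @ [z])" using u(2) by (metis doubleton_eq_iff)
    moreover have "z \<noteq> last (x # as)"
    proof -
      have "last (x # as) \<in> set (x # as)" by (rule last_in_set) simp
      moreover have "z \<notin> set (x # as)" using dist by auto
      ultimately show ?thesis by metis
    qed
    ultimately have z: "z = hd (bs @ [z])" by blast
    have "bs = []"
    proof (rule ccontr)
      assume "bs \<noteq> []"
      then have "z \<in> set bs" using z hd_in_set[of bs] by simp
      then show False using dist by simp
    qed
    then show False using up us by simp
  qed
  have ux: "u = x"
  proof (rule ccontr)
    assume "u \<noteq> x"
    then have "distinct (x # ys @ [u])" using cz \<open>u \<notin> set us\<close> u(2) by (auto simp: chain_def ys)
    moreover have "set (elist (x # ys @ [u])) \<subseteq> edges G"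
      using c zu elist_snoc[of "x # ys" u] by (simp add: chain_def z_def)
    moreover have "\<forall>v\<in>set ys. degree G v = 2" using inner dz by (simp add: ys)
    ultimately have "chain x (ys @ [u])" by (simp add: chain_def butlast_append)
    then show False using max by blast
  qed
  then show "{last ys, x} \<in> edges G" using zu by (simp add: z_def)
  have "us \<noteq> []" using up ux by auto
  then show "2 \<le> length ys" by (cases us) (simp_all add: ys)
qed

text \<open>Take a longest chain starting with the given edge; its length is bounded by the number
  of vertices. It stops at a vertex of degree other than 2 or closes up at x.\<close>

lemma chain_exists:
  assumes xy: "{x, y} \<in> edges G"
  obtains ys where "chain x ys" "hd ys = y"
    "degree G (last ys) \<noteq> 2 \<or> degree G (last ys) = 2 \<and> {last ys, x} \<in> edges G \<and> 2 \<le> length ys"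
proof -
  let ?P = "\<lambda>ys. chain x ys \<and> hd ys = y"
  have "x \<noteq> y" using edge_card[OF xy] by auto
  then have P1: "?P [y]" using xy by (simp add: chain_def)
  have P2: "\<forall>ys. ?P ys \<longrightarrow> length ys < Suc (card (verts G))"
  proof (intro allI impI)
    fix ys assume p: "?P ys"
    then have "set ys \<subseteq> verts G" using chain_verts by auto
    then have "card (set ys) \<le> card (verts G)" using finite_verts card_mono by blast
    then show "length ys < Suc (card (verts G))" using p by (simp add: chain_def distinct_card)
  qed
  obtain ys where P: "?P ys" and max: "\<And>zs. ?P zs \<Longrightarrow> length zs \<le> length ys"
    using ex_has_greatest_nat[of ?P, OF P1 P2] by metis
  have "\<not> chain x (ys @ [u])" for u
  proof
    assume "chain x (ys @ [u])"
    moreover have "hd (ys @ [u]) = y" using P by (simp add: chain_def)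
    ultimately show False using max[of "ys @ [u]"] by simp
  qed
  then show ?thesis using chain_maximal[of x ys] that P by blast
qed

text \<open>An arm going backwards from u would swallow the whole chain up to x, but no vertex of an
  arm has degree 3 or more. Hence the edge behind u is not simple.\<close>

lemma chain_back_contrib:
  assumes c: "chain x (as @ u # bs)" and d: "3 \<le> degree G x"
  shows "contrib u {last (x # as), u} = 2 * weight (f {last (x # as), u})"
proof -
  have "contrib u {u, last (x # as)} = 2 * weight (f {u, last (x # as)})"
  proof (rule contrib_no_arm)
    fix zs assume zs: "arm G u zs"
    show "hd zs \<noteq> last (x # as)"
    proof
      assume h: "hd zs = last (x # as)"
      have "set (rev (x # as)) \<subseteq> set zs"
      proof (rule arm_propagate[OF zs])
        have "hd zs \<in> set zs" using zs by (simp add: arm_def)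
        then show "hd (rev (x # as)) \<in> set zs" by (simp only: h hd_rev)
        have "elist (x # as @ u # bs) = elist (x # as) @ {last (x # as), u} # elist (u # bs)"
          using elist_append[of "x # as" u bs] elist_snoc[of "x # as" u] by simp
        then show "set (elist (rev (x # as))) \<subseteq> edges G"
          unfolding elist_rev using c by (simp add: chain_def)
        show "u \<notin> set (rev (x # as))" using c by (auto simp: chain_def)
      qed
      then show False using arm_degree_le_2[OF zs, of x] d by auto
    qed
  qed
  then show ?thesis by (simp add: insert_commute)
qed

lemma max_degree_2_shape:
  assumes le: "\<And>v. v \<in> verts G \<Longrightarrow> degree G v \<le> 2"
  shows "(\<exists>vs. path_shape vs) \<or> (\<exists>vs. cycle_shape vs)"
proof (cases "\<exists>x\<in>verts G. degree G x \<le> 1")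
  case True
  then obtain x where x: "x \<in> verts G" "degree G x \<le> 1" by blast
  show ?thesis
  proof (cases "degree G x = 0")
    case True
    then have "incident G x = {}" using finite_incident by (simp add: degree_def)
    then have "verts G = {x}" "edges G = {}" using x spanning[of x "{x}" "{}"] by auto
    then have "path_shape [x]" by (simp add: path_shape_def)
    then show ?thesis by blast
  next
    case False
    then have d: "degree G x = 1" using x by simp
    then obtain e where e: "incident G x = {e}" by (auto simp: degree_def card_1_singleton_iff)
    then have ee: "e \<in> edges G" "x \<in> e" by (auto simp: incident_def)
    obtain y where y: "e = {x, y}" using edge_at[OF ee] by metis
    obtain ys where c: "chain x ys" "hd ys = y" and
      alt: "degree G (last ys) \<noteq> 2 \<or> degree G (last ys) = 2 \<and> {last ys, x} \<in> edges G \<and> 2 \<le> length ys"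
      using chain_exists[of x y] ee y by metis
    have ysne: "ys \<noteq> []" "distinct (x # ys)" using c by (auto simp: chain_def)
    have y_edge: "{x, hd ys} \<in> set (elist (x # ys))" using elist_Cons[OF ysne(1), of x] by simp
    \<comment> \<open>The chain cannot return to x: the closing edge would have to be the only edge
      at x, which is the first edge of the chain.\<close>
    have dl: "degree G (last ys) \<noteq> 2"
    proof
      assume "degree G (last ys) = 2"
      then have l: "{last ys, x} \<in> incident G x" "2 \<le> length ys" using alt by (simp_all add: incident_def)
      then have "{last ys, x} = {x, hd ys}" using e y c(2) by simp
      then have "last ys = hd ys" by (metis doubleton_eq_iff)
      then show False using l(2) ysne by (cases ys) (auto split: if_splits)
    qed
    define us z where "us = butlast ys" and "z = last ys"
    have ys: "ys = us @ [z]" using ysne by (simp add: us_def z_def)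
    have "{last (x # us), z} \<in> incident G z"
      using chain_edge(1)[of x us z "[]"] c(1) by (simp add: ys)
    then have "degree G z \<noteq> 0" using finite_incident by (auto simp: degree_def)
    moreover have "z \<in> verts G" using chain_verts[OF c(1)] by (simp add: ys)
    then have "degree G z \<le> 2" by (rule le)
    ultimately have "degree G (last ys) = 1" using dl by (simp add: z_def)
    then have arm: "arm G x ys" by (rule chain_arm[OF c(1)])
    have "incident G u \<subseteq> set (elist (x # ys))" if u: "u \<in> set (x # ys)" for u
    proof (cases "u = x")
      case True
      then show ?thesis using e y c(2) y_edge by simp
    next
      case False
      then show ?thesis using arm_incident_subset[OF arm] u by simp
    qed
    moreover have "x \<in> set (x # ys)" by simp
    moreover have "set (elist (x # ys)) \<subseteq> edges G" using c(1) by (simp add: chain_def)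
    ultimately have "verts G = set (x # ys)" "edges G = set (elist (x # ys))"
      using spanning[of x "set (x # ys)" "set (elist (x # ys))"] chain_verts[OF c(1)] elist_subset
      by blast+
    then have "path_shape (x # ys)" using ysne by (simp add: path_shape_def)
    then show ?thesis by blast
  qed
next
  case False
  then have d2: "degree G v = 2" if "v \<in> verts G" for v using le that by fastforce
  obtain x where x: "x \<in> verts G" using verts_nonempty by blast
  then have "incident G x \<noteq> {}" using d2 by (force simp: degree_def)
  then obtain e where ee: "e \<in> edges G" "x \<in> e" by (auto simp: incident_def)
  obtain y where y: "e = {x, y}" using edge_at[OF ee] by metis
  obtain ys where c: "chain x ys" "hd ys = y" and
    \<comment> \<open>All degrees are 2 here, so only the second alternative is possible and the
      chain closes up to a cycle.\<close>
    alt: "degree G (last ys) \<noteq> 2 \<or> degree G (last ys) = 2 \<and> {last ys, x} \<in> edges G \<and> 2 \<le> length ys"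
    using chain_exists[of x y] ee y by metis
  have ysne: "ys \<noteq> []" "distinct (x # ys)" "set (elist (x # ys)) \<subseteq> edges G" using c by (auto simp: chain_def)
  define us z where "us = butlast ys" and "z = last ys"
  have ys: "ys = us @ [z]" using ysne by (simp add: us_def z_def)
  have zV: "z \<in> verts G" using chain_verts[OF c(1)] ys by auto
  then have cyc: "{z, x} \<in> edges G" "2 \<le> length ys" using alt d2 by (auto simp: z_def)
  then have us: "us \<noteq> []" using ys by auto
  have hd: "hd ys \<in> set us" using us by (simp add: ys)
  then have hz: "hd ys \<noteq> z" using ysne(2) ys by auto
  let ?E = "insert {x, z} (set (elist (x # ys)))"
  have el: "elist (x # ys) = {x, hd ys} # elist ys" "elist (x # ys) = elist (x # us) @ [{last us, z}]"
    using ysne(1) elist_Cons[of ys x] elist_snoc[of "x # us" z] us by (auto simp: ys)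
  have "incident G u \<subseteq> ?E" if "u \<in> set (x # ys)" for u
  proof -
    consider "u = x" | "u = z" | "u \<in> set ys" "u \<noteq> last ys" using \<open>u \<in> set (x # ys)\<close> by (auto simp: z_def)
    then show ?thesis
    proof cases
      case 1
      have "{x, hd ys} \<in> incident G x" "{x, z} \<in> incident G x"
        using ysne(3) cyc el by (auto simp: incident_def insert_commute)
      moreover have "{x, hd ys} \<noteq> {x, z}" using hz by (metis doubleton_eq_iff)
      ultimately have "incident G x = {{x, hd ys}, {x, z}}" using incident_2[OF d2[OF x]] by blast
      then show ?thesis using 1 el by auto
    next
      case 2
      have "{last us, z} \<in> incident G z" "{x, z} \<in> incident G z"
        using ysne(3) cyc by (auto simp: el(2) incident_def insert_commute)
      moreover have "{last us, z} \<noteq> {x, z}"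
      proof -
        have "last us \<noteq> x" using us ysne(2) ys last_in_set[of us] by auto
        then show ?thesis by (metis doubleton_eq_iff)
      qed
      ultimately have "incident G z = {{last us, z}, {x, z}}" using incident_2[OF d2[OF zV]] by blast
      then show ?thesis using 2 el(2) by auto
    next
      case 3
      then obtain as bs where ab: "ys = as @ u # bs" "bs \<noteq> []" using chain_inner[OF c(1)] by blast
      have i: "incident G u = {{last (x # as), u}, {u, hd bs}}"
        using chain_incident(2)[of x as u bs] c ab by simp
      have "distinct ((x # as) @ u # bs)" using ysne(2) ab by simp
      then have "{last (x # as), u} \<in> set (elist ((x # as) @ u # bs))" "{u, hd bs} \<in> set (elist ((x # as) @ u # bs))"
        using elist_incident[of "x # as" u bs] ab(2) by blast+
      then show ?thesis unfolding i by (simp add: ab)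
    qed
  qed
  moreover have "?E \<subseteq> edges G" using cyc ysne by (auto simp: insert_commute)
  moreover have "e \<subseteq> set (x # ys)" if "e \<in> ?E" for e using that elist_subset[of e "x # ys"] ys by auto
  ultimately have "verts G = set (x # ys)" "edges G = ?E"
    using spanning[of x "set (x # ys)" ?E] chain_verts[OF c(1)] by auto
  then have "cycle_shape (x # ys)" using ysne cyc by (simp add: cycle_shape_def z_def)
  then show ?thesis by blast
qed

end

section \<open>Arm lengths of trees with three arms\<close>

lemma rho_mono: "m \<le> n \<Longrightarrow> rho m \<le> rho n"
  by (simp add: rho_eq frac_le)

text \<open>By monotonicity it suffices to exclude a few triples with sum above 4: (3,3,3), (2,2,3),
  (1,4,4), (1,3,4) and (1,2,6). They lie just beyond the boundary triples (2,2,2), (1,3,3) and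
  (1,2,5), where the sum is exactly 4.\<close>

lemma T_sizes:
  assumes "1 \<le> p" "p \<le> q" "q \<le> r" and le: "rho p + rho q + rho r \<le> 4"
  shows "p = 1 \<and> q = 1 \<or> (p, q, r) \<in> {(1, 2, 2), (1, 2, 3), (1, 2, 4), (1, 2, 5), (1, 3, 3), (2, 2, 2)}"
proof -
  have not: False if "i \<le> p" "j \<le> q" "k \<le> r" "4 < rho i + rho j + rho k" for i j k
    using rho_mono[OF that(1)] rho_mono[OF that(2)] rho_mono[OF that(3)] that(4) le by linarith
  have 1: "p \<le> 2" using not[of 3 3 3] assms by (force simp: rho_numeral)
  have 2: "p = 2 \<Longrightarrow> r \<le> 2" using not[of 2 2 3] assms by (force simp: rho_numeral)
  have 3: "q \<le> 3" if "p = 1" using not[of 1 4 4] that assms by (force simp: rho_numeral)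
  have 4: "r \<le> 3" if "p = 1" "q = 3" using not[of 1 3 4] that by (force simp: rho_numeral)
  have 5: "r \<le> 5" if "p = 1" "q = 2" using not[of 1 2 6] that by (force simp: rho_numeral)
  from 1 assms(1) consider "p = 2" | "p = 1" by linarith
  then show ?thesis
  proof cases
    case 1
    then have "q = 2" "r = 2" using 2 assms(2,3) by linarith+
    then show ?thesis using 1 by simp
  next
    case p: 2
    then consider "q = 1" | "q = 2" | "q = 3" using 3 assms(2) by linarith
    then show ?thesis
    proof cases
      case 2
      then have "r = 2 \<or> r = 3 \<or> r = 4 \<or> r = 5" using 5[OF p] assms(3) by linarith
      then show ?thesis using p 2 by auto
    next
      case 3
      then have "r = 3" using 4[OF p] assms(3) by linarith
      then show ?thesis using p 3 by simp
    qed (use p in simp)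
  qed
qed

lemma T_graph_listed:
  assumes "1 \<le> p" "p \<le> q" "q \<le> r" and le: "rho p + rho q + rho r \<le> 4"
  shows "listed (T_graph p q r, \<lambda>_. 3)"
proof -
  have III: "listed Y" if "Y \<in> list_III" for Y using that by (simp add: listed_def)
  have IV: "listed Y" if "Y \<in> list_IV" for Y using that by (simp add: listed_def)
  from T_sizes[OF assms] consider "p = 1" "q = 1" | "(p, q, r) = (1, 2, 2)" | "(p, q, r) = (1, 2, 3)"
    | "(p, q, r) = (1, 2, 4)" | "(p, q, r) = (1, 2, 5)" | "(p, q, r) = (1, 3, 3)" | "(p, q, r) = (2, 2, 2)"
    by blast
  then show ?thesis
  proof cases
    case 1
    have "4 \<le> r + 3" "r + 3 - 3 = r" using assms by simp_all
    then show ?thesis using III[OF list_III.D, of "r + 3"] 1 by metis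
  next
    case 2 then show ?thesis using III[OF list_III.E6] by simp
  next
    case 3 then show ?thesis using III[OF list_III.E7] by simp
  next
    case 4 then show ?thesis using III[OF list_III.E8] by simp
  next
    case 5 then show ?thesis using IV[OF list_IV.E8] by simp
  next
    case 6 then show ?thesis using IV[OF list_IV.E7] by simp
  next
    case 7 then show ?thesis using IV[OF list_IV.E6] by simp
  qed
qed

section \<open>Graphs with a vertex of degree at least 3\<close>

context coxeter
begin

lemma arm_hd_edge_unique:
  assumes a: "arm G x as" and e: "{x, v} \<in> edges G" "v \<in> set as"
  shows "v = hd as"
proof -
  have "{x, v} \<in> set (elist (x # as))" using assms by (auto simp: arm_def)
  then have "{x, v} = {x, hd as}"
    using elist_incident[of "[]" x as "{x, v}"] a by (simp add: arm_def)
  then show ?thesis by (metis doubleton_eq_iff)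
qed

text \<open>From a common vertex, follow the second arm back to its first vertex. The walk avoids x,
  so it stays in the first arm; that arm has only its own first vertex adjacent to x.\<close>

lemma arms_disjoint:
  assumes a: "arm G x as" and b: "arm G x bs" and ne: "hd as \<noteq> hd bs"
  shows "set as \<inter> set bs = {}"
proof (rule ccontr)
  assume "\<not> ?thesis"
  then obtain u where u: "u \<in> set as" "u \<in> set bs" by blast
  obtain b1 b2 where bs: "bs = b1 @ u # b2" using u(2) split_list by fast
  have el: "elist bs = elist (b1 @ [u]) @ elist (u # b2)" unfolding bs by (rule elist_append)
  have "set (elist bs) \<subseteq> edges G" using b by (auto simp: arm_def elist_Cons)
  then have "set (elist (rev (b1 @ [u]))) \<subseteq> edges G" unfolding elist_rev el by simp
  moreover have "x \<notin> set (rev (b1 @ [u]))" using b by (auto simp: arm_def bs)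
  moreover have "hd (rev (b1 @ [u])) \<in> set as" using u(1) by simp
  ultimately have "set (rev (b1 @ [u])) \<subseteq> set as" using arm_propagate[OF a] by blast
  moreover have "hd bs \<in> set (rev (b1 @ [u]))" by (cases b1) (simp_all add: bs)
  ultimately have "hd bs \<in> set as" by blast
  then have "hd bs = hd as" using arm_hd_edge_unique[OF a arm_hd_edge[OF b]] by simp
  then show False using ne by simp
qed

lemma T_shapeI:
  assumes a: "arm G x as" "arm G x bs" "arm G x cs" "distinct [hd as, hd bs, hd cs]"
    and inc: "incident G x = {{x, hd as}, {x, hd bs}, {x, hd cs}}"
  shows "T_shape x as bs cs"
proof -
  let ?S = "set (x # as @ bs @ cs)"
  let ?E = "set (elist (x # as)) \<union> set (elist (x # bs)) \<union> set (elist (x # cs))"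
  have d: "set as \<inter> set bs = {}" "set as \<inter> set cs = {}" "set bs \<inter> set cs = {}"
    using arms_disjoint a by simp_all
  have hd: "{x, hd ys} \<in> set (elist (x # ys))" if "arm G x ys" for ys
    using that by (simp add: arm_def elist_Cons)
  have "incident G u \<subseteq> ?E" if u: "u \<in> ?S" for u
  proof -
    consider "u = x" | "u \<in> set as" | "u \<in> set bs" | "u \<in> set cs" using u by auto
    then show ?thesis
    proof cases
      case 1 then show ?thesis using hd[OF a(1)] hd[OF a(2)] hd[OF a(3)] by (simp add: inc)
    qed (use arm_incident_subset a in blast)+
  qed
  moreover have "?E \<subseteq> edges G" using a by (auto simp: arm_def)
  moreover have "?S \<subseteq> verts G" using arm_verts[OF a(1)] arm_verts[OF a(2)] arm_verts[OF a(3)] by simp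
  moreover have "e \<subseteq> ?S" if "e \<in> ?E" for e
    using that elist_subset[of e "x # as"] elist_subset[of e "x # bs"] elist_subset[of e "x # cs"] by auto
  ultimately have "verts G = ?S" "edges G = ?E" using spanning[of x ?S ?E] by simp_all
  moreover have "as \<noteq> []" "bs \<noteq> []" "cs \<noteq> []" "distinct (x # as)" "distinct (x # bs)" "distinct (x # cs)"
    using a by (simp_all add: arm_def)
  ultimately show ?thesis using d by (simp add: T_shape_def Int_Un_distrib)
qed

lemma T_shape_swap:
  assumes "T_shape x as bs cs"
  shows "T_shape x bs as cs" "T_shape x as cs bs"
  using assms by (simp_all add: T_shape_def Un_ac Int_Un_distrib Int_commute)

text \<open>A label other than 3 has weight at least 2, and a nonsimple edge of weight 1 contributes
  exactly 2. So only simple edges of label 3 stay below 2.\<close>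

lemma contrib_less_2_arm:
  assumes e: "e \<in> incident G x" and less: "contrib x e < 2"
  obtains ys where "arm G x ys" "e = {x, hd ys}" "f ` set (elist (x # ys)) \<subseteq> {3}"
    "contrib x e = rho (length ys)"
proof -
  have eG: "e \<in> edges G" using e by (simp add: incident_def)
  have fe: "f e = 3"
    using contrib_ge_weight[OF e] less weight_ge_2[OF label_ge_3[OF eG]] by force
  have "simple_pair G (f_hat f) x e"
    using less fe by (simp add: contrib_def partial_rho_def f_hat_eq_weight split: if_splits)
  then obtain ys where ys: "arm G x ys" "e = {x, hd ys}" by (rule simple_pair_imp_arm)
  then have "f ` set (elist ys) \<subseteq> {3}"
    using arm_simple_iff[OF ys(1)] \<open>simple_pair G (f_hat f) x e\<close> by simp
  then have f3: "f ` set (elist (x # ys)) \<subseteq> {3}" using fe ys by (auto simp: arm_def elist_Cons)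
  have "\<forall>m\<in>set (map f (elist (x # ys))). m = 3" using f3 by auto
  then have "map f (elist (x # ys)) = replicate (length ys) 3"
    using replicate_length_same[of "map f (elist (x # ys))" 3] by simp
  then have "contrib x e = rho (length ys)" using arm_contrib[OF ys(1)] ys(2) by simp
  then show ?thesis using that ys f3 by blast
qed

lemma contrib_1_leaf:
  assumes "e \<in> incident G x" "contrib x e = 1"
  obtains a where "e = {x, a}" "arm G x [a]" "f e = 3"
proof -
  obtain ys where ys: "arm G x ys" "e = {x, hd ys}" "f ` set (elist (x # ys)) \<subseteq> {3}"
    "contrib x e = rho (length ys)"
    using contrib_less_2_arm[OF assms(1)] assms(2) by auto
  have "length ys \<le> 1" using ys(4) assms(2) rho_le_1_iff[of "length ys"] by simp
  then obtain a where "ys = [a]" using ys(1) by (cases ys) (auto simp: arm_def)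
  then show ?thesis using that ys by simp
qed

lemma leaf_facts:
  assumes "arm G x [a]"
  shows "{x, a} \<in> edges G" "incident G a = {{x, a}}" "degree G a = 1" "a \<noteq> x" "a \<in> verts G"
proof -
  show "{x, a} \<in> edges G" using arm_hd_edge[OF assms] by simp
  show "incident G a = {{x, a}}" using arm_incident[of x "[]" a "[]"] assms by simp
  show "degree G a = 1" using arm_degree[of x "[]" a "[]"] assms by simp
  show "a \<noteq> x" using assms by (auto simp: arm_def)
  show "a \<in> verts G" using arm_verts[OF assms] by simp
qed

text \<open>At least two further edges contribute at least 1 each, so the bound 4 leaves no slack:
  there are exactly two of them, both contribute 1, and such an edge leads to a leaf.\<close>

lemma big_contrib:
  assumes le: "rho_degree G (f_hat f) x \<le> 4" and e: "e \<in> incident G x"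
    and big: "2 \<le> contrib x e" and d: "3 \<le> degree G x"
  obtains a b where "contrib x e = 2" "incident G x = {e, {x, a}, {x, b}}" "a \<noteq> b"
    "e \<noteq> {x, a}" "e \<noteq> {x, b}" "arm G x [a]" "arm G x [b]" "f {x, a} = 3" "f {x, b} = 3"
proof -
  let ?R = "incident G x - {e}"
  have sum: "rho_degree G (f_hat f) x = contrib x e + (\<Sum>d\<in>?R. contrib x d)"
    unfolding rho_degree_eq using finite_incident e by (rule sum.remove)
  have "real (card ?R) = (\<Sum>d\<in>?R. 1)" by simp
  also have "\<dots> \<le> (\<Sum>d\<in>?R. contrib x d)" by (rule sum_mono) (simp add: contrib_ge_1)
  finally have R: "real (card ?R) \<le> (\<Sum>d\<in>?R. contrib x d)" .
  have "2 \<le> card ?R" using d e finite_incident by (simp add: degree_def)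
  then have "card ?R = 2" and two: "contrib x e = 2" "(\<Sum>d\<in>?R. contrib x d) = 2"
    using R sum le big by linarith+
  then obtain d1 d2 where R12: "?R = {d1, d2}" "d1 \<noteq> d2" by (auto simp: card_2_iff)
  then have i: "d1 \<in> incident G x" "d2 \<in> incident G x" "d1 \<noteq> e" "d2 \<noteq> e" by blast+
  have "contrib x d1 + contrib x d2 = 2" using two(2) R12 by simp
  then have c: "contrib x d1 = 1" "contrib x d2 = 1"
    using contrib_ge_1[OF i(1)] contrib_ge_1[OF i(2)] by linarith+
  obtain a where a: "d1 = {x, a}" "arm G x [a]" "f d1 = 3" using contrib_1_leaf[OF i(1) c(1)] .
  obtain b where b: "d2 = {x, b}" "arm G x [b]" "f d2 = 3" using contrib_1_leaf[OF i(2) c(2)] .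
  have "incident G x = {e, d1, d2}" using R12 e by blast
  then show ?thesis using that[of a b] a b i R12 two by blast
qed

definition classified :: bool where
  "classified \<longleftrightarrow> (\<exists>Y. listed Y \<and> labelled_iso (G, f) Y)"

lemma classified_T:
  assumes x: "degree G x = 3" and less: "\<And>e. e \<in> incident G x \<Longrightarrow> contrib x e < 2"
    and le: "rho_degree G (f_hat f) x \<le> 4"
  shows classified
proof -
  obtain e1 e2 e3 where inc: "incident G x = {e1, e2, e3}" and ne: "e1 \<noteq> e2" "e1 \<noteq> e3" "e2 \<noteq> e3"
    using x by (auto simp: degree_def card_3_iff)
  have i: "e1 \<in> incident G x" "e2 \<in> incident G x" "e3 \<in> incident G x" by (simp_all add: inc)
  obtain as where as: "arm G x as" "e1 = {x, hd as}" "f ` set (elist (x # as)) \<subseteq> {3}"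
    using contrib_less_2_arm[OF i(1) less[OF i(1)]] .
  obtain bs where bs: "arm G x bs" "e2 = {x, hd bs}" "f ` set (elist (x # bs)) \<subseteq> {3}"
    using contrib_less_2_arm[OF i(2) less[OF i(2)]] .
  obtain cs where cs: "arm G x cs" "e3 = {x, hd cs}" "f ` set (elist (x # cs)) \<subseteq> {3}"
    using contrib_less_2_arm[OF i(3) less[OF i(3)]] .
  have T: "T_shape x as bs cs"
    using as bs cs ne inc by (intro T_shapeI) auto
  have f3: "f ` edges G \<subseteq> {3}" using T as bs cs by (simp add: T_shape_def image_Un)
  have ex: classified if T: "T_shape x as bs cs" and l: "length as \<le> length bs" "length bs \<le> length cs" for as bs cs
  proof -
    have p: "1 \<le> length as" using T by (cases as) (auto simp: T_shape_def)
    have "rho (length as) + rho (length bs) + rho (length cs) \<le> 4"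
      using T_shape_label_3(1)[OF T f3] le by simp
    then have "listed (T_graph (length as) (length bs) (length cs), \<lambda>_. 3)"
      using T_graph_listed p l by blast
    moreover have "labelled_iso (G, f) (T_graph (length as) (length bs) (length cs), \<lambda>_. 3)"
      using labelled_iso_T[of "length as" "length bs" "length cs"] p l T f3 by fastforce
    ultimately show ?thesis unfolding classified_def by blast
  qed
  \<comment> \<open>All orders of the arms are shapes of the same graph, so the lengths may be
    assumed to be sorted as in the lists.\<close>
  have "T_shape x as cs bs" "T_shape x bs as cs" "T_shape x bs cs as" "T_shape x cs as bs" "T_shape x cs bs as"
    using T T_shape_swap by blast+
  then show ?thesis using ex T by (meson nat_le_linear)
qed

lemma classified_D:
  assumes D: "D_shape a b ys c d" and f: "f ` edges G \<subseteq> {3}"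
  shows classified
proof -
  have "ys \<noteq> []" using D by (simp add: D_shape_def)
  then have l: "4 \<le> length ys + 3" by (cases ys) auto
  have "labelled_iso (G, f) (D_affine_graph (length ys + 3), \<lambda>_. 3)"
    unfolding labelled_iso_D_affine[OF l] using D f by (intro exI conjI) simp_all
  moreover have "listed (D_affine_graph (length ys + 3), \<lambda>_. 3)"
    using list_IV.D[OF l] by (simp add: listed_def)
  ultimately show ?thesis unfolding classified_def by blast
qed

text \<open>Four or more edges contributing at least 1 each exhaust the bound: there are exactly
  four, each leading to a leaf with label 3. The result is affine D_4, a \<open>D_shape\<close> with
  the spine \<open>[x]\<close>.\<close>

lemma classified_D4:
  assumes d: "4 \<le> degree G x" and le: "rho_degree G (f_hat f) x \<le> 4"
  shows classified
proof -
  have leaf: "\<exists>a. e = {x, a} \<and> arm G x [a] \<and> f e = 3" if e: "e \<in> incident G x" for e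
  proof -
    let ?R = "incident G x - {e}"
    have sum: "rho_degree G (f_hat f) x = contrib x e + (\<Sum>d\<in>?R. contrib x d)"
      unfolding rho_degree_eq using finite_incident e by (rule sum.remove)
    have "real (card ?R) = (\<Sum>d\<in>?R. 1)" by simp
    also have "\<dots> \<le> (\<Sum>d\<in>?R. contrib x d)" by (rule sum_mono) (simp add: contrib_ge_1)
    finally have "real (card ?R) \<le> (\<Sum>d\<in>?R. contrib x d)" .
    moreover have "3 \<le> card ?R" using d e finite_incident by (simp add: degree_def)
    ultimately have "contrib x e = 1" using sum le contrib_ge_1[OF e] by linarith
    then show ?thesis using contrib_1_leaf[OF e] by metis
  qed
  have "real (degree G x) = (\<Sum>d\<in>incident G x. 1)" by (simp add: degree_def)
  also have "\<dots> \<le> rho_degree G (f_hat f) x"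
    unfolding rho_degree_eq by (rule sum_mono) (simp add: contrib_ge_1)
  finally have "card (incident G x) = 4" using d le by (simp add: degree_def)
  then have "card (incident G x) = Suc 3" by simp
  then obtain e1 R where "incident G x = insert e1 R" "e1 \<notin> R" "card R = 3"
    unfolding card_Suc_eq by blast
  then obtain e2 e3 e4 where inc: "incident G x = {e1, e2, e3, e4}" and dist: "distinct [e1, e2, e3, e4]"
    by (auto simp: card_3_iff)
  have i: "e1 \<in> incident G x" "e2 \<in> incident G x" "e3 \<in> incident G x" "e4 \<in> incident G x"
    by (simp_all add: inc)
  obtain a where a: "e1 = {x, a}" "arm G x [a]" "f e1 = 3" using leaf[OF i(1)] by blast
  obtain b where b: "e2 = {x, b}" "arm G x [b]" "f e2 = 3" using leaf[OF i(2)] by blast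
  obtain c where c: "e3 = {x, c}" "arm G x [c]" "f e3 = 3" using leaf[OF i(3)] by blast
  obtain d where d: "e4 = {x, d}" "arm G x [d]" "f e4 = 3" using leaf[OF i(4)] by blast
  let ?S = "{a, b, x, c, d}" and ?E = "{e1, e2, e3, e4}"
  note L = leaf_facts[OF a(2)] leaf_facts[OF b(2)] leaf_facts[OF c(2)] leaf_facts[OF d(2)]
  have x: "x \<in> verts G" using L(1) edge_subset by blast
  have "incident G u \<subseteq> ?E" if "u \<in> ?S" for u
  proof -
    from that consider "u = x" | "u = a" | "u = b" | "u = c" | "u = d" by blast
    then show ?thesis
      by cases (simp_all add: inc L(2,7,12,17) a(1) b(1) c(1) d(1))
  qed
  moreover have "?E \<subseteq> edges G" using i by (simp add: incident_def)
  moreover have "e \<subseteq> ?S" if "e \<in> ?E" for e using that a(1) b(1) c(1) d(1) by auto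
  moreover have "?S \<subseteq> verts G" using L x by simp
  ultimately have S: "verts G = ?S" "edges G = ?E" using spanning[of x ?S ?E] by simp_all
  have "distinct ([a, b] @ [x] @ [c, d])"
  proof -
    have "a \<noteq> b" "a \<noteq> c" "a \<noteq> d" "b \<noteq> c" "b \<noteq> d" "c \<noteq> d"
      using dist unfolding a(1) b(1) c(1) d(1) by auto
    then show ?thesis using L(4,9,14,19) by simp
  qed
  then have "D_shape a b [x] c d"
    unfolding D_shape_def using S a(1) b(1) c(1) d(1) by (simp add: insert_commute)
  moreover have "f ` edges G \<subseteq> {3}" using S(2) a b c d by simp
  ultimately show ?thesis by (rule classified_D)
qed

text \<open>The edge behind u contributes twice its weight and the edge ahead at least 1, so the
  weight is at most 3/2, which excludes every label except 3.\<close>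

lemma chain_butlast_label_3:
  assumes c: "chain x (as @ u # bs)" and bs: "bs \<noteq> []" and d: "3 \<le> degree G x"
    and le: "rho_degree G (f_hat f) u \<le> 4"
  shows "f {last (x # as), u} = 3"
proof -
  let ?e = "{last (x # as), u}" and ?e' = "{u, hd bs}"
  note i = chain_incident[OF c bs]
  have "rho_degree G (f_hat f) u = contrib u ?e + contrib u ?e'"
    unfolding rho_degree_eq i(2) using i(3) by simp
  moreover have "1 \<le> contrib u ?e'" by (rule contrib_ge_1) (simp add: i(2))
  ultimately have "2 * weight (f ?e) \<le> 3" using le chain_back_contrib[OF c d] by simp
  moreover have "?e \<in> edges G" using chain_edge(1)[OF c] by (simp add: incident_def)
  ultimately show ?thesis using weight_ge_2[OF label_ge_3] by force
qed

lemma classified_B: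
  assumes T: "T_shape x [a] [b] ys" and f: "f {x, a} = 3" "f {x, b} = 3"
    and contrib: "contrib x {x, hd ys} = 2"
    and le: "\<And>v. v \<in> verts G \<Longrightarrow> rho_degree G (f_hat f) v \<le> 4"
  shows classified
proof -
  let ?L = "map f (elist (x # ys))"
  note arm = T_shape_arms(3)[OF T]
  have dx: "degree G x = 3"
  proof -
    note A = T_shape_arms(4,5)[OF T]
    have "a \<noteq> b" "a \<noteq> hd ys" "b \<noteq> hd ys" using A(2) by auto
    then show ?thesis by (simp add: degree_def A(1) card_insert_if doubleton_eq_iff)
  qed
  \<comment> \<open>This is the degree condition at the outer endpoint u of the edge labelled m. As
    \<open>post\<close> is nonempty, u is not the last vertex, and its inward edge is not simple
    because x has degree 3.\<close>
  have step: "2 * weight m + side post \<le> 4" if L: "?L = pre @ m # post" and post: "post \<noteq> []" for pre m post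
  proof -
    have len: "length ys = length pre + Suc (length post)" using arg_cong[OF L, of length] by simp
    define as u bs where "as = take (length pre) ys" and "u = ys ! length pre" and "bs = drop (Suc (length pre)) ys"
    have ys: "ys = as @ u # bs" using id_take_nth_drop[of "length pre" ys] len by (simp add: as_def u_def bs_def)
    have la: "length as = length pre" using len by (simp add: as_def)
    have bs: "bs \<noteq> []" using len post by (cases post) (simp_all add: bs_def)
    let ?e = "{last (x # as), u}"
    have el: "elist (x # ys) = elist (x # as) @ ?e # elist (u # bs)"
      using elist_append[of "x # as" u bs] elist_snoc[of "x # as" u] by (simp add: ys)
    have "map f (elist (x # as)) @ f ?e # map f (elist (u # bs)) = pre @ m # post"
      using L unfolding el by simp
    moreover have "length (map f (elist (x # as))) = length pre" using la by simp
    ultimately have m: "m = f ?e" "post = map f (elist (u # bs))"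
      by (simp_all add: append_eq_append_conv)
    have arm': "arm G x (as @ u # bs)" using arm ys by simp
    \<comment> \<open>Vertices of an arm other than its last have degree 2, so an arm is also a
      chain and \<open>chain_back_contrib\<close> applies.\<close>
    have c: "chain x (as @ u # bs)"
    proof -
      have "degree G v = 2" if v: "v \<in> set (butlast ys)" for v
      proof -
        obtain p q where pq: "butlast ys = p @ v # q" using v split_list by fast
        have "ys = p @ v # (q @ [last ys])"
          using append_butlast_last_id[of ys] arm by (simp add: pq arm_def)
        then have "arm G x (p @ v # (q @ [last ys]))" using arm by simp
        then show ?thesis using arm_degree by simp
      qed
      then show ?thesis using arm by (simp add: chain_def arm_def flip: ys)
    qed
    have ub: "arm G u bs" using arm_suffix[OF arm' bs] .
    have u: "u \<in> verts G" using arm_verts[OF arm'] by simp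
    have "contrib u ?e = 2 * weight (f ?e)" using chain_back_contrib[OF c] dx by simp
    moreover have "contrib u {u, hd bs} = side post" using arm_contrib[OF ub] m(2) by simp
    moreover have "rho_degree G (f_hat f) u = contrib u ?e + contrib u {u, hd bs}"
      unfolding rho_degree_eq chain_incident(2)[OF c bs] using chain_incident(3)[OF c bs] by simp
    ultimately show ?thesis using le[OF u] m(1) by simp
  qed
  have "\<forall>m\<in>set ?L. 3 \<le> m" using arm label_ge_3 by (auto simp: arm_def)
  moreover have "side ?L = 2" using arm_contrib[OF arm] contrib by simp
  ultimately obtain n where n: "?L = replicate n 3 @ [4]"
    using labels_B_affine[of ?L] step by blast
  \<comment> \<open>The arm has n + 1 edges, and the path in affine B_l has l - 2, so l = n +
    3.\<close>
  have l: "3 \<le> n + 3" by simp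
  have "\<exists>x a b cs. T_shape x [a] [b] cs \<and> f {x, a} = 3 \<and> f {x, b} = 3 \<and>
       map f (elist (x # cs)) = replicate (n + 3 - 3) 3 @ [4]"
    using T f n by (intro exI[of _ x] exI[of _ a] exI[of _ b] exI[of _ ys]) simp
  then have "labelled_iso (G, f) (B_affine_graph (n + 3), (\<lambda>_. 3)({n + 3 - 2, n + 3 - 1} := 4))"
    unfolding labelled_iso_B_affine[OF l] .
  moreover have "listed (B_affine_graph (n + 3), (\<lambda>_. 3)({n + 3 - 2, n + 3 - 1} := 4))"
    unfolding listed_def by (rule UnI2) (rule list_IV.B[OF l])
  ultimately show ?thesis unfolding classified_def by blast
qed

text \<open>The argument at x repeats at the last vertex z: the edge behind z contributes at least 2
  since x has degree at least 3, so \<open>big_contrib\<close> gives two leaves at z as well.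
  Tightness also makes the label of that edge 3.\<close>

lemma classified_D_long:
  assumes le: "\<And>v. v \<in> verts G \<Longrightarrow> rho_degree G (f_hat f) v \<le> 4"
    and c: "chain x ys" and dx: "3 \<le> degree G x" and dz: "3 \<le> degree G (last ys)"
    and inc: "incident G x = {{x, hd ys}, {x, a}, {x, b}}" "a \<noteq> b"
    and ab: "arm G x [a]" "arm G x [b]" "f {x, a} = 3" "f {x, b} = 3"
  shows classified
proof -
  define us z where "us = butlast ys" and "z = last ys"
  have ys: "ys = us @ [z]" using c by (simp add: us_def z_def chain_def)
  let ?p = "last (x # us)"
  have cz: "chain x (us @ [z])" using c ys by simp
  have dist: "distinct (x # ys)" using c by (simp add: chain_def)
  have zx: "z \<noteq> x" and p: "?p \<in> set (x # us)" "z \<notin> set (x # us)"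
    using dist last_in_set[of "x # us"] by (auto simp: ys simp del: last.simps)
  have zV: "z \<in> verts G" using chain_verts[OF c] by (simp add: ys)
  have dz': "3 \<le> degree G z" using dz by (simp add: z_def)
  have pz: "{?p, z} \<in> incident G z" by (rule chain_edge(1)[OF cz])
  then have pzE: "{?p, z} \<in> edges G" by (simp add: incident_def)
  have cpz: "contrib z {?p, z} = 2 * weight (f {?p, z})" by (rule chain_back_contrib[OF cz dx])
  have "2 \<le> contrib z {?p, z}" using cpz weight_ge_1[OF label_ge_3[OF pzE]] by simp
  then obtain c' d' where z: "contrib z {?p, z} = 2" "incident G z = {{?p, z}, {z, c'}, {z, d'}}" "c' \<noteq> d'"
    "{?p, z} \<noteq> {z, c'}" "{?p, z} \<noteq> {z, d'}" "arm G z [c']" "arm G z [d']" "f {z, c'} = 3" "f {z, d'} = 3"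
    using big_contrib[OF le[OF zV] pz _ dz'] by blast
  have fz: "f {?p, z} = 3"
    using z(1) cpz weight_eq_1_iff[OF label_ge_3[OF pzE]] by simp
  have f3: "f e = 3" if e: "e \<in> set (elist (x # ys))" for e
  proof -
    obtain as p q bs where s: "x # ys = as @ p # q # bs" "e = {p, q}" using elist_split[OF e] .
    \<comment> \<open>Dropping the leading x from \<open>as @ [p]\<close> brings the chosen edge
      into the form in which chains are split; the list is empty if p = x.\<close>
    define as' where "as' = tl (as @ [p])"
    have xas: "x # as' = as @ [p]" using s(1) by (cases as) (auto simp: as'_def)
    have "x # ys = x # (as' @ q # bs)" using s(1) xas by (metis append.assoc append_Cons append_Nil)
    then have ys': "ys = as' @ q # bs" by simp
    have e': "e = {last (x # as'), q}" by (simp only: xas s(2) last_snoc)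
    show ?thesis
    proof (cases "bs = []")
      case True
      then have "as' = us" "q = z" using ys' ys by simp_all
      then show ?thesis using e' fz by simp
    next
      case False
      have "chain x (as' @ q # bs)" using c ys' by simp
      moreover have "q \<in> verts G" using chain_verts[OF c] by (simp add: ys')
      ultimately show ?thesis unfolding e' using chain_butlast_label_3 False dx le by blast
    qed
  qed
  note A = leaf_facts[OF ab(1)] and B = leaf_facts[OF ab(2)]
    and C = leaf_facts[OF z(6)] and D = leaf_facts[OF z(7)]
  have xV: "x \<in> verts G" using chain_verts[OF c] by simp
  \<comment> \<open>Leaves have degree 1 and spine vertices do not, which makes the leaves distinct
    from the spine. Leaves at different ends differ because their only edges do.\<close>
  have deg2: "degree G u \<noteq> 1" if "u \<in> set (x # ys)" for u
  proof -
    have "\<forall>u\<in>set us. degree G u = 2" using cz by (simp add: chain_def)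
    then show ?thesis using that dx dz' by (auto simp: ys)
  qed
  have notin: "v \<notin> set (x # ys)" if "degree G v = 1" for v using deg2 that by blast
  have neq: "u \<noteq> v" if "arm G x [u]" "arm G z [v]" for u v
  proof
    assume "u = v"
    then have "{{x, u}} = {{z, u}}" using leaf_facts(2)[OF that(1)] leaf_facts(2)[OF that(2)] by simp
    then show False using zx by (auto simp: doubleton_eq_iff)
  qed
  let ?w = "x # ys"
  let ?S = "set ([a, b] @ ?w @ [c', d'])"
  let ?E = "set (elist ?w) \<union> {{a, x}, {b, x}, {z, c'}, {z, d'}}"
  have hd: "{x, hd ys} \<in> set (elist ?w)" using elist_Cons[of ys x] by (simp add: ys)
  have lst: "{?p, z} \<in> set (elist ?w)" using elist_snoc[of "x # us" z] by (simp add: ys)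
  have "incident G u \<subseteq> ?E" if u: "u \<in> ?S" for u
  proof -
    from u consider "u = a" | "u = b" | "u = c'" | "u = d'" | "u = x" | "u = z" | "u \<in> set ys" "u \<noteq> last ys"
      by (auto simp: z_def)
    then show ?thesis
    proof cases
      case 1 then show ?thesis by (simp add: A(2) insert_commute)
    next
      case 2 then show ?thesis by (simp add: B(2) insert_commute)
    next
      case 3 then show ?thesis by (simp add: C(2))
    next
      case 4 then show ?thesis by (simp add: D(2))
    next
      case 5 then show ?thesis using hd by (simp add: inc(1) insert_commute)
    next
      case 6
      have "incident G z \<subseteq> ?E" unfolding z(2) using lst by simp
      then show ?thesis using 6 by (simp only:)
    next
      case 7
      obtain as bs where s: "ys = as @ u # bs" "bs \<noteq> []" using chain_inner[OF c 7] .
      have "chain x (as @ u # bs)" using c s by simp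
      then have i: "incident G u = {{last (x # as), u}, {u, hd bs}}" by (rule chain_incident(2)) (rule s(2))
      have "{last (x # as), u} \<in> set (elist ?w)" "{u, hd bs} \<in> set (elist ?w)"
        using elist_last_edge[of "x # as" u bs] elist_hd_edge[of bs u "x # as"] s(2) by (simp_all add: s(1))
      then show ?thesis unfolding i by blast
    qed
  qed
  moreover have "?S \<subseteq> verts G" using chain_verts[OF c] A(5) B(5) C(5) D(5) by simp
  moreover have "?E \<subseteq> edges G" using c A(1) B(1) C(1) D(1) by (simp add: chain_def insert_commute)
  moreover have "e \<subseteq> ?S" if "e \<in> ?E" for e
    using that elist_subset[of e ?w] by (auto simp: ys)
  ultimately have S: "verts G = ?S" "edges G = ?E" using spanning[of x ?S ?E] by simp_all
  have "distinct ([a, b] @ ?w @ [c', d'])"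
    using dist inc(2) z(3) notin[OF A(3)] notin[OF B(3)] notin[OF C(3)] notin[OF D(3)]
      neq[OF ab(1) z(6)] neq[OF ab(1) z(7)] neq[OF ab(2) z(6)] neq[OF ab(2) z(7)] by auto
  moreover have "last ?w = z" by (simp add: ys)
  ultimately have "D_shape a b ?w c' d'" unfolding D_shape_def using S by simp
  moreover have "f ` edges G \<subseteq> {3}"
    unfolding S(2) using f3 ab(3,4) z(8,9) by (auto simp: insert_commute)
  ultimately show ?thesis by (rule classified_D)
qed

lemma classified_degree_3:
  assumes le: "\<And>v. v \<in> verts G \<Longrightarrow> rho_degree G (f_hat f) v \<le> 4"
    and x: "x \<in> verts G" "3 \<le> degree G x"
  shows classified
proof (cases "\<exists>e\<in>incident G x. 2 \<le> contrib x e")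
  case False
  then have less: "contrib x e < 2" if "e \<in> incident G x" for e using that by force
  show ?thesis
  proof (cases "degree G x = 3")
    case True
    then show ?thesis using classified_T less le[OF x(1)] by blast
  next
    case False
    then have "4 \<le> degree G x" using x(2) by simp
    then show ?thesis using classified_D4 le[OF x(1)] by blast
  qed
next
  case True
  then obtain e where e: "e \<in> incident G x" "2 \<le> contrib x e" by blast
  obtain a b where ab: "contrib x e = 2" "incident G x = {e, {x, a}, {x, b}}" "a \<noteq> b"
    "e \<noteq> {x, a}" "e \<noteq> {x, b}" "arm G x [a]" "arm G x [b]" "f {x, a} = 3" "f {x, b} = 3"
    using big_contrib[OF le[OF x(1)] e x(2)] by blast
  have eE: "e \<in> edges G" "x \<in> e" using e by (simp_all add: incident_def)
  obtain y where y: "e = {x, y}" using edge_at[OF eE] by metis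
  obtain ys where c: "chain x ys" "hd ys = y" and
    alt: "degree G (last ys) \<noteq> 2 \<or> degree G (last ys) = 2 \<and> {last ys, x} \<in> edges G \<and> 2 \<le> length ys"
    using chain_exists[of x y] eE(1) y by metis
  have ysne: "ys \<noteq> []" "distinct (x # ys)" using c by (auto simp: chain_def)
  have ya: "y \<noteq> a" "y \<noteq> b" using ab(4,5) y by auto
  \<comment> \<open>The chain cannot close up at x. Its closing edge would be its own first edge,
    impossible for length at least 2, or an edge to \<open>a\<close> or \<open>b\<close>, whose
    degree is 1.\<close>
  have d2: "degree G (last ys) \<noteq> 2"
  proof
    assume d: "degree G (last ys) = 2"
    then have l: "{last ys, x} \<in> incident G x" "2 \<le> length ys" using alt by (simp_all add: incident_def)
    then have "{last ys, x} = {x, y} \<or> {last ys, x} = {x, a} \<or> {last ys, x} = {x, b}"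
      unfolding ab(2) y by simp
    then have "last ys = y \<or> last ys = a \<or> last ys = b" by (metis doubleton_eq_iff)
    moreover have "last ys \<noteq> y" using l(2) ysne c(2) by (cases ys) (auto split: if_splits)
    ultimately show False using d leaf_facts(3)[OF ab(6)] leaf_facts(3)[OF ab(7)] by auto
  qed
  define us z where "us = butlast ys" and "z = last ys"
  have ys: "ys = us @ [z]" using ysne by (simp add: us_def z_def)
  have "{last (x # us), z} \<in> incident G z"
    using chain_edge(1)[of x us z "[]"] c(1) by (simp add: ys)
  then have "degree G z \<noteq> 0" using finite_incident by (auto simp: degree_def)
  then consider "degree G (last ys) = 1" | "3 \<le> degree G (last ys)" using d2 unfolding z_def by linarith
  then show ?thesis
  proof cases
    case 1
    then have arm: "arm G x ys" using chain_arm c(1) by blast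
    have "T_shape x [a] [b] ys"
      using ab arm y c(2) ya by (intro T_shapeI) (auto simp: insert_commute)
    then show ?thesis using classified_B ab(1,8,9) y c(2) le by blast
  next
    case 2
    show ?thesis
      by (rule classified_D_long[OF le c(1) x(2) 2 _ ab(3,6-9)]) (use ab(2) y c(2) in simp_all)
  qed
qed

section \<open>Graphs without a vertex of degree at least 3, and the conclusion\<close>

lemma classified_path_or_cycle:
  assumes le: "\<And>v. v \<in> verts G \<Longrightarrow> rho_degree G (f_hat f) v \<le> 4"
    and deg: "\<And>v. v \<in> verts G \<Longrightarrow> degree G v \<le> 2"
  shows classified
proof -
  consider vs where "path_shape vs" | vs where "cycle_shape vs" using max_degree_2_shape[OF deg] by blast
  then show ?thesis
  proof cases
    case (1 vs)
    let ?ms = "map f (elist vs)"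
    have "\<forall>m\<in>set ?ms. 3 \<le> m" using 1 label_ge_3 by (auto simp: path_shape_def)
    moreover have "side (rev ms1) + side ms2 \<le> 4" if "?ms = ms1 @ ms2" for ms1 ms2
      using path_ex_rho_degree[OF 1 that] le by force
    ultimately have "listed (lpath ?ms) \<or> listed (lpath (rev ?ms))" by (rule path_labels_listed)
    moreover have "labelled_iso (G, f) (lpath ?ms)" using 1 labelled_iso_lpath by blast
    moreover have "labelled_iso (G, f) (lpath (rev ?ms))"
    proof -
      have "path_shape (rev vs)" "map f (elist (rev vs)) = rev ?ms"
        using 1 by (simp_all add: path_shape_def elist_rev rev_map)
      then show ?thesis using labelled_iso_lpath by blast
    qed
    ultimately show ?thesis unfolding classified_def by blast
  next
    case (2 vs)
    have d2: "degree G v = 2" if "v \<in> verts G" for v by (rule cycle_degree[OF 2 that])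
    \<comment> \<open>On a cycle no edge is simple, so an edge with another label would contribute
      at least 4 by itself, and the second edge at the same vertex adds at least 1.\<close>
    have "f e = 3" if e: "e \<in> edges G" for e
    proof (rule ccontr)
      assume ne: "f e \<noteq> 3"
      have "e \<noteq> {}" using edge_card[OF e] by auto
      then obtain x where x: "x \<in> e" by blast
      then have xV: "x \<in> verts G" and ei: "e \<in> incident G x" using e edge_subset by (auto simp: incident_def)
      have "\<exists>e'\<in>incident G x. e' \<noteq> e"
      proof (rule ccontr)
        assume "\<not> ?thesis"
        then have "incident G x = {e}" using ei by blast
        then have "degree G x = card {e}" by (simp only: degree_def)
        then show False using d2[OF xV] by simp
      qed
      then obtain e' where e': "e' \<in> incident G x" "e' \<noteq> e" by blast
      then have "incident G x = {e, e'}" using incident_2[OF d2[OF xV] ei] by blast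
      then have "rho_degree G (f_hat f) x = contrib x e + contrib x e'"
        using e'(2) by (simp add: rho_degree_eq)
      moreover have "contrib x e = 2 * weight (f e)" by (rule degree_2_contrib[OF d2 ei])
      moreover have "2 \<le> weight (f e)" using weight_ge_2[OF label_ge_3[OF e] ne] .
      moreover have "1 \<le> contrib x e'" using contrib_ge_1[OF e'(1)] .
      ultimately show False using le[OF xV] by linarith
    qed
    then have f3: "f ` edges G \<subseteq> {3}" by blast
    have n: "3 \<le> length vs" using 2 by (simp add: cycle_shape_def)
    have "labelled_iso (G, f) (cycle_graph (length vs), \<lambda>_. 3)"
      unfolding labelled_iso_cycle[OF n] using 2 f3 by blast
    moreover have "listed (cycle_graph (length vs), \<lambda>_. 3)"
    proof -
      have l: "2 \<le> length vs - 1" "length vs - 1 + 1 = length vs" using n by simp_all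
      show ?thesis unfolding listed_def using list_IV.A[OF l(1)] unfolding l(2) by (rule UnI2)
    qed
    ultimately show ?thesis unfolding classified_def by blast
  qed
qed

lemma belongs_to_list_III_or_IV:
  assumes "\<And>v. v \<in> verts G \<Longrightarrow> rho_degree G (f_hat f) v \<le> 4"
  shows "belongs_to (G, f) list_III \<or> belongs_to (G, f) list_IV"
proof -
  have classified
    using classified_degree_3[OF assms] classified_path_or_cycle[OF assms]
    by (metis not_less_eq_eq numeral_2_eq_2 numeral_3_eq_3)
  then show ?thesis by (auto simp: classified_def listed_def belongs_to_def)
qed

end

theorem proposition4:
  fixes \<Gamma> :: "'a ugraph" and f :: "'a set \<Rightarrow> enat"
  assumes "coxeter_graph \<Gamma> f"
    and "connected_graph \<Gamma>"
  shows "(belongs_to (\<Gamma>, f) list_III \<longleftrightarrow>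
            (\<forall>x\<in>verts \<Gamma>. rho_degree \<Gamma> (f_hat f) x < 4)) \<and>
         (belongs_to (\<Gamma>, f) list_IV \<longleftrightarrow>
            (\<forall>x\<in>verts \<Gamma>. rho_degree \<Gamma> (f_hat f) x \<le> 4) \<and>
            (\<exists>y\<in>verts \<Gamma>. rho_degree \<Gamma> (f_hat f) y = 4))"
proof -
  interpret coxeter \<Gamma> f using assms by unfold_locales
  \<comment> \<open>For the converses, the classification leaves two lists: membership in IV would
    supply a vertex of degree 4 and contradict condition (1), and membership in III would make all
    degrees smaller than 4 and contradict condition (2).\<close>
  show ?thesis
    using list_III_rho_degree list_IV_rho_degree belongs_to_list_III_or_IV by (metis less_eq_real_def order_less_irrefl)
qed

end
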